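(* Let $M$ be a loopless matroid of rank $d+1$ on $E$. Then $(A^\bullet(M),\int_M,\mathscr K_M)$ satisfies $\operatorname{HL}^{\le1}_{\mathscr K_M}$ and $\operatorname{HR}^{\le1}_{\mathscr K_M}$: for every $\ell\in\mathscr K_M$ and $i\in\{0,1\}$ with $i\le\lfloor d/2\rfloor$, multiplication by $\ell^{d-2i}:A^i(M)\to A^{d-i}(M)$ is an isomorphism, and the form $(-1)^i\int_M xy\ell^{d-2i}$ is positive definite on $P^i_\ell=\{z\in A^i(M): \ell^{d-2i+1}z=0\}$.
   Context: $A^\bullet(M)=\mathbb R[x_F: F\text{ nonempty proper flat}]/(\langle x_Fx_{F'}: F,F'\text{ incomparable}\rangle+\langle\sum_{F\ni i}x_F-\sum_{F\ni j}x_F: i,j\in E\rangle)$ with degree map $\int_M:A^d(M)\to\mathbb R$, $\int_Mx_{F_1}\cdots x_{F_d}=1$ for every maximal chain of nonempty proper flats. A divisor class $\sum_Fc_Fx_F\in A^1(M)$ is combinatorially ample if there is a function $a:2^E\to\mathbb R$ with $a_\emptyset=a_E=0$, $a_F=c_F$ for all nonempty proper flats $F$, and $a_A+a_B>a_{A\cup B}+a_{A\cap B}$ for all incomparable $A,B\subseteq E$ (and $\ge$ for all $A,B$). $\mathscr K_M\subseteq A^1(M)$ is the cone of combinatorially ample classes. *)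

theory Defs
  imports Complex_Main "HOL-Library.Poly_Mapping"
begin

definition matroid_rank :: "'a set \<Rightarrow> ('a set \<Rightarrow> nat) \<Rightarrow> bool" where
  "matroid_rank E r \<longleftrightarrow> finite E
     \<and> (\<forall>X. X \<subseteq> E \<longrightarrow> r X \<le> card X)
     \<and> (\<forall>X Y. X \<subseteq> Y \<and> Y \<subseteq> E \<longrightarrow> r X \<le> r Y)
     \<and> (\<forall>X Y. X \<subseteq> E \<and> Y \<subseteq> E \<longrightarrow> r (X \<union> Y) + r (X \<inter> Y) \<le> r X + r Y)"

definition loopless :: "'a set \<Rightarrow> ('a set \<Rightarrow> nat) \<Rightarrow> bool" where
  "loopless E r \<longleftrightarrow> (\<forall>e\<in>E. r {e} = 1)"

definition is_flat :: "'a set \<Rightarrow> ('a set \<Rightarrow> nat) \<Rightarrow> 'a set \<Rightarrow> bool" where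
  "is_flat E r F \<longleftrightarrow> F \<subseteq> E \<and> (\<forall>e \<in> E - F. r (insert e F) > r F)"

definition np_flats :: "'a set \<Rightarrow> ('a set \<Rightarrow> nat) \<Rightarrow> 'a set set" where
  "np_flats E r = {F. is_flat E r F \<and> F \<noteq> {} \<and> F \<noteq> E}"

type_synonym 'a cpoly = "('a set \<Rightarrow>\<^sub>0 nat) \<Rightarrow>\<^sub>0 real"

definition var :: "'a set \<Rightarrow> 'a cpoly" where
  "var F = Poly_Mapping.single (Poly_Mapping.single F 1) 1"

definition const :: "real \<Rightarrow> 'a cpoly" where
  "const c = Poly_Mapping.single 0 c"

definition vars_in :: "'a set set \<Rightarrow> 'a cpoly \<Rightarrow> bool" where
  "vars_in V p \<longleftrightarrow> (\<forall>m \<in> Poly_Mapping.keys p. Poly_Mapping.keys m \<subseteq> V)"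

definition homog :: "nat \<Rightarrow> 'a cpoly \<Rightarrow> bool" where
  "homog i p \<longleftrightarrow> (\<forall>m \<in> Poly_Mapping.keys p. (\<Sum>F\<in>Poly_Mapping.keys m. Poly_Mapping.lookup m F) = i)"

definition ideal_gen :: "'a set set \<Rightarrow> 'a cpoly set \<Rightarrow> 'a cpoly set" where
  "ideal_gen V G = {(\<Sum>g\<in>S. h g * g) | S h. finite S \<and> S \<subseteq> G \<and> (\<forall>g\<in>S. vars_in V (h g))}"

definition chow_gens :: "'a set \<Rightarrow> ('a set \<Rightarrow> nat) \<Rightarrow> 'a cpoly set" where
  "chow_gens E r =
     {var F * var G | F G. F \<in> np_flats E r \<and> G \<in> np_flats E r \<and> \<not> F \<subseteq> G \<and> \<not> G \<subseteq> F}
   \<union> {(\<Sum>F\<in>{F\<in>np_flats E r. i \<in> F}. var F) - (\<Sum>F\<in>{F\<in>np_flats E r. j \<in> F}. var F) | i j.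
        i \<in> E \<and> j \<in> E}"

definition chow_ideal :: "'a set \<Rightarrow> ('a set \<Rightarrow> nat) \<Rightarrow> 'a cpoly set" where
  "chow_ideal E r = ideal_gen (np_flats E r) (chow_gens E r)"

text \<open>Representatives of degree-i classes: homogeneous degree-i polynomials in the x_F.\<close>
definition chow_hom :: "'a set \<Rightarrow> ('a set \<Rightarrow> nat) \<Rightarrow> nat \<Rightarrow> 'a cpoly set" where
  "chow_hom E r i = {p. vars_in (np_flats E r) p \<and> homog i p}"

definition max_chain :: "'a set \<Rightarrow> ('a set \<Rightarrow> nat) \<Rightarrow> 'a set set \<Rightarrow> bool" where
  "max_chain E r C \<longleftrightarrow> C \<subseteq> np_flats E r
     \<and> (\<forall>F\<in>C. \<forall>G\<in>C. F \<subseteq> G \<or> G \<subseteq> F)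
     \<and> (\<forall>H\<in>np_flats E r - C. \<exists>F\<in>C. \<not> F \<subseteq> H \<and> \<not> H \<subseteq> F)"

definition chow_deg :: "'a set \<Rightarrow> ('a set \<Rightarrow> nat) \<Rightarrow> 'a cpoly \<Rightarrow> real" where
  "chow_deg E r = (THE \<phi>.
      (\<forall>p\<in>chow_hom E r (r E - 1). \<forall>q\<in>chow_hom E r (r E - 1). \<phi> (p + q) = \<phi> p + \<phi> q)
    \<and> (\<forall>c. \<forall>p\<in>chow_hom E r (r E - 1). \<phi> (const c * p) = c * \<phi> p)
    \<and> (\<forall>p\<in>chow_hom E r (r E - 1) \<inter> chow_ideal E r. \<phi> p = 0)
    \<and> (\<forall>C. max_chain E r C \<longrightarrow> \<phi> (\<Prod>F\<in>C. var F) = 1)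
    \<and> (\<forall>p. p \<notin> chow_hom E r (r E - 1) \<longrightarrow> \<phi> p = 0))"

text \<open>Combinatorially ample: a function a on all subsets of E, vanishing at the empty set
  and E, strictly submodular on incomparable pairs (and submodular on all pairs). The
  ample class it defines is sum of a_F x_F over nonempty proper flats F.\<close>
definition comb_ample_fun :: "'a set \<Rightarrow> ('a set \<Rightarrow> real) \<Rightarrow> bool" where
  "comb_ample_fun E a \<longleftrightarrow> a {} = 0 \<and> a E = 0
     \<and> (\<forall>A B. A \<subseteq> E \<and> B \<subseteq> E \<longrightarrow> a A + a B \<ge> a (A \<union> B) + a (A \<inter> B))
     \<and> (\<forall>A B. A \<subseteq> E \<and> B \<subseteq> E \<and> \<not> A \<subseteq> B \<and> \<not> B \<subseteq> A
              \<longrightarrow> a A + a B > a (A \<union> B) + a (A \<inter> B))"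

definition divisor :: "'a set \<Rightarrow> ('a set \<Rightarrow> nat) \<Rightarrow> ('a set \<Rightarrow> real) \<Rightarrow> 'a cpoly" where
  "divisor E r a = (\<Sum>F\<in>np_flats E r. const (a F) * var F)"

end

theory Submission
  imports Defs "HOL-Library.Multiset" "HOL-Analysis.Function_Topology" "HOL-Analysis.Convex"
begin

text \<open>
The degree map is built by principal truncations: in the basis h_G of indicator functions of the flats
above G, a product of d divisors has degree \<open>\<plusminus>\<close>1 or 0 according to whether the matroid truncated
successively along the flats G stays loopless. As truncations commute, this is symmetric, and the relations
of the Chow ring can be checked in rank 3.

The Hodge-Riemann relations in degree at most 1 are proved by induction on the dimension of the link of a
chain of flats. By strict submodularity an ample class restricts to a positive combination of the variables
of the link, so the relations for the links of the vertices give an operator inequality \<open>A \<le> A A\<close> for the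
intersection form, normalised so that 1 is a Perron eigenvector. Since 1 - A is the Laplacian of a connected
graph, A has exactly one positive eigenvalue. The induction starts in dimension 2, where the
form is computed. Poincare duality between degrees 1 and d - 1 is elementary: a numerically trivial divisor is
modular, and degree d - 1 is spanned, modulo relations coming from exchanging one flat in a chain,
by one chain for each flat of rank at least 2 (the ground set included).
\<close>

section \<open>Flats of a matroid\<close>

text \<open>\<open>chow_deg\<close> is a definite description, so a degree map must be shown to
  exist and to be unique. Existence is the construction of \<open>D\<close>. Its arguments are
  functions on flats instead of single variables, so that a linear relation becomes a statement
  about one Moebius coefficient. Up to \<open>chow_deg_eq\<close> only the resulting functional
  \<open>dg\<close> is used; uniqueness comes from the same exchange of flats that gives duality.
  The link of a chain belongs to a product of minors. To avoid minors and products, every statement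
  about a link is made in the one Chow ring, by multiplying with the monomial
  \<open>X \<sigma>\<close> of the chain. Negative semidefiniteness alone would not give
  injectivity, and the form on a link can be degenerate on polynomials. The induction therefore also
  carries the equality case: a primitive divisor of square zero pairs to zero with everything.
  Duality turns this into membership in the ideal. Surjectivity is linear algebra with functionals
  instead of a dimension count, which is why duality is needed starting from degree d - 1 as well as
  from degree 1.\<close>

definition cl :: "'a set \<Rightarrow> ('a set \<Rightarrow> nat) \<Rightarrow> 'a set \<Rightarrow> 'a set" where
  "cl E r X = {e \<in> E. r (insert e X) = r X}"

definition fl :: "'a set \<Rightarrow> ('a set \<Rightarrow> nat) \<Rightarrow> 'a set set" where
  "fl E r = {F. is_flat E r F \<and> F \<noteq> {}}"

locale matroid =
  fixes E :: "'a set" and r :: "'a set \<Rightarrow> nat"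
  assumes matroid_rank: "matroid_rank E r"
begin

lemma finite_E [simp]: "finite E"
  using matroid_rank by (simp add: matroid_rank_def)

lemma rank_le_card: "X \<subseteq> E \<Longrightarrow> r X \<le> card X"
  using matroid_rank by (simp add: matroid_rank_def)

lemma rank_mono: "X \<subseteq> Y \<Longrightarrow> Y \<subseteq> E \<Longrightarrow> r X \<le> r Y"
  using matroid_rank by (simp add: matroid_rank_def)

lemma rank_submod: "X \<subseteq> E \<Longrightarrow> Y \<subseteq> E \<Longrightarrow> r (X \<union> Y) + r (X \<inter> Y) \<le> r X + r Y"
  using matroid_rank by (simp add: matroid_rank_def)

lemma rank_empty [simp]: "r {} = 0"
  using rank_le_card[of "{}"] by simp

lemma rank_insert_le: "e \<in> E \<Longrightarrow> X \<subseteq> E \<Longrightarrow> r (insert e X) \<le> Suc (r X)"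
  using rank_submod[of "{e}" X] rank_le_card[of "{e}"] by simp

lemma rank_insert_mono:
  assumes "r (insert e X) = r X" "X \<subseteq> Y" "Y \<subseteq> E" "e \<in> E"
  shows "r (insert e Y) = r Y"
proof -
  have X: "X \<subseteq> E" using assms by blast
  have "insert e X \<union> Y = insert e Y" using assms by blast
  then have "r (insert e Y) + r (insert e X \<inter> Y) \<le> r X + r Y"
    using rank_submod[of "insert e X" Y] assms X by simp
  moreover have "r X \<le> r (insert e X \<inter> Y)" by (rule rank_mono) (use assms in auto)
  moreover have "r Y \<le> r (insert e Y)" by (rule rank_mono) (use assms in auto)
  ultimately show ?thesis by linarith
qed

lemma rank_union_eq:
  assumes "X \<subseteq> E" "Y \<subseteq> E" "\<And>e. e \<in> Y \<Longrightarrow> r (insert e X) = r X"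
  shows "r (X \<union> Y) = r X"
proof -
  have "finite Y" using assms(2) finite_E finite_subset by blast
  then show ?thesis using assms(2,3)
  proof (induction Y)
    case (insert e Y)
    have "r (insert e (X \<union> Y)) = r (X \<union> Y)"
      by (rule rank_insert_mono[of _ X]) (use insert assms(1) in auto)
    then show ?case using insert by simp
  qed simp
qed

lemma cl_subset: "cl E r X \<subseteq> E"
  by (auto simp: cl_def)

lemma subset_cl: "X \<subseteq> E \<Longrightarrow> X \<subseteq> cl E r X"
  by (auto simp: cl_def insert_absorb)

lemma rank_cl: "X \<subseteq> E \<Longrightarrow> r (cl E r X) = r X"
  using rank_union_eq[of X "cl E r X"] subset_cl[of X] cl_subset[of X]
  by (simp add: Un_absorb1) (auto simp: cl_def)

lemma flat_cl: "X \<subseteq> E \<Longrightarrow> is_flat E r (cl E r X)"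
proof -
  assume X: "X \<subseteq> E"
  have "r (insert e (cl E r X)) > r (cl E r X)" if e: "e \<in> E - cl E r X" for e
  proof -
    have "r (insert e X) \<noteq> r X" using e by (auto simp: cl_def)
    moreover have "r X \<le> r (insert e X)" by (rule rank_mono) (use X e in auto)
    moreover have "r (insert e X) \<le> r (insert e (cl E r X))"
      by (rule rank_mono) (use X e subset_cl[OF X] cl_subset in auto)
    ultimately show ?thesis using rank_cl[OF X] by linarith
  qed
  then show ?thesis using cl_subset by (auto simp: is_flat_def)
qed

lemma flat_subset: "is_flat E r F \<Longrightarrow> F \<subseteq> E"
  by (simp add: is_flat_def)

lemma flat_finite: "is_flat E r F \<Longrightarrow> finite F"
  using flat_subset finite_E finite_subset by blast

lemma flat_insert: "is_flat E r F \<Longrightarrow> e \<in> E \<Longrightarrow> e \<notin> F \<Longrightarrow> r (insert e F) = Suc (r F)"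
proof -
  assume F: "is_flat E r F" and e: "e \<in> E" "e \<notin> F"
  then have "r F < r (insert e F)" unfolding is_flat_def by blast
  then show ?thesis using rank_insert_le[OF e(1) flat_subset[OF F]] by linarith
qed

lemma cl_mono_flat: "is_flat E r F \<Longrightarrow> X \<subseteq> F \<Longrightarrow> cl E r X \<subseteq> F"
proof
  fix e assume F: "is_flat E r F" "X \<subseteq> F" and "e \<in> cl E r X"
  then have e: "e \<in> E" "r (insert e X) = r X" by (auto simp: cl_def)
  have "r (insert e F) = r F" by (rule rank_insert_mono[OF e(2)]) (use F e in \<open>auto simp: is_flat_def\<close>)
  then show "e \<in> F" using flat_insert[OF F(1) e(1)] by auto
qed

lemma flat_E: "is_flat E r E"
  by (simp add: is_flat_def)

lemma flat_rank_less: "is_flat E r F \<Longrightarrow> G \<subseteq> E \<Longrightarrow> F \<subset> G \<Longrightarrow> r F < r G"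
proof -
  assume F: "is_flat E r F" "G \<subseteq> E" "F \<subset> G"
  then obtain e where e: "e \<in> G" "e \<notin> F" by blast
  have "r F < r (insert e F)" using F e flat_insert[of F e] by auto
  also have "\<dots> \<le> r G" by (rule rank_mono) (use F e in auto)
  finally show ?thesis .
qed

lemma flat_eqI: "is_flat E r F \<Longrightarrow> G \<subseteq> E \<Longrightarrow> F \<subseteq> G \<Longrightarrow> r G \<le> r F \<Longrightarrow> F = G"
  using flat_rank_less[of F G] by auto

lemma cl_eq_flat: "is_flat E r F \<Longrightarrow> X \<subseteq> F \<Longrightarrow> r F \<le> r X \<Longrightarrow> cl E r X = F"
  by (rule flat_eqI[OF flat_cl]) 
    (use flat_subset[of F] cl_mono_flat[of F X] rank_cl[of X] in auto)

lemma rank_cl_insert: "is_flat E r F \<Longrightarrow> e \<in> E \<Longrightarrow> e \<notin> F \<Longrightarrow> r (cl E r (insert e F)) = Suc (r F)"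
  using flat_insert[of F e] rank_cl[of "insert e F"] flat_subset[of F] by simp

lemma mem_cl_insert: "F \<subseteq> E \<Longrightarrow> e \<in> E \<Longrightarrow> insert e F \<subseteq> cl E r (insert e F)"
  using subset_cl[of "insert e F"] by blast

text \<open>Truncation along a set only sees the ranks of unions with it, so truncating along a set
  or along its closure is the same. \<open>D_Cons2\<close> relies on this.\<close>

lemma rank_union_cl:
  assumes XY: "X \<subseteq> E" "Y \<subseteq> E"
  shows "r (cl E r X \<union> Y) = r (X \<union> Y)"
proof -
  have "r ((X \<union> Y) \<union> cl E r X) = r (X \<union> Y)"
  proof (rule rank_union_eq)
    fix e assume "e \<in> cl E r X"
    then have e: "e \<in> E" "r (insert e X) = r X" unfolding cl_def by blast+
    show "r (insert e (X \<union> Y)) = r (X \<union> Y)"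
      by (rule rank_insert_mono[OF e(2)]) (use XY e(1) in blast)+
  qed (use XY cl_subset in blast)+
  moreover have "X \<union> Y \<union> cl E r X = cl E r X \<union> Y" using subset_cl[OF XY(1)] by blast
  ultimately show ?thesis by metis
qed

lemma flat_between:
  assumes "is_flat E r H" "is_flat E r K" "H \<subseteq> K" "r H \<le> j" "j \<le> r K"
  shows "\<exists>G. is_flat E r G \<and> H \<subseteq> G \<and> G \<subseteq> K \<and> r G = j"
  using assms(4,5)
proof (induction j rule: dec_induct)
  case base
  then show ?case using assms by blast
next
  case (step j)
  then obtain G where G: "is_flat E r G" "H \<subseteq> G" "G \<subseteq> K" "r G = j" by auto
  then have "G \<noteq> K" using step by auto
  then obtain e where e: "e \<in> K" "e \<notin> G" using G by blast
  have eE: "e \<in> E" using e assms(2) flat_subset by blast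
  have "cl E r (insert e G) \<subseteq> K" using cl_mono_flat[OF assms(2), of "insert e G"] e G by auto
  moreover have "insert e G \<subseteq> cl E r (insert e G)" using mem_cl_insert G(1) eE flat_subset by blast
  moreover have "is_flat E r (cl E r (insert e G))" using flat_cl[of "insert e G"] eE G(1) flat_subset by auto
  ultimately show ?case using rank_cl_insert[OF G(1) eE e(2)] G by (intro exI[of _ "cl E r (insert e G)"]) auto
qed

lemma finite_flats [simp]: "finite (fl E r)" "finite (np_flats E r)"
proof -
  have "fl E r \<subseteq> Pow E" "np_flats E r \<subseteq> Pow E" by (auto simp: fl_def np_flats_def is_flat_def)
  then show "finite (fl E r)" "finite (np_flats E r)" using finite_subset[of _ "Pow E"] by auto
qed

text \<open>The partition property of flats: a cover of H is the closure of H with any one of its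
  new elements, so distinct covers share none.\<close>

lemma flat_cover_unique:
  assumes "is_flat E r H" "is_flat E r F" "H \<subseteq> F" "r F = Suc (r H)" "e \<in> F" "e \<notin> H"
  shows "F = cl E r (insert e H)"
proof -
  have "e \<in> E" using assms flat_subset by blast
  then show ?thesis
  using cl_eq_flat[of F "insert e H"] flat_insert[of H e] assms by auto
qed

end

locale loopless_matroid = matroid +
  assumes loopless: "loopless E r"
begin

lemma rank_singleton: "e \<in> E \<Longrightarrow> r {e} = 1"
  using loopless by (simp add: loopless_def)

lemma rank_pos: "X \<subseteq> E \<Longrightarrow> X \<noteq> {} \<Longrightarrow> r X \<ge> 1"
proof -
  assume X: "X \<subseteq> E" "X \<noteq> {}"
  then obtain e where e: "e \<in> X" by blast
  then have "r {e} \<le> r X" by (intro rank_mono) (use X in auto)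
  then show ?thesis using rank_singleton[of e] e X by auto
qed

lemma flat_empty: "is_flat E r {}"
  by (simp add: is_flat_def rank_singleton)

lemma np_flat: "F \<in> np_flats E r \<Longrightarrow> is_flat E r F" by (simp add: np_flats_def)

lemma np_subset: "F \<in> np_flats E r \<Longrightarrow> F \<subseteq> E" by (simp add: np_flats_def is_flat_def)

lemma np_rank: "F \<in> np_flats E r \<Longrightarrow> 1 \<le> r F \<and> r F < r E"
  using rank_pos[of F] flat_rank_less[of F E] by (auto simp: np_flats_def is_flat_def)

lemma npI: "is_flat E r F \<Longrightarrow> 1 \<le> r F \<Longrightarrow> r F < r E \<Longrightarrow> F \<in> np_flats E r"
  by (auto simp: np_flats_def)

end

section \<open>Principal truncation and the degree form\<close>

text \<open>Moebius inversion over P ordered by inclusion, as a recursion. The guard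
  \<open>finite G\<close> makes \<open>card\<close> a termination measure; in a
  \<open>finite_family\<close> it always holds.\<close>

function mob :: "'a set set \<Rightarrow> ('a set \<Rightarrow> real) \<Rightarrow> 'a set \<Rightarrow> real" where
  "mob P y G = y G - (\<Sum>H\<in>{H\<in>P. finite G \<and> H \<subset> G}. mob P y H)"
  by auto
termination
  by (relation "measure (\<lambda>(P, y, G). card G)") (auto intro: psubset_card_mono)

declare mob.simps [simp del]

locale finite_family =
  fixes P :: "'a set set"
  assumes finite_P: "finite P" and finite_mem: "G \<in> P \<Longrightarrow> finite G"
begin

lemma mob_sum:
  assumes "H \<in> P"
  shows "(\<Sum>G\<in>{G\<in>P. G \<subseteq> H}. mob P y G) = y H"
proof -
  have "{G\<in>P. G \<subseteq> H} = insert H {G\<in>P. finite H \<and> G \<subset> H}" using assms finite_mem by auto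
  then have "(\<Sum>G\<in>{G\<in>P. G \<subseteq> H}. mob P y G) = mob P y H + (\<Sum>G\<in>{G\<in>P. finite H \<and> G \<subset> H}. mob P y G)"
    using finite_P by simp
  then show ?thesis using mob.simps[of P y H] by simp
qed

lemma mob_unique:
  assumes "\<And>H. H \<in> P \<Longrightarrow> (\<Sum>G\<in>{G\<in>P. G \<subseteq> H}. f G) = y H" "G \<in> P"
  shows "mob P y G = f G"
  using assms(2)
proof (induction "card G" arbitrary: G rule: less_induct)
  case less
  have eq: "{H\<in>P. H \<subseteq> G} = insert G {H\<in>P. finite G \<and> H \<subset> G}" using less finite_mem by auto
  have "(\<Sum>H\<in>{H\<in>P. H \<subseteq> G}. f H) = f G + (\<Sum>H\<in>{H\<in>P. finite G \<and> H \<subset> G}. f H)"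
    unfolding eq using finite_P by simp
  moreover have "(\<Sum>H\<in>{H\<in>P. finite G \<and> H \<subset> G}. f H) = (\<Sum>H\<in>{H\<in>P. finite G \<and> H \<subset> G}. mob P y H)"
  proof (rule sum.cong)
    fix H assume "H \<in> {H\<in>P. finite G \<and> H \<subset> G}"
    then show "f H = mob P y H" using less(1)[of H] psubset_card_mono[of G H] by simp
  qed simp
  ultimately show ?case using assms(1)[OF less(2)] mob.simps[of P y G] by simp
qed

lemma mob_cong: "(\<And>H. H \<in> P \<Longrightarrow> y H = z H) \<Longrightarrow> G \<in> P \<Longrightarrow> mob P y G = mob P z G"
  by (rule mob_unique) (auto simp: mob_sum)

lemma mob_add: "G \<in> P \<Longrightarrow> mob P (\<lambda>H. y H + z H) G = mob P y G + mob P z G"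
  by (rule mob_unique) (auto simp: mob_sum sum.distrib)

lemma mob_scale: "G \<in> P \<Longrightarrow> mob P (\<lambda>H. c * y H) G = c * mob P y G"
  by (rule mob_unique) (auto simp: mob_sum simp flip: sum_distrib_left)

text \<open>Change of poset along a left adjoint c of the inclusion of a subfamily P'.\<close>
lemma mob_push:
  assumes sub: "P' \<subseteq> P" and c: "\<And>G. G \<in> P \<Longrightarrow> c G \<in> P'"
    and adj: "\<And>G H. G \<in> P \<Longrightarrow> H \<in> P' \<Longrightarrow> c G \<subseteq> H \<longleftrightarrow> G \<subseteq> H"
  shows "(\<Sum>K\<in>P'. mob P' z K * \<Phi> K) = (\<Sum>G\<in>P. mob P z G * \<Phi> (c G))"
proof -
  interpret P': finite_family P'
    using finite_P finite_mem sub by unfold_locales (auto intro: finite_subset)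
  \<comment> \<open>By adjunction the G below H are exactly those whose image \<open>c G\<close> is
    below H, so summing the inverse over the fibres of \<open>c\<close> solves the inversion problem
    on \<open>P'\<close>.\<close>
  have mob': "mob P' z K = (\<Sum>G\<in>{G\<in>P. c G = K}. mob P z G)" if "K \<in> P'" for K
  proof (rule P'.mob_unique[OF _ that])
    fix H assume H: "H \<in> P'"
    have "(\<Sum>K\<in>{K\<in>P'. K \<subseteq> H}. \<Sum>G\<in>{G\<in>P. c G = K}. mob P z G)
        = (\<Sum>K\<in>{K\<in>P'. K \<subseteq> H}. \<Sum>G\<in>{G\<in>{G\<in>P. G \<subseteq> H}. c G = K}. mob P z G)"
      by (intro sum.cong refl) (use adj H in auto)
    also have "\<dots> = (\<Sum>G\<in>{G\<in>P. G \<subseteq> H}. mob P z G)"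
      by (rule sum.group) (use finite_P P'.finite_P c adj H in auto)
    also have "\<dots> = z H" using mob_sum H sub by auto
    finally show "(\<Sum>K\<in>{K\<in>P'. K \<subseteq> H}. \<Sum>G\<in>{G\<in>P. c G = K}. mob P z G) = z H" .
  qed
  have "(\<Sum>K\<in>P'. mob P' z K * \<Phi> K) = (\<Sum>K\<in>P'. \<Sum>G\<in>{G\<in>P. c G = K}. mob P z G * \<Phi> (c G))"
    by (intro sum.cong refl) (simp add: mob' sum_distrib_right)
  also have "\<dots> = (\<Sum>G\<in>P. mob P z G * \<Phi> (c G))"
    by (rule sum.group) (use finite_P P'.finite_P c in auto)
  finally show ?thesis .
qed

end

text \<open>The truncated subtraction is harmless when G has rank at least 1.\<close>
definition tr :: "'a set \<Rightarrow> ('a set \<Rightarrow> nat) \<Rightarrow> 'a set \<Rightarrow> nat" where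
  "tr G r X = min (r X) (r (X \<union> G) - 1)"

text \<open>Either order gives the minimum of r X, r (X \<union> G) - 1, r (X \<union> H) - 1 and r
  (X \<union> G \<union> H) - 2.\<close>

lemma tr_commute: "tr G (tr H r) = tr H (tr G r)"
proof
  fix X
  have "min (min a (b - 1)) (min c (d - 1) - 1) = min (min a (c - 1)) (min b (d - 1) - 1)"
    for a b c d :: nat
  proof -
    have "min u v - 1 = min (u - 1) (v - 1)" for u v :: nat by (simp add: min_def)
    then show ?thesis by (simp add: min.assoc min.left_commute)
  qed
  moreover
  have "X \<union> G \<union> H = X \<union> H \<union> G" by blast
  ultimately show "tr G (tr H r) X = tr H (tr G r) X" unfolding tr_def by simp
qed

lemma (in matroid) tr_eq: 
  assumes "G \<subseteq> E" "X \<subseteq> E"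
  shows "tr G r X = (if r (X \<union> G) = r X then r X - 1 else r X)"
  using rank_mono[of X "X \<union> G"] assms by (auto simp: tr_def)

lemma (in matroid) tr_matroid:
  assumes G: "G \<subseteq> E" "r G \<ge> 1"
  shows "matroid_rank E (tr G r)"
proof -
  have "tr G r X \<le> tr G r Y" if XY: "X \<subseteq> Y" "Y \<subseteq> E" for X Y
  proof -
    have "r X \<le> r Y" "r (X \<union> G) \<le> r (Y \<union> G)" by (intro rank_mono; use XY G in auto)+
    then show ?thesis unfolding tr_def by linarith
  qed
  moreover have "tr G r (X \<union> Y) + tr G r (X \<inter> Y) \<le> tr G r X + tr G r Y"
    if XY: "X \<subseteq> E" "Y \<subseteq> E" for X Y
  proof -
    have m: "r X \<le> r (X \<union> Y)" "r Y \<le> r (X \<union> Y)" "r (X \<inter> Y) \<le> r X" "r (X \<inter> Y) \<le> r Y"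
      "r G \<le> r (X \<union> G)" "r G \<le> r (Y \<union> G)" "r (X \<union> Y) \<le> r (X \<union> Y \<union> G)"
      "r (X \<inter> Y) \<le> r (X \<inter> Y \<union> G)" "r X \<le> r (X \<union> G)" "r Y \<le> r (Y \<union> G)"
      "r G \<le> r (X \<inter> Y \<union> G)" "r G \<le> r (X \<union> Y \<union> G)"
      by (intro rank_mono; use XY G in auto)+
    have s0: "r (X \<union> Y) + r (X \<inter> Y) \<le> r X + r Y" using rank_submod XY by blast
    have s1: "r (X \<union> Y \<union> G) + r (X \<inter> Y \<union> G) \<le> r (X \<union> G) + r (Y \<union> G)"
    proof -
      have "(X \<union> G) \<union> (Y \<union> G) = X \<union> Y \<union> G" "(X \<union> G) \<inter> (Y \<union> G) = X \<inter> Y \<union> G" by blast+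
      then show ?thesis using rank_submod[of "X \<union> G" "Y \<union> G"] XY G by simp
    qed
    have s2: "r (X \<union> Y \<union> G) + r X \<le> r (X \<union> Y) + r (X \<union> G)"
    proof -
      have "r ((X \<union> Y) \<union> (X \<union> G)) + r ((X \<union> Y) \<inter> (X \<union> G)) \<le> r (X \<union> Y) + r (X \<union> G)"
        by (rule rank_submod) (use XY G in auto)
      moreover have "r X \<le> r ((X \<union> Y) \<inter> (X \<union> G))" by (rule rank_mono) (use XY G in auto)
      moreover have "(X \<union> Y) \<union> (X \<union> G) = X \<union> Y \<union> G" by blast
      ultimately show ?thesis by simp
    qed
    have s3: "r (X \<union> Y \<union> G) + r Y \<le> r (X \<union> Y) + r (Y \<union> G)"
    proof -
      have "r ((X \<union> Y) \<union> (Y \<union> G)) + r ((X \<union> Y) \<inter> (Y \<union> G)) \<le> r (X \<union> Y) + r (Y \<union> G)"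
        by (rule rank_submod) (use XY G in auto)
      moreover have "r Y \<le> r ((X \<union> Y) \<inter> (Y \<union> G))" by (rule rank_mono) (use XY G in auto)
      moreover have "(X \<union> Y) \<union> (Y \<union> G) = X \<union> Y \<union> G" by blast
      ultimately show ?thesis by simp
    qed
    have s4: "r (Z \<union> G) + r (X \<inter> Y) \<le> r Z + r (X \<inter> Y \<union> G)" if Z: "Z = X \<or> Z = Y" for Z
    proof -
      have "r (Z \<union> (X \<inter> Y \<union> G)) + r (Z \<inter> (X \<inter> Y \<union> G)) \<le> r Z + r (X \<inter> Y \<union> G)"
        by (rule rank_submod) (use XY G Z in auto)
      moreover have "r (X \<inter> Y) \<le> r (Z \<inter> (X \<inter> Y \<union> G))" by (rule rank_mono) (use XY G Z in auto)
      moreover have "Z \<union> (X \<inter> Y \<union> G) = Z \<union> G" using Z by blast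
      ultimately show ?thesis by simp
    qed
    \<comment> \<open>Primes denote ranks after adding G; a stands for the union, b for the
      intersection. A value drops when adding G gains nothing. The delicate case is that x and y
      drop but b does not: then b < b', and submodularity of the primed ranks supplies the missing
      unit. The bounds by 1 keep the subtraction exact.\<close>
    have ar: "(if a' = a then a - 1 else a) + (if b' = b then b - 1 else b)
          \<le> (if x' = x then x - 1 else x) + (if y' = y then y - 1 else y)"
      if "a + b \<le> x + y" "a' + b' \<le> x' + y'" "a' + x \<le> a + x'" "a' + y \<le> a + y'"
        "x' + b \<le> x + b'" "y' + b \<le> y + b'" "a \<le> a'" "b \<le> b'" "1 \<le> x'" "1 \<le> y'" "x \<le> x'" "y \<le> y'"
        "1 \<le> a'" "1 \<le> b'" for a b x y a' b' x' y' :: nat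
      using that by (cases "a' = a"; cases "b' = b"; cases "x' = x"; cases "y' = y"; simp; linarith)
    have p: "X \<union> Y \<subseteq> E" "X \<inter> Y \<subseteq> E" using XY by auto
    show ?thesis
      unfolding tr_eq[OF G(1) XY(1)] tr_eq[OF G(1) XY(2)] tr_eq[OF G(1) p(1)] tr_eq[OF G(1) p(2)]
      by (rule ar) (use m s0 s1 s2 s3 s4 G(2) in auto)
  qed
  moreover have "tr G r X \<le> card X" if "X \<subseteq> E" for X
    using rank_le_card[OF that] by (simp add: tr_def)
  ultimately show ?thesis unfolding matroid_rank_def by auto
qed

context loopless_matroid
begin

text \<open>Truncating along a flat of rank 1 would turn its elements into loops. The threshold 2
  reappears as the guard in \<open>D\<close>.\<close>

lemma tr_loopless:
  assumes G: "G \<subseteq> E" "r G \<ge> 2"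
  shows "loopless_matroid E (tr G r)"
proof -
  have "tr G r {e} = 1" if e: "e \<in> E" for e
  proof -
    have "r G \<le> r ({e} \<union> G)" by (rule rank_mono) (use G e in auto)
    then show ?thesis using rank_singleton[OF e] G unfolding tr_def by auto
  qed
  then show ?thesis using tr_matroid[of G] G
    by unfold_locales (auto simp: loopless_def)
qed

lemma flat_tr: 
  assumes "G \<subseteq> E" "is_flat E (tr G r) F"
  shows "is_flat E r F"
proof -
  have F: "F \<subseteq> E" using assms(2) by (simp add: is_flat_def)
  have "r (insert e F) > r F" if e: "e \<in> E - F" for e
  proof (rule ccontr)
    assume "\<not> r F < r (insert e F)"
    moreover have "r F \<le> r (insert e F)" by (rule rank_mono) (use e F in auto)
    ultimately have eq: "r (insert e F) = r F" by simp
    have "r (insert e (F \<union> G)) = r (F \<union> G)"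
      by (rule rank_insert_mono[OF eq]) (use assms F e in auto)
    then have "tr G r (insert e F) = tr G r F" using eq by (simp add: tr_def)
    then show False using assms(2) e unfolding is_flat_def by (metis less_irrefl)
  qed
  then show ?thesis using F by (auto simp: is_flat_def)
qed

lemma fl_tr: "G \<subseteq> E \<Longrightarrow> fl E (tr G r) \<subseteq> fl E r"
  using flat_tr by (auto simp: fl_def)

lemma finite_family_fl: "finite_family (fl E r)"
  using finite_flats(1) by unfold_locales (auto simp: fl_def flat_finite)

sublocale ff: finite_family "fl E r"
  by (rule finite_family_fl)

end

text \<open>The mixed degree of divisors on the matroid r. The Moebius inverse of y gives its coefficients in
  the functions that are 1 on the flats containing G. Modulo linear functions these are - h_G, hence 0 if G
  has rank 1, and h_G acts as truncation along G.\<close>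
fun D :: "'a set \<Rightarrow> ('a set \<Rightarrow> nat) \<Rightarrow> ('a set \<Rightarrow> real) list \<Rightarrow> real" where
  "D E r [] = 1"
| "D E r (y # ys) = - (\<Sum>G\<in>{G\<in>fl E r. 2 \<le> r G}. mob (fl E r) y G * D E (tr G r) ys)"

lemma fl_cong: "(\<And>X. X \<subseteq> E \<Longrightarrow> r X = r' X) \<Longrightarrow> fl E r = fl E r'"
  unfolding fl_def is_flat_def by (intro Collect_cong) auto

lemma D_cong:
  assumes "\<And>X. X \<subseteq> E \<Longrightarrow> r X = r' X"
  shows "D E r ys = D E r' ys"
  using assms
proof (induction ys arbitrary: r r')
  case (Cons y ys)
  have fl: "fl E r = fl E r'" using Cons(2) by (rule fl_cong)
  have sub: "G \<subseteq> E" if "G \<in> fl E r'" for G using that by (auto simp: fl_def is_flat_def)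
  have "{G\<in>fl E r. 2 \<le> r G} = {G\<in>fl E r'. 2 \<le> r' G}"
    using fl sub Cons(2) by auto
  moreover have "D E (tr G r) ys = D E (tr G r') ys" if "G \<in> fl E r'" for G
    by (rule Cons(1)) (use Cons(2) sub[OF that] in \<open>auto simp: tr_def\<close>)
  ultimately show ?case using fl by auto
qed simp

section \<open>Symmetry of the mixed degree\<close>

context loopless_matroid
begin

lemma D_Cons: "D E r (y # ys) = - (\<Sum>G\<in>fl E r. mob (fl E r) y G * (if 2 \<le> r G then D E (tr G r) ys else 0))"
  by (simp add: sum.inter_filter if_distrib cong: if_cong)

lemma fl_subset: "G \<in> fl E r \<Longrightarrow> G \<subseteq> E"
  by (simp add: fl_def is_flat_def)

text \<open>The inner recursion runs over the flats of \<open>tr G r\<close>, which depend on G.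
  Closure in \<open>tr G r\<close> is left adjoint to the inclusion of these flats into those of r,
  so \<open>mob_push\<close> pulls the inner sum back and both arguments are expanded over the same
  flats.\<close>

lemma D_Cons2:
  "D E r (y # z # ys) = (\<Sum>G\<in>fl E r. \<Sum>G'\<in>fl E r. mob (fl E r) y G * mob (fl E r) z G' *
     (if 2 \<le> r G \<and> 2 \<le> tr G r G' then D E (tr G' (tr G r)) ys else 0))"
proof -
  have "mob (fl E r) y G * (if 2 \<le> r G then D E (tr G r) (z # ys) else 0)
     = - (\<Sum>G'\<in>fl E r. mob (fl E r) y G * mob (fl E r) z G' *
     (if 2 \<le> r G \<and> 2 \<le> tr G r G' then D E (tr G' (tr G r)) ys else 0))" if G: "G \<in> fl E r" for G
  proof (cases "2 \<le> r G")
    case True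
    then interpret t: loopless_matroid E "tr G r" using tr_loopless fl_subset[OF G] by blast
    define \<Phi> where "\<Phi> K = (if 2 \<le> tr G r K then D E (tr K (tr G r)) ys else 0)" for K
    have \<Phi>: "\<Phi> (cl E (tr G r) K) = \<Phi> K" if K: "K \<in> fl E r" for K
    proof -
      have "D E (tr (cl E (tr G r) K) (tr G r)) ys = D E (tr K (tr G r)) ys"
      proof (rule D_cong)
        fix X assume "X \<subseteq> E"
        then show "tr (cl E (tr G r) K) (tr G r) X = tr K (tr G r) X"
          using t.rank_union_cl[of K X] fl_subset[OF K] unfolding tr_def[of _ "tr G r"] by (simp add: Un_commute)
      qed
      then show ?thesis unfolding \<Phi>_def using t.rank_cl[of K] fl_subset[OF K] by simp
    qed
    have "D E (tr G r) (z # ys) = - (\<Sum>K\<in>fl E (tr G r). mob (fl E (tr G r)) z K * \<Phi> K)"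
      unfolding t.D_Cons \<Phi>_def ..
    also have "\<dots> = - (\<Sum>G'\<in>fl E r. mob (fl E r) z G' * \<Phi> (cl E (tr G r) G'))"
    proof (subst ff.mob_push[where c = "cl E (tr G r)"])
      show "fl E (tr G r) \<subseteq> fl E r" using fl_tr fl_subset[OF G] by blast
    next
      fix K assume K: "K \<in> fl E r"
      then show "cl E (tr G r) K \<in> fl E (tr G r)"
        using t.flat_cl[of K] t.subset_cl[of K] fl_subset[OF K] by (auto simp: fl_def)
      fix H assume H: "H \<in> fl E (tr G r)"
      then show "cl E (tr G r) K \<subseteq> H \<longleftrightarrow> K \<subseteq> H"
        using t.cl_mono_flat[of H K] t.subset_cl[of K] fl_subset[OF K] by (auto simp: fl_def)
    qed simp
    also have "\<dots> = - (\<Sum>G'\<in>fl E r. mob (fl E r) z G' * \<Phi> G')"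
      using \<Phi> by simp
    finally show ?thesis using True by (simp add: sum_distrib_left \<Phi>_def mult.assoc)
  qed simp
  then show ?thesis unfolding D_Cons[of y] by (simp add: sum_negf)
qed

text \<open>In \<open>D_Cons2\<close> the guard says that both flats have rank at least 2 and their
  union rank at least 3, which is symmetric; the truncations commute.\<close>

lemma D_swap: "D E r (y # z # ys) = D E r (z # y # ys)"
proof -
  have c: "2 \<le> r G \<and> 2 \<le> tr G r G' \<longleftrightarrow> 2 \<le> r G' \<and> 2 \<le> tr G' r G" for G G'
    by (auto simp: tr_def Un_commute)
  show ?thesis
    unfolding D_Cons2[of y] D_Cons2[of z]
    by (subst sum.swap, intro sum.cong refl) (use c in \<open>auto simp: tr_commute\<close>)
qed

lemma D_cong_tail:
  assumes "\<And>r'. loopless_matroid E r' \<Longrightarrow> r' E = r E - 1 \<Longrightarrow> D E r' ys = D E r' zs"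
  shows "D E r (y # ys) = D E r (y # zs)"
proof -
  have "D E (tr G r) ys = D E (tr G r) zs" if G: "G \<in> fl E r" "2 \<le> r G" for G
  proof (rule assms)
    show "loopless_matroid E (tr G r)" using tr_loopless fl_subset G by blast
    show "tr G r E = r E - 1" using fl_subset[OF G(1)] by (simp add: tr_def Un_absorb2)
  qed
  then show ?thesis by simp
qed

end

lemma D_move:
  "loopless_matroid E r \<Longrightarrow> D E r (xs @ y # ys) = D E r (y # xs @ ys)"
proof (induction xs arbitrary: r)
  case (Cons x xs)
  interpret loopless_matroid E r by fact
  have "D E r (x # (xs @ y # ys)) = D E r (x # (y # xs @ ys))"
    by (rule D_cong_tail) (use Cons in blast)
  also have "\<dots> = D E r (y # x # xs @ ys)" by (rule D_swap)
  finally show ?case by simp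
qed simp

lemma D_perm:
  assumes "loopless_matroid E r" "mset ys = mset zs"
  shows "D E r ys = D E r zs"
  using assms
proof (induction ys arbitrary: r zs)
  case (Cons y ys)
  interpret loopless_matroid E r by fact
  have "y \<in> set zs" using Cons(3) mset_eq_setD[of "y # ys" zs] by auto
  then obtain us vs where zs: "zs = us @ y # vs" by (meson split_list)
  have "D E r (y # ys) = D E r (y # (us @ vs))"
    by (rule D_cong_tail) (use Cons zs in simp)
  then show ?case using D_move[OF Cons(2), of us y vs] zs by simp
qed simp

abbreviation xi :: "'a set \<Rightarrow> 'a set \<Rightarrow> real" where
  "xi F \<equiv> (\<lambda>H. if H = F then 1 else 0)"

section \<open>Linearity, relations and normalisation of the mixed degree\<close>

context loopless_matroid
begin

lemma D_head_cong: "(\<And>F. F \<in> fl E r \<Longrightarrow> y F = z F) \<Longrightarrow> D E r (y # ys) = D E r (z # ys)"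
  using ff.mob_cong[of y z] by simp

lemma D_head_add: "D E r ((\<lambda>H. y H + z H) # ys) = D E r (y # ys) + D E r (z # ys)"
  by (simp add: ff.mob_add ring_distribs sum.distrib)

lemma D_head_scale: "D E r ((\<lambda>H. c * y H) # ys) = c * D E r (y # ys)"
  by (simp add: ff.mob_scale mult.assoc sum_distrib_left)

lemma D_head_zero: "D E r ((\<lambda>H. 0) # ys) = 0"
  using D_head_scale[of 0 "\<lambda>H. 0" ys] by simp

lemma D_head_sum: "finite S \<Longrightarrow> D E r ((\<lambda>H. \<Sum>s\<in>S. y s H) # ys) = (\<Sum>s\<in>S. D E r (y s # ys))"
proof (induction S rule: finite_induct)
  case empty
  then show ?case using D_head_zero by simp
next
  case (insert s S)
  then show ?case by (simp add: D_head_add del: D.simps)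
qed

lemma cl_singleton_fl: "i \<in> E \<Longrightarrow> cl E r {i} \<in> fl E r \<and> r (cl E r {i}) = 1"
  using flat_cl[of "{i}"] subset_cl[of "{i}"] rank_cl[of "{i}"] rank_singleton by (auto simp: fl_def)

text \<open>This is the indicator of the flats above the rank one flat cl {i}, so its only Moebius
  coefficient sits where \<open>D\<close> has no term. It is the source of the linear
  relations.\<close>

lemma D_head_modular:
  assumes i: "i \<in> E"
  shows "D E r ((\<lambda>H. if i \<in> H then 1 else 0) # ys) = 0"
proof -
  let ?p = "cl E r {i}"
  have "mob (fl E r) (\<lambda>H. if i \<in> H then 1 else 0) G = (if G = ?p then 1 else 0)" if "G \<in> fl E r" for G
  proof (rule ff.mob_unique[OF _ that])
    fix H assume H: "H \<in> fl E r"
    then have "?p \<subseteq> H \<longleftrightarrow> i \<in> H"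
      using cl_mono_flat[of H "{i}"] subset_cl[of "{i}"] i by (auto simp: fl_def)
    then show "(\<Sum>G\<in>{G \<in> fl E r. G \<subseteq> H}. if G = ?p then 1 else 0) = (if i \<in> H then 1 else (0::real))"
      using cl_singleton_fl[OF i] by (simp add: sum.delta)
  qed
  then show ?thesis using cl_singleton_fl[OF i] by (auto intro!: sum.neutral)
qed

lemma fl_rank_pos: "F \<in> fl E r \<Longrightarrow> 1 \<le> r F"
  using rank_pos[of F] fl_subset[of F] by (auto simp: fl_def)

text \<open>Distinct flats of rank at least 2 join to E, so the only excluded pair is a line taken
  twice. The double sum becomes a product of coefficient sums minus a diagonal over the lines: one
  positive square against one negative square per line.\<close>

lemma D_rank3:
  assumes r3: "r E = 3"
  shows "D E r [y, z] =
    (y E - (\<Sum>p\<in>{p\<in>fl E r. r p = 1}. y p)) * (z E - (\<Sum>p\<in>{p\<in>fl E r. r p = 1}. z p))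
    - (\<Sum>L\<in>{L\<in>fl E r. r L = 2}. (y L - (\<Sum>p\<in>{p\<in>fl E r. r p = 1 \<and> p \<subseteq> L}. y p))
         * (z L - (\<Sum>p\<in>{p\<in>fl E r. r p = 1 \<and> p \<subseteq> L}. z p)))"
proof -
  let ?c = "mob (fl E r)"
  let ?Q = "{G\<in>fl E r. 2 \<le> r G}"
  have pt: "?c u p = u p" if "p \<in> fl E r" "r p = 1" for u p
  proof -
    have "{G\<in>fl E r. G \<subseteq> p} = {p}"
    proof -
      have "G = p" if "G \<in> fl E r" "G \<subseteq> p" for G
        using flat_eqI[of G p] that(2) fl_subset[OF \<open>p \<in> fl E r\<close>] fl_rank_pos[OF that(1)] \<open>r p = 1\<close> that(1)
        by (simp add: fl_def)
      then show ?thesis using that by auto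
    qed
    then show ?thesis using ff.mob_sum[OF that(1), of u] by simp
  qed
  have ln: "?c u L = u L - (\<Sum>p\<in>{p\<in>fl E r. r p = 1 \<and> p \<subseteq> L}. u p)" if L: "L \<in> fl E r" "r L = 2" for u L
  proof -
    have "{G\<in>fl E r. G \<subseteq> L} = insert L {p\<in>fl E r. r p = 1 \<and> p \<subseteq> L}"
    proof -
      have "G = L \<or> r G = 1" if G: "G \<in> fl E r" "G \<subseteq> L" for G
      proof -
        have "G \<noteq> L \<Longrightarrow> r G < r L" using G flat_rank_less[of G L] fl_subset[OF L(1)] by (simp add: fl_def psubset_eq)
        then show ?thesis using fl_rank_pos[OF G(1)] L(2) by linarith
      qed
      then show ?thesis using L by auto
    qed
    then have "u L = ?c u L + (\<Sum>p\<in>{p\<in>fl E r. r p = 1 \<and> p \<subseteq> L}. ?c u p)"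
      using ff.mob_sum[OF L(1), of u] L by simp
    then show ?thesis using pt by simp
  qed
  have Efl: "E \<in> fl E r" using r3 rank_empty flat_E by (auto simp: fl_def)
  have Y: "(\<Sum>G\<in>?Q. ?c u G) = u E - (\<Sum>p\<in>{p\<in>fl E r. r p = 1}. u p)" for u
  proof -
    have "{G\<in>fl E r. G \<subseteq> E} = ?Q \<union> {p\<in>fl E r. r p = 1}"
      using fl_subset fl_rank_pos by force
    moreover have "(\<Sum>G\<in>?Q \<union> {p\<in>fl E r. r p = 1}. ?c u G) = (\<Sum>G\<in>?Q. ?c u G) + (\<Sum>p\<in>{p\<in>fl E r. r p = 1}. ?c u p)"
      by (rule sum.union_disjoint) auto
    ultimately show ?thesis using ff.mob_sum[OF Efl, of u] pt by simp
  qed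
  have cond: "2 \<le> tr G r H \<longleftrightarrow> 2 \<le> r H \<and> \<not> (G = H \<and> r G = 2)" if G: "G \<in> ?Q" and H: "H \<in> fl E r" for G H
  proof (cases "2 \<le> r H \<and> G \<noteq> H")
    case True
    have fG: "is_flat E r G" "is_flat E r H" "2 \<le> r G" "2 \<le> r H" "G \<union> H \<subseteq> E"
      using G H True fl_subset by (auto simp: fl_def)
    have "G \<subset> G \<union> H \<or> H \<subset> G \<union> H" using True by blast
    then have "2 < r (G \<union> H)"
    proof
      assume "G \<subset> G \<union> H"
      from flat_rank_less[OF fG(1,5) this] show ?thesis using fG by linarith
    next
      assume "H \<subset> G \<union> H"
      from flat_rank_less[OF fG(2,5) this] show ?thesis using fG by linarith
    qed
    then have "2 < r (H \<union> G)" by (simp add: Un_commute)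
    then show ?thesis using True by (auto simp: tr_def)
  next
    case False
    have "r H \<le> 3" using rank_mono[of H E] fl_subset[OF H] r3 by simp
    then show ?thesis using False G by (auto simp: tr_def)
  qed
  define A where "A u G = (if 2 \<le> r G then ?c u G else 0)" for u G
  define C where "C G = (if r G = 2 then ?c y G * ?c z G else 0)" for G
  have A: "(\<Sum>G\<in>fl E r. A u G) = (\<Sum>G\<in>?Q. ?c u G)" for u
    unfolding A_def by (rule sum.inter_filter[OF finite_flats(1), symmetric])
  have "D E r [y, z] = (\<Sum>G\<in>fl E r. \<Sum>H\<in>fl E r. A y G * A z H - (if G = H then C G else 0))"
    unfolding D_Cons2
  proof (intro sum.cong refl)
    fix G H assume GH: "G \<in> fl E r" "H \<in> fl E r"
    show "?c y G * ?c z H * (if 2 \<le> r G \<and> 2 \<le> tr G r H then D E (tr H (tr G r)) [] else 0)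
        = A y G * A z H - (if G = H then C G else 0)"
    proof (cases "2 \<le> r G")
      case True
      then have "2 \<le> tr G r H \<longleftrightarrow> 2 \<le> r H \<and> \<not> (G = H \<and> r G = 2)" using cond GH by blast
      then show ?thesis using True by (simp add: A_def C_def)
    next
      case False
      then show ?thesis by (auto simp: A_def C_def)
    qed
  qed
  also have "\<dots> = (\<Sum>G\<in>fl E r. A y G) * (\<Sum>H\<in>fl E r. A z H) - (\<Sum>G\<in>fl E r. C G)"
    by (simp add: sum_subtractf sum_product sum.delta)
  also have "(\<Sum>G\<in>fl E r. C G) = (\<Sum>L\<in>{L\<in>fl E r. r L = 2}. ?c y L * ?c z L)"
    unfolding C_def by (rule sum.inter_filter[OF finite_flats(1), symmetric])
  also have "\<dots> = (\<Sum>L\<in>{L\<in>fl E r. r L = 2}. (y L - (\<Sum>p\<in>{p\<in>fl E r. r p = 1 \<and> p \<subseteq> L}. y p))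
         * (z L - (\<Sum>p\<in>{p\<in>fl E r. r p = 1 \<and> p \<subseteq> L}. z p)))"
    by (rule sum.cong) (simp_all add: ln)
  finally show ?thesis unfolding A Y .
qed

lemma D_not_flat: "F \<notin> fl E r \<Longrightarrow> D E r (xi F # ys) = 0"
  using D_head_cong[of "xi F" "\<lambda>H. 0" ys] D_head_zero[of ys] by force

lemma D_incomparable_rank3:
  assumes r3: "r E = 3" and FG: "F \<subseteq> E" "G \<subseteq> E" "\<not> F \<subseteq> G" "\<not> G \<subseteq> F"
  shows "D E r [xi F, xi G] = 0"
proof (cases "F \<in> fl E r \<and> G \<in> fl E r")
  case False
  then show ?thesis
    using D_not_flat[of F "[xi G]"] D_not_flat[of G "[xi F]"] D_swap[of "xi F" "xi G" "[]"] by metis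
next
  case True
  let ?p = "\<lambda>F. if r F = 1 then 1 else (0::real)"
  let ?v = "\<lambda>F L. (if F = L then 1 else 0) - (if r F = 1 \<and> F \<subseteq> L then 1 else (0::real))"
  have flat: "is_flat E r F" "is_flat E r G" using True by (auto simp: fl_def)
  have pt: "(\<Sum>p\<in>{p\<in>fl E r. r p = 1}. xi F p) = ?p F" if "F \<in> fl E r" for F
    using that by (simp add: sum.delta)
  have ln: "xi F L - (\<Sum>p\<in>{p\<in>fl E r. r p = 1 \<and> p \<subseteq> L}. xi F p) = ?v F L" if "F \<in> fl E r" for F L
    using that by (simp add: sum.delta)
  have E: "F \<noteq> E" "G \<noteq> E" using FG by auto
  then have "F \<subset> E" "G \<subset> E" using FG by auto
  then have "r F < 3" "r G < 3"
    using flat_rank_less[OF flat(1) order_refl] flat_rank_less[OF flat(2) order_refl] r3 by metis+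
  then have rk: "r F = 1 \<or> r F = 2" "r G = 1 \<or> r G = 2"
    using fl_rank_pos[of F] fl_rank_pos[of G] True by linarith+
  have "D E r [xi F, xi G] = ?p F * ?p G - (\<Sum>L\<in>{L\<in>fl E r. r L = 2}. ?v F L * ?v G L)"
    unfolding D_rank3[OF r3] ln[OF conjunct1[OF True]] ln[OF conjunct2[OF True]]
      pt[OF conjunct1[OF True]] pt[OF conjunct2[OF True]] using E by simp
  \<comment> \<open>For two points the product 1 cancels against the unique line joining them.
    Otherwise everything vanishes: an incomparable point and line are not incident, and two
    incomparable lines are distinct.\<close>
  also have "\<dots> = 0"
  proof (cases "r F = 1 \<and> r G = 1")
    case both: True
    have r2: "r (F \<union> G) = 2"
    proof -
      have "r (F \<union> G) + r (F \<inter> G) \<le> 2" using rank_submod[of F G] FG both by simp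
      moreover have "r F < r (F \<union> G)" using flat_rank_less[OF flat(1), of "F \<union> G"] FG by auto
      ultimately show ?thesis using both by linarith
    qed
    have c: "cl E r (F \<union> G) \<in> fl E r" "r (cl E r (F \<union> G)) = 2" "F \<union> G \<subseteq> cl E r (F \<union> G)"
      using flat_cl[of "F \<union> G"] rank_cl[of "F \<union> G"] subset_cl[of "F \<union> G"] FG r2 by (auto simp: fl_def)
    have eq: "L = cl E r (F \<union> G)" if "L \<in> fl E r" "r L = 2" "F \<union> G \<subseteq> L" for L
      using cl_eq_flat[of L "F \<union> G"] that r2 by (simp add: fl_def)
    have "(\<Sum>L\<in>{L\<in>fl E r. r L = 2}. ?v F L * ?v G L)
        = (\<Sum>L\<in>{L\<in>fl E r. r L = 2}. if L = cl E r (F \<union> G) then 1 else 0)"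
    proof (intro sum.cong refl)
      fix L assume "L \<in> {L\<in>fl E r. r L = 2}"
      then have "F \<subseteq> L \<and> G \<subseteq> L \<longleftrightarrow> L = cl E r (F \<union> G)" and "F \<noteq> L" "G \<noteq> L"
        using eq[of L] c(3) both by auto
      then show "?v F L * ?v G L = (if L = cl E r (F \<union> G) then 1 else 0)"
        using both by (cases "F \<subseteq> L"; cases "G \<subseteq> L") simp_all
    qed
    also have "\<dots> = 1" using c by (simp add: sum.delta)
    finally show ?thesis using both by simp
  next
    case nb: False
    have z: "?v F L * ?v G L = 0" if "r L = 2" for L
      using FG nb rk that by auto
    have "(\<Sum>L\<in>{L\<in>fl E r. r L = 2}. ?v F L * ?v G L) = 0"
      by (rule sum.neutral) (use z in blast)
    then show ?thesis using nb by auto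
  qed
  finally show ?thesis .
qed

end

text \<open>By symmetry the pair can go last; each truncation along a member of \<open>xs\<close>
  lowers the rank by one, down to 3. F and G are mere subsets because a truncation can destroy
  flats.\<close>

lemma D_incomparable:
  assumes "loopless_matroid E r" "r E = length xs + 3" "F \<subseteq> E" "G \<subseteq> E" "\<not> F \<subseteq> G" "\<not> G \<subseteq> F"
  shows "D E r (xi F # xi G # xs) = 0"
proof -
  have "D E r (xs @ [xi F, xi G]) = 0"
    using assms(1,2)
  proof (induction xs arbitrary: r)
    case Nil
    then show ?case using loopless_matroid.D_incomparable_rank3[OF Nil(1)] assms(3-) by simp
  next
    case (Cons x xs)
    interpret loopless_matroid E r by fact
    have "D E (tr H r) (xs @ [xi F, xi G]) = 0" if H: "H \<in> fl E r" "2 \<le> r H" for H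
    proof (rule Cons(1))
      show "loopless_matroid E (tr H r)" using tr_loopless fl_subset H by blast
      show "tr H r E = length xs + 3" using fl_subset[OF H(1)] Cons(3) by (simp add: tr_def Un_absorb2)
    qed
    then show ?case by simp
  qed
  moreover have "D E r (xi F # xi G # xs) = D E r (xs @ [xi F, xi G])"
    by (rule D_perm[OF assms(1)]) simp
  ultimately show ?thesis by simp
qed

text \<open>The flag is listed from the hyperplane down. Only truncation along E contributes; it
  cuts off the top rank and leaves the rest a complete flag.\<close>

lemma D_flag:
  assumes "loopless_matroid E r" "r E = length Fs + 1" "\<And>F. F \<in> set Fs \<Longrightarrow> is_flat E r F"
    "sorted_wrt (\<lambda>A B. B \<subset> A) Fs" "map r Fs = rev [1..<Suc (length Fs)]"
  shows "D E r (map xi Fs) = 1"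
  using assms
proof (induction Fs arbitrary: r)
  case (Cons F Fs)
  interpret loopless_matroid E r by fact
  let ?\<Phi> = "\<lambda>G. if 2 \<le> r G then D E (tr G r) (map xi Fs) else 0"
  have F: "is_flat E r F" "r F = Suc (length Fs)" "map r Fs = rev [1..<Suc (length Fs)]"
    using Cons.prems(3,5) by auto
  have rE: "r E = Suc (Suc (length Fs))" using Cons.prems(2) by simp
  have Ffl: "F \<in> fl E r" "E \<in> fl E r" "F \<noteq> E" using F rE flat_E by (auto simp: fl_def)
  have "mob (fl E r) (xi F) G = (if G = F then 1 else 0) - (if G = E then 1 else 0)" if "G \<in> fl E r" for G
  proof (rule ff.mob_unique[OF _ that])
    fix H assume H: "H \<in> fl E r"
    have "E = H" if "F \<subseteq> H" "H \<noteq> F"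
    proof -
      have "r F < r H" using flat_rank_less[OF F(1) fl_subset[OF H]] that by blast
      then have "r E \<le> r H" using F rE by simp
      then show ?thesis using flat_eqI[of H E] H fl_subset[OF H] by (auto simp: fl_def)
    qed
    then have "F \<subseteq> H \<longleftrightarrow> H = F \<or> H = E" using fl_subset[OF Ffl(1)] by auto
    moreover have "E \<subseteq> H \<longleftrightarrow> H = E" using fl_subset[OF H] by auto
    ultimately show "(\<Sum>G\<in>{G \<in> fl E r. G \<subseteq> H}. (if G = F then 1 else 0) - (if G = E then 1 else 0))
        = (if H = F then 1 else (0::real))"
      using Ffl by (auto simp: sum_subtractf sum.delta)
  qed
  then have "D E r (map xi (F # Fs)) = - (\<Sum>G\<in>fl E r. ((if G = F then 1 else 0) - (if G = E then 1 else 0)) * ?\<Phi> G)"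
    unfolding list.map D_Cons by simp
  also have "\<dots> = - (\<Sum>G\<in>fl E r. (if G = F then ?\<Phi> G else 0) - (if G = E then ?\<Phi> G else 0))"
    by (intro arg_cong[where f = uminus] sum.cong refl) simp
  also have "\<dots> = ?\<Phi> E - ?\<Phi> F"
    using Ffl by (simp add: sum_subtractf sum.delta)
  \<comment> \<open>Truncation along F puts all of F into the closure of the next flat, which
    thereby stops being a flat. If no flat is left, F has rank 1 and the guard applies.\<close>
  also have "?\<Phi> F = 0"
  proof (cases Fs)
    case Nil
    then show ?thesis using F by simp
  next
    case (Cons F' Fs')
    then have F': "is_flat E r F'" "F' \<subset> F" "r F' = length Fs"
      using Cons.prems(3,4) F(3) by auto
    then obtain e where e: "e \<in> F" "e \<notin> F'" by auto
    have eE: "e \<in> E" using e Ffl fl_subset by blast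
    have "insert e F' \<union> F = F" "F' \<union> F = F" using e F' by auto
    then have "tr F r (insert e F') \<le> tr F r F'" unfolding tr_def using F F' by simp
    then have "\<not> is_flat E (tr F r) F'" unfolding is_flat_def using e eE by (meson DiffI not_le)
    moreover have "2 \<le> r F \<Longrightarrow> loopless_matroid E (tr F r)" using tr_loopless fl_subset Ffl by blast
    ultimately show ?thesis using loopless_matroid.D_not_flat[of E "tr F r" F'] Cons by (auto simp: fl_def simp del: D.simps)
  qed
  also have "?\<Phi> E = 1"
  proof -
    have trE: "tr E r X = min (r X) (Suc (length Fs))" if "X \<subseteq> E" for X
      using that rE by (simp add: tr_def Un_absorb1)
    have rk: "r A \<le> length Fs" if "A \<in> set Fs" for A
    proof -
      have "r A \<in> set (map r Fs)" using that by simp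
      then show ?thesis unfolding F(3) by auto
    qed
    have "D E (tr E r) (map xi Fs) = 1"
    proof (rule Cons.IH)
      show "loopless_matroid E (tr E r)" using tr_loopless[of E] rE by simp
      show "tr E r E = length Fs + 1" using trE[of E] rE by simp
      show "sorted_wrt (\<lambda>A B. B \<subset> A) Fs" using Cons.prems(4) by simp
      have "map (tr E r) Fs = map r Fs"
      proof (rule map_cong[OF refl])
        fix A assume A: "A \<in> set Fs"
        then have "A \<subseteq> E" using Cons.prems(3) flat_subset by simp
        then show "tr E r A = r A" using trE rk[OF A] by simp
      qed
      then show "map (tr E r) Fs = rev [1..<Suc (length Fs)]" using F by simp
      fix A assume A: "A \<in> set Fs"
      then have fA: "is_flat E r A" using Cons.prems(3) by simp
      show "is_flat E (tr E r) A" unfolding is_flat_def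
      proof (intro conjI ballI)
        show "A \<subseteq> E" using fA flat_subset by blast
        fix e assume e: "e \<in> E - A"
        then have "insert e A \<subseteq> E" "A \<subseteq> E" using fA flat_subset by auto
        then show "tr E r A < tr E r (insert e A)"
          using flat_insert[OF fA, of e] e rk[OF A] trE by simp
      qed
    qed
    then show ?thesis using rE by simp
  qed
  finally show ?case by simp
qed simp

section \<open>Polynomials, the Chow ideal and the degree map\<close>

declare D.simps [simp del]

text \<open>Monomials are spelled as lists because \<open>D\<close> consumes a list. Lists of equal
  monomials have equal multisets, so \<open>D_perm\<close> makes the choice harmless.\<close>

definition mon :: "'a set list \<Rightarrow> ('a set \<Rightarrow>\<^sub>0 nat)" where
  "mon xs = sum_list (map (\<lambda>F. Poly_Mapping.single F 1) xs)"

definition vmon :: "'a set list \<Rightarrow> 'a cpoly" where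
  "vmon xs = prod_list (map var xs)"

lemma mon_simps [simp]: "mon [] = 0" "mon (F # xs) = Poly_Mapping.single F 1 + mon xs"
  by (simp_all add: mon_def)

lemma vmon_simps [simp]: "vmon [] = 1" "vmon (F # xs) = var F * vmon xs"
  by (simp_all add: vmon_def)

lemma lookup_mon: "Poly_Mapping.lookup (mon xs) F = count (mset xs) F"
  by (induction xs) (auto simp: lookup_add lookup_single when_def)

lemma keys_mon [simp]: "Poly_Mapping.keys (mon xs) = set xs"
  by (auto simp: in_keys_iff lookup_mon)

lemma mon_eqD: "mon xs = mon ys \<Longrightarrow> mset xs = mset ys"
  by (intro multiset_eqI) (metis lookup_mon)

lemma sum_lookup_mon: "(\<Sum>F\<in>Poly_Mapping.keys (mon xs). Poly_Mapping.lookup (mon xs) F) = length xs"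
  by (simp add: lookup_mon) (metis size_multiset_overloaded_eq set_mset_mset size_mset)

lemma ex_mon: "\<exists>xs. mon xs = m"
proof -
  have "finite {F. 0 < Poly_Mapping.lookup m F}" by simp
  then have c: "count (Abs_multiset (Poly_Mapping.lookup m)) = Poly_Mapping.lookup m"
    by (rule count_Abs_multiset)
  obtain xs where "mset xs = Abs_multiset (Poly_Mapping.lookup m)" using ex_mset by blast
  then have "mon xs = m" using c by (intro poly_mapping_eqI) (simp add: lookup_mon)
  then show ?thesis by blast
qed

lemma single_mon: "Poly_Mapping.single (mon xs) c = const c * vmon xs"
proof (induction xs)
  case (Cons F xs)
  have "Poly_Mapping.single (mon (F # xs)) c = var F * Poly_Mapping.single (mon xs) c"
    by (simp add: var_def mult_single)
  then show ?case using Cons by (simp add: mult.left_commute)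
qed (simp add: const_def)

lemma const_add: "const (a + b) = const a + const b"
  by (simp add: const_def single_add)

lemma const_mult: "const (a * b) = const a * const b"
  by (simp add: const_def mult_single)

lemma const_0 [simp]: "const 0 = 0" and const_1 [simp]: "const 1 = 1"
  by (simp_all add: const_def)

lemma const_uminus: "const (- a) = - const a"
  by (simp add: const_def single_uminus)

lemma const_sum: "const (\<Sum>s\<in>S. f s) = (\<Sum>s\<in>S. const (f s))"
  by (induction S rule: infinite_finite_induct) (auto simp: const_add)

lemma poly_expand: "p = (\<Sum>m\<in>Poly_Mapping.keys p. Poly_Mapping.single m (Poly_Mapping.lookup p m))"
proof (rule poly_mapping_eqI)
  fix k
  show "Poly_Mapping.lookup p k = Poly_Mapping.lookup (\<Sum>m\<in>Poly_Mapping.keys p. Poly_Mapping.single m (Poly_Mapping.lookup p m)) k"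
    by (auto simp: lookup_sum lookup_single when_def in_keys_iff sum.delta)
qed

section \<open>Homogeneous polynomials in a given set of variables\<close>

definition homs :: "'a set set \<Rightarrow> nat \<Rightarrow> 'a cpoly set" where
  "homs V k = {p. vars_in V p \<and> homog k p}"

lemma chow_hom_eq: "chow_hom E r k = homs (np_flats E r) k"
  by (simp add: chow_hom_def homs_def)

lemma homs_vars: "p \<in> homs V k \<Longrightarrow> vars_in V p"
  by (simp add: homs_def)

lemma vars_in_0 [simp]: "vars_in V 0" by (simp add: vars_in_def)

lemma vars_in_add: "vars_in V p \<Longrightarrow> vars_in V q \<Longrightarrow> vars_in V (p + q)"
  using keys_add[of p q] by (auto simp: vars_in_def)

lemma vars_in_mult: "vars_in V p \<Longrightarrow> vars_in V q \<Longrightarrow> vars_in V (p * q)"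
proof -
  assume pq: "vars_in V p" "vars_in V q"
  show ?thesis unfolding vars_in_def
  proof
    fix m assume "m \<in> Poly_Mapping.keys (p * q)"
    then obtain a b where ab: "a \<in> Poly_Mapping.keys p" "b \<in> Poly_Mapping.keys q" "m = a + b"
      using keys_mult[of p q] by blast
    have "Poly_Mapping.keys m \<subseteq> Poly_Mapping.keys a \<union> Poly_Mapping.keys b"
      unfolding ab(3) by (rule keys_add)
    moreover have "Poly_Mapping.keys a \<subseteq> V" "Poly_Mapping.keys b \<subseteq> V"
      using pq ab unfolding vars_in_def by blast+
    ultimately show "Poly_Mapping.keys m \<subseteq> V" by blast
  qed
qed

lemma vars_in_const [simp]: "vars_in V (const c)"
  by (simp add: vars_in_def const_def)

lemma vars_in_1 [simp]: "vars_in V 1"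
  using vars_in_const[of V 1] by simp

lemma vars_in_var: "F \<in> V \<Longrightarrow> vars_in V (var F)"
  by (simp add: vars_in_def var_def)

lemma vars_in_sum: "(\<And>s. s \<in> S \<Longrightarrow> vars_in V (f s)) \<Longrightarrow> vars_in V (\<Sum>s\<in>S. f s)"
  by (induction S rule: infinite_finite_induct) (auto intro: vars_in_add)

lemma vars_in_power: "vars_in V p \<Longrightarrow> vars_in V (p ^ n)"
  by (induction n) (auto intro: vars_in_mult)

lemma homog_add: "homog k p \<Longrightarrow> homog k q \<Longrightarrow> homog k (p + q)"
  using keys_add[of p q] by (auto simp: homog_def)

lemma homog_mult: "homog j p \<Longrightarrow> homog k q \<Longrightarrow> homog (j + k) (p * q)"
proof -
  assume pq: "homog j p" "homog k q"
  show ?thesis unfolding homog_def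
  proof
    fix m assume "m \<in> Poly_Mapping.keys (p * q)"
    then obtain a b where ab: "a \<in> Poly_Mapping.keys p" "b \<in> Poly_Mapping.keys q" "m = a + b"
      using keys_mult[of p q] by blast
    obtain xs ys where xy: "a = mon xs" "b = mon ys" using ex_mon by metis
    have "m = mon (xs @ ys)" unfolding ab(3) xy by (simp add: mon_def)
    moreover have "length xs = j" "length ys = k"
      using pq ab xy sum_lookup_mon unfolding homog_def by metis+
    ultimately show "(\<Sum>F\<in>Poly_Mapping.keys m. Poly_Mapping.lookup m F) = j + k"
      using sum_lookup_mon[of "xs @ ys"] by simp
  qed
qed

lemma homs_0 [simp]: "0 \<in> homs V k" by (simp add: homs_def homog_def)

lemma homs_add: "p \<in> homs V k \<Longrightarrow> q \<in> homs V k \<Longrightarrow> p + q \<in> homs V k"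
  by (simp add: homs_def vars_in_add homog_add)

lemma homs_mult: "p \<in> homs V j \<Longrightarrow> q \<in> homs V k \<Longrightarrow> p * q \<in> homs V (j + k)"
  by (simp add: homs_def vars_in_mult homog_mult)

lemma homs_const [simp]: "const c \<in> homs V 0"
  by (auto simp: homs_def vars_in_def homog_def const_def)

lemma homs_1 [simp]: "1 \<in> homs V 0"
  using homs_const[of 1] by simp

lemma homs_scale: "p \<in> homs V k \<Longrightarrow> const c * p \<in> homs V k"
  using homs_mult[OF homs_const, of p V k c] by simp

lemma homs_uminus: "p \<in> homs V k \<Longrightarrow> - p \<in> homs V k"
  using homs_scale[of p V k "-1"] by (simp add: const_uminus)

lemma homs_diff: "p \<in> homs V k \<Longrightarrow> q \<in> homs V k \<Longrightarrow> p - q \<in> homs V k"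
  using homs_add[OF _ homs_uminus, of p V k q] by simp

lemma homs_var: "F \<in> V \<Longrightarrow> var F \<in> homs V 1"
  by (simp add: homs_def vars_in_var) (simp add: homog_def var_def)

lemma homs_sum: "(\<And>s. s \<in> S \<Longrightarrow> f s \<in> homs V k) \<Longrightarrow> (\<Sum>s\<in>S. f s) \<in> homs V k"
  by (induction S rule: infinite_finite_induct) (auto intro: homs_add)

lemma homs_power: "p \<in> homs V k \<Longrightarrow> p ^ n \<in> homs V (n * k)"
  by (induction n) (auto intro: homs_mult)

lemma homs_vmon: "set xs \<subseteq> V \<Longrightarrow> vmon xs \<in> homs V (length xs)"
proof (induction xs)
  case (Cons F xs)
  then show ?case using homs_mult[OF homs_var[of F V], of "vmon xs" "length xs"] by simp
qed simp

lemma homs_prod_var: "finite C \<Longrightarrow> C \<subseteq> V \<Longrightarrow> (\<Prod>F\<in>C. var F) \<in> homs V (card C)"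
proof (induction C rule: finite_induct)
  case (insert F C)
  then show ?case using homs_mult[OF homs_var[of F V], of "\<Prod>F\<in>C. var F" "card C"] by simp
qed simp

lemma vars_in_induct [consumes 1, case_names zero step]:
  assumes "vars_in V p" "P 0"
    "\<And>c xs q. set xs \<subseteq> V \<Longrightarrow> P q \<Longrightarrow> P (const c * vmon xs + q)"
  shows "P p"
proof -
  have "P (\<Sum>m\<in>S. Poly_Mapping.single m (Poly_Mapping.lookup p m))"
    if "finite S" "S \<subseteq> Poly_Mapping.keys p" for S
    using that
  proof (induction S rule: finite_induct)
    case (insert m S)
    obtain xs where xs: "mon xs = m" using ex_mon by blast
    have "m \<in> Poly_Mapping.keys p" using insert by auto
    then have "set xs \<subseteq> V" using assms(1) keys_mon[of xs] unfolding vars_in_def xs by blast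
    then show ?case using insert assms(3)[of xs] single_mon[of xs] xs by simp
  qed (simp add: assms)
  then show ?thesis using poly_expand[of p] by (metis finite_keys order_refl)
qed

lemma homs_induct [consumes 1, case_names zero step]:
  assumes "p \<in> homs V k" "P 0"
    "\<And>c xs q. set xs \<subseteq> V \<Longrightarrow> length xs = k \<Longrightarrow> q \<in> homs V k \<Longrightarrow> P q \<Longrightarrow> P (const c * vmon xs + q)"
  shows "P p"
proof -
  have "P (\<Sum>m\<in>S. Poly_Mapping.single m (Poly_Mapping.lookup p m)) \<and>
     (\<Sum>m\<in>S. Poly_Mapping.single m (Poly_Mapping.lookup p m)) \<in> homs V k"
    if "finite S" "S \<subseteq> Poly_Mapping.keys p" for S
    using that
  proof (induction S rule: finite_induct)
    case (insert m S)
    obtain xs where xs: "mon xs = m" using ex_mon by blast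
    have m: "m \<in> Poly_Mapping.keys p" using insert by auto
    then have *: "set xs \<subseteq> V" using assms(1) keys_mon[of xs] unfolding homs_def vars_in_def xs by blast
    have **: "length xs = k" using assms(1) m sum_lookup_mon[of xs] unfolding homs_def homog_def xs by auto
    have "const c * vmon xs \<in> homs V k" for c using homs_scale homs_vmon[OF *] ** by blast
    then show ?case using insert assms(3)[OF * **] single_mon[of xs] xs by (simp add: homs_add)
  qed (simp add: assms)
  then show ?thesis using poly_expand[of p] by (metis finite_keys order_refl)
qed

definition lin_ext :: "(('a set \<Rightarrow>\<^sub>0 nat) \<Rightarrow> real) \<Rightarrow> 'a cpoly \<Rightarrow> real" where
  "lin_ext w p = (\<Sum>m\<in>Poly_Mapping.keys p. Poly_Mapping.lookup p m * w m)"

lemma lin_ext_superset: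
  "finite S \<Longrightarrow> Poly_Mapping.keys p \<subseteq> S \<Longrightarrow> lin_ext w p = (\<Sum>m\<in>S. Poly_Mapping.lookup p m * w m)"
  unfolding lin_ext_def by (rule sum.mono_neutral_left) (auto simp: in_keys_iff)

lemma lin_ext_add: "lin_ext w (p + q) = lin_ext w p + lin_ext w q"
proof -
  let ?S = "Poly_Mapping.keys p \<union> Poly_Mapping.keys q"
  have "lin_ext w (p + q) = (\<Sum>m\<in>?S. Poly_Mapping.lookup (p + q) m * w m)"
    by (rule lin_ext_superset) (use keys_add[of p q] in auto)
  also have "\<dots> = (\<Sum>m\<in>?S. Poly_Mapping.lookup p m * w m) + (\<Sum>m\<in>?S. Poly_Mapping.lookup q m * w m)"
    by (simp add: lookup_add ring_distribs sum.distrib)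
  also have "\<dots> = lin_ext w p + lin_ext w q"
    by (intro arg_cong2[where f = "(+)"] lin_ext_superset[symmetric]) auto
  finally show ?thesis .
qed

lemma lin_ext_single: "lin_ext w (Poly_Mapping.single m c) = c * w m"
  by (simp add: lin_ext_def)

lemma lin_ext_0 [simp]: "lin_ext w 0 = 0"
  by (simp add: lin_ext_def)

lemma lin_ext_sum: "lin_ext w (\<Sum>s\<in>S. f s) = (\<Sum>s\<in>S. lin_ext w (f s))"
  by (induction S rule: infinite_finite_induct) (auto simp: lin_ext_add)

lemma lin_ext_scale: "lin_ext w (const c * p) = c * lin_ext w p"
proof -
  have "const c * p = (\<Sum>m\<in>Poly_Mapping.keys p. Poly_Mapping.single m (c * Poly_Mapping.lookup p m))"
    by (subst poly_expand[of p]) (simp add: const_def mult_single sum_distrib_left)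
  then show ?thesis
    by (simp add: lin_ext_sum lin_ext_single sum_distrib_left mult.assoc) (simp add: lin_ext_def sum_distrib_left)
qed

section \<open>The degree functional and the Chow ideal\<close>

locale chow = loopless_matroid +
  fixes d :: nat
  assumes rank_E: "r E = d + 1"
begin

abbreviation "V \<equiv> np_flats E r"
abbreviation "I \<equiv> chow_ideal E r"

text \<open>The value 0 outside degree d lets linearity and vanishing on the ideal hold without
  homogeneity conditions. \<open>chow_deg_eq\<close> identifies it with \<open>chow_deg\<close> in
  degree d.\<close>

definition dg :: "'a cpoly \<Rightarrow> real" where
  "dg = lin_ext (\<lambda>m. let xs = SOME xs. mon xs = m in if length xs = d then D E r (map xi xs) else 0)"

lemma dg_add: "dg (p + q) = dg p + dg q" by (simp add: dg_def lin_ext_add)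
lemma dg_0 [simp]: "dg 0 = 0" by (simp add: dg_def)
lemma dg_sum: "dg (\<Sum>s\<in>S. f s) = (\<Sum>s\<in>S. dg (f s))" by (simp add: dg_def lin_ext_sum)
lemma dg_scale: "dg (const c * p) = c * dg p" by (simp add: dg_def lin_ext_scale)
lemma dg_uminus: "dg (- p) = - dg p" using dg_scale[of "-1" p] by (simp add: const_uminus)
lemma dg_diff: "dg (p - q) = dg p - dg q" using dg_add[of p "- q"] by (simp add: dg_uminus)

lemma dg_vmon: "dg (vmon xs) = (if length xs = d then D E r (map xi xs) else 0)"
proof -
  let ?ys = "SOME ys. mon ys = mon xs"
  have "mon ?ys = mon xs" by (rule someI[of _ xs]) simp
  then have m: "mset ?ys = mset xs" by (rule mon_eqD)
  then have "length ?ys = length xs" by (metis size_mset)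
  moreover have "D E r (map xi ?ys) = D E r (map xi xs)"
    by (rule D_perm[OF loopless_matroid_axioms]) (simp only: mset_map m)
  ultimately show ?thesis
    using lin_ext_single[of _ "mon xs" 1] single_mon[of xs 1] by (simp add: dg_def Let_def)
qed

lemma ideal_0 [simp]: "0 \<in> I"
  unfolding chow_ideal_def ideal_gen_def by (rule CollectI, rule exI[of _ "{}"]) auto

lemma ideal_add:
  assumes "p \<in> I" "q \<in> I" shows "p + q \<in> I"
proof -
  obtain S h where S: "p = (\<Sum>g\<in>S. h g * g)" "finite S" "S \<subseteq> chow_gens E r" "\<forall>g\<in>S. vars_in V (h g)"
    using assms(1) unfolding chow_ideal_def ideal_gen_def by auto
  obtain T k where T: "q = (\<Sum>g\<in>T. k g * g)" "finite T" "T \<subseteq> chow_gens E r" "\<forall>g\<in>T. vars_in V (k g)"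
    using assms(2) unfolding chow_ideal_def ideal_gen_def by auto
  define f where "f g = (if g \<in> S then h g else 0) + (if g \<in> T then k g else 0)" for g
  have "(\<Sum>g\<in>S\<union>T. f g * g) = (\<Sum>g\<in>S\<union>T. if g \<in> S then h g * g else 0) + (\<Sum>g\<in>S\<union>T. if g \<in> T then k g * g else 0)"
    unfolding f_def sum.distrib[symmetric] by (intro sum.cong refl) (auto simp: ring_distribs)
  also have "(\<Sum>g\<in>S\<union>T. if g \<in> S then h g * g else 0) = p"
    unfolding S(1) by (rule sum.mono_neutral_cong_right) (use S T in auto)
  also have "(\<Sum>g\<in>S\<union>T. if g \<in> T then k g * g else 0) = q"
    unfolding T(1) by (rule sum.mono_neutral_cong_right) (use S T in auto)
  finally have "p + q = (\<Sum>g\<in>S\<union>T. f g * g)" by simp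
  moreover have "\<forall>g\<in>S\<union>T. vars_in V (f g)" unfolding f_def using S T by (auto intro: vars_in_add)
  ultimately show ?thesis unfolding chow_ideal_def ideal_gen_def using S T
    by (intro CollectI exI[of _ "S \<union> T"] exI[of _ f]) auto
qed

lemma ideal_mult:
  assumes "p \<in> I" "vars_in V q" shows "q * p \<in> I"
proof -
  obtain S h where S: "p = (\<Sum>g\<in>S. h g * g)" "finite S" "S \<subseteq> chow_gens E r" "\<forall>g\<in>S. vars_in V (h g)"
    using assms(1) unfolding chow_ideal_def ideal_gen_def by auto
  have "q * p = (\<Sum>g\<in>S. (q * h g) * g)" unfolding S(1) by (simp add: sum_distrib_left mult.assoc)
  then show ?thesis unfolding chow_ideal_def ideal_gen_def using S vars_in_mult[OF assms(2)]
    by (intro CollectI exI[of _ S] exI[of _ "\<lambda>g. q * h g"]) auto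
qed

lemma ideal_gen: "g \<in> chow_gens E r \<Longrightarrow> g \<in> I"
  unfolding chow_ideal_def ideal_gen_def
  by (rule CollectI, rule exI[of _ "{g}"], rule exI[of _ "\<lambda>_. 1"]) auto

lemma ideal_scale: "p \<in> I \<Longrightarrow> const c * p \<in> I"
  by (rule ideal_mult) auto

lemma ideal_uminus: "p \<in> I \<Longrightarrow> - p \<in> I"
  using ideal_scale[of p "-1"] by (simp add: const_uminus)

lemma ideal_diff: "p \<in> I \<Longrightarrow> q \<in> I \<Longrightarrow> p - q \<in> I"
  using ideal_add[OF _ ideal_uminus, of p q] by simp

lemma ideal_sum: "(\<And>s. s \<in> S \<Longrightarrow> f s \<in> I) \<Longrightarrow> (\<Sum>s\<in>S. f s) \<in> I"
  by (induction S rule: infinite_finite_induct) (auto intro: ideal_add)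

lemma incomparable_ideal:
  "F \<in> V \<Longrightarrow> G \<in> V \<Longrightarrow> \<not> F \<subseteq> G \<Longrightarrow> \<not> G \<subseteq> F \<Longrightarrow> var F * var G \<in> I"
  by (rule ideal_gen) (auto simp: chow_gens_def)

definition alpha :: "'a \<Rightarrow> 'a cpoly" where
  "alpha i = (\<Sum>F\<in>{F\<in>V. i \<in> F}. var F)"

lemma alpha_diff_ideal: "i \<in> E \<Longrightarrow> j \<in> E \<Longrightarrow> alpha i - alpha j \<in> I"
  unfolding alpha_def by (rule ideal_gen) (auto simp: chow_gens_def)

lemma homs_alpha: "alpha i \<in> homs V 1"
  unfolding alpha_def by (rule homs_sum, rule homs_var) simp

text \<open>The sum of the \<open>xi F\<close> misses only the flat E, so it is the modular function
  of i, of degree 0, minus \<open>xi E\<close>. The result does not depend on i, which is the linear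
  relation.\<close>

lemma D_alpha: "i \<in> E \<Longrightarrow> (\<Sum>F\<in>{F\<in>V. i \<in> F}. D E r (xi F # ys)) = - D E r (xi E # ys)"
proof -
  assume i: "i \<in> E"
  have "(\<Sum>F\<in>{F\<in>V. i \<in> F}. D E r (xi F # ys)) = D E r ((\<lambda>H. \<Sum>F\<in>{F\<in>V. i \<in> F}. xi F H) # ys)"
    by (rule D_head_sum[symmetric]) simp
  also have "\<dots> = D E r ((\<lambda>H. (if i \<in> H then 1 else 0) + (-1) * xi E H) # ys)"
  proof (rule D_head_cong)
    fix H assume "H \<in> fl E r"
    then have "H = E \<or> H \<in> V" by (auto simp: fl_def np_flats_def)
    moreover have "E \<notin> V" by (simp add: np_flats_def)
    ultimately show "(\<Sum>F\<in>{F\<in>V. i \<in> F}. xi F H) = (if i \<in> H then 1 else 0) + (-1) * xi E H"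
      using i by (auto simp: sum.delta)
  qed
  also have "\<dots> = - D E r (xi E # ys)"
    unfolding D_head_add D_head_scale D_head_modular[OF i] by simp
  finally show ?thesis .
qed

lemma dg_ideal:
  assumes "p \<in> I" shows "dg p = 0"
proof -
  have gen: "dg (vmon xs * g) = 0" if g: "g \<in> chow_gens E r" for g xs
  proof -
    consider F G where "g = var F * var G" "F \<in> V" "G \<in> V" "\<not> F \<subseteq> G" "\<not> G \<subseteq> F"
      | i j where "g = alpha i - alpha j" "i \<in> E" "j \<in> E"
      using g unfolding chow_gens_def alpha_def by blast
    then show ?thesis
    proof cases
      case 1
      have "vmon xs * g = vmon (F # G # xs)" using 1 by (simp add: mult_ac)
      moreover have "D E r (map xi (F # G # xs)) = 0" if "length xs + 2 = d"
        using D_incomparable[OF loopless_matroid_axioms, of "map xi xs" F G] 1 rank_E that np_subset by simp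
      ultimately show ?thesis using dg_vmon[of "F # G # xs"] by auto
    next
      case 2
      have "dg (vmon xs * alpha i) = (if Suc (length xs) = d then - D E r (xi E # map xi xs) else 0)" if "i \<in> E" for i
      proof -
        have "vmon xs * alpha i = (\<Sum>F\<in>{F\<in>V. i \<in> F}. vmon (F # xs))"
          by (simp add: alpha_def sum_distrib_left mult.commute)
        then have "dg (vmon xs * alpha i) = (\<Sum>F\<in>{F\<in>V. i \<in> F}. if Suc (length xs) = d then D E r (xi F # map xi xs) else 0)"
          by (simp only: dg_sum dg_vmon list.map length_Cons)
        then show ?thesis using D_alpha[OF that] by auto
      qed
      then show ?thesis using 2 by (simp add: right_diff_distrib dg_diff)
    qed
  qed
  have "dg (h * g) = 0" if g: "g \<in> chow_gens E r" and "vars_in V h" for h g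
    using that(2)
  proof (induction h rule: vars_in_induct)
    case (step c xs q)
    then show ?case using gen[OF g] by (simp add: ring_distribs dg_add mult.assoc dg_scale)
  qed simp
  moreover obtain S h where S: "p = (\<Sum>g\<in>S. h g * g)" "finite S" "S \<subseteq> chow_gens E r" "\<forall>g\<in>S. vars_in V (h g)"
    using assms unfolding chow_ideal_def ideal_gen_def by auto
  ultimately show ?thesis unfolding S(1) dg_sum by (intro sum.neutral) auto
qed

end

section \<open>Chains of flats\<close>

lemma chain_has_max:
  assumes "finite C" "C \<noteq> {}" "\<And>A B. A \<in> C \<Longrightarrow> B \<in> C \<Longrightarrow> A \<subseteq> B \<or> B \<subseteq> A"
  shows "\<exists>M\<in>C. \<forall>A\<in>C. A \<subseteq> M"
  using assms
proof (induction C rule: finite_ne_induct)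
  case (insert A C)
  have "\<exists>M\<in>C. \<forall>B\<in>C. B \<subseteq> M" by (rule insert.IH, rule insert.prems) simp_all
  then obtain M where M: "M \<in> C" "\<And>B. B \<in> C \<Longrightarrow> B \<subseteq> M" by blast
  have "A \<subseteq> M \<or> M \<subseteq> A" by (rule insert.prems) (simp_all add: M(1))
  then consider "A \<subseteq> M" | "M \<subseteq> A" by metis
  then show ?case
  proof cases
    case 1
    show ?thesis by (rule bexI[of _ M], rule ballI) (use 1 M in \<open>elim insertE, simp_all\<close>)
  next
    case 2
    have "B \<subseteq> A" if "B \<in> insert A C" for B
      using that 2 M(2)[of B] by (elim insertE) (simp, metis subset_trans)
    then show ?thesis by (intro bexI[of _ A] ballI) simp_all
  qed
next
  case (singleton A)
  show ?case by simp
qed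

lemma chain_has_min:
  assumes "finite C" "C \<noteq> {}" "\<And>A B. A \<in> C \<Longrightarrow> B \<in> C \<Longrightarrow> A \<subseteq> B \<or> B \<subseteq> A"
  shows "\<exists>M\<in>C. \<forall>A\<in>C. M \<subseteq> A"
  using assms
proof (induction C rule: finite_ne_induct)
  case (insert A C)
  have "\<exists>M\<in>C. \<forall>B\<in>C. M \<subseteq> B" by (rule insert.IH, rule insert.prems) simp_all
  then obtain M where M: "M \<in> C" "\<And>B. B \<in> C \<Longrightarrow> M \<subseteq> B" by blast
  have "A \<subseteq> M \<or> M \<subseteq> A" by (rule insert.prems) (simp_all add: M(1))
  then consider "M \<subseteq> A" | "A \<subseteq> M" by metis
  then show ?case
  proof cases
    case 1
    show ?thesis by (rule bexI[of _ M], rule ballI) (use 1 M in \<open>elim insertE, simp_all\<close>)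
  next
    case 2
    have "A \<subseteq> B" if "B \<in> insert A C" for B
      using that 2 M(2)[of B] by (elim insertE) (simp, metis subset_trans)
    then show ?thesis by (intro bexI[of _ A] ballI) simp_all
  qed
next
  case (singleton A)
  show ?case by simp
qed

text \<open>Edmonds' greedy algorithm: a chain lies in the tight sets of a vertex of the base polytope.\<close>
lemma modular_interpolation:
  fixes a :: "'a set \<Rightarrow> real"
  assumes "finite E" "C \<subseteq> Pow E" "\<And>A B. A \<in> C \<Longrightarrow> B \<in> C \<Longrightarrow> A \<subseteq> B \<or> B \<subseteq> A" "a {} = 0"
  shows "\<exists>w. (\<forall>A\<in>C. sum w A = a A) \<and>
    ((\<forall>A B. A \<subseteq> E \<and> B \<subseteq> E \<longrightarrow> a A + a B \<ge> a (A \<union> B) + a (A \<inter> B)) \<longrightarrow> (\<forall>A\<subseteq>E. sum w A \<le> a A))"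
  using assms
proof (induction "card E" arbitrary: E C)
  case 0
  have E: "E = {}" using 0(1,2) by (metis card_0_eq)
  have "a A = 0" if "A \<subseteq> E" for A using that 0(5) E by simp
  then show ?case using 0(3) by (intro exI[of _ "\<lambda>_. 0"]) auto
next
  case (Suc n)
  have "\<exists>e\<in>E. \<forall>A\<in>C - {E}. e \<notin> A"
  proof (cases "C - {E} = {}")
    case True
    then show ?thesis using Suc(2) by (metis Zero_neq_Suc card.empty empty_iff ex_in_conv)
  next
    case False
    have "finite (C - {E})" using Suc(3,4) by (meson finite_Diff finite_Pow_iff finite_subset)
    then obtain M where M: "M \<in> C - {E}" "\<forall>A\<in>C - {E}. A \<subseteq> M"
      using chain_has_max[OF _ False] Suc(5) by (metis DiffD1)
    then obtain e where "e \<in> E" "e \<notin> M" using Suc(4) by blast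
    then show ?thesis using M by blast
  qed
  then obtain e where e: "e \<in> E" "\<And>A. A \<in> C \<Longrightarrow> A \<noteq> E \<Longrightarrow> e \<notin> A" by blast
  let ?E' = "E - {e}"
  have sub: "A \<subseteq> ?E'" if "A \<in> C" "A \<noteq> E" for A using that e Suc(4) by blast
  \<comment> \<open>Inserting \<open>?E'\<close> into the chain makes w tight there, so that the
    weight given to e below is its marginal value over all other elements. Submodularity for A and
    \<open>?E'\<close> then keeps the extension below a.\<close>
  have "\<exists>w. (\<forall>A\<in>insert ?E' (C - {E}). sum w A = a A) \<and>
    ((\<forall>A B. A \<subseteq> ?E' \<and> B \<subseteq> ?E' \<longrightarrow> a A + a B \<ge> a (A \<union> B) + a (A \<inter> B)) \<longrightarrow> (\<forall>A\<subseteq>?E'. sum w A \<le> a A))"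
  proof (rule Suc(1))
    show "n = card ?E'" using Suc(2,3) e by simp
    show "insert ?E' (C - {E}) \<subseteq> Pow ?E'" using sub by blast
    show "A \<subseteq> B \<or> B \<subseteq> A" if "A \<in> insert ?E' (C - {E})" "B \<in> insert ?E' (C - {E})" for A B
    proof (cases "A = ?E' \<or> B = ?E'")
      case True
      then show ?thesis using that sub by blast
    next
      case False
      then show ?thesis using that Suc(5)[of A B] by blast
    qed
    show "finite ?E'" using Suc(3) by simp
    show "a {} = 0" by (rule Suc(6))
  qed
  then obtain w where w: "\<And>A. A \<in> C \<Longrightarrow> A \<noteq> E \<Longrightarrow> sum w A = a A" "sum w ?E' = a ?E'"
    "(\<forall>A B. A \<subseteq> ?E' \<and> B \<subseteq> ?E' \<longrightarrow> a A + a B \<ge> a (A \<union> B) + a (A \<inter> B)) \<longrightarrow> (\<forall>A\<subseteq>?E'. sum w A \<le> a A)"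
    by auto
  define w' where "w' = w(e := a E - a ?E')"
  have w'1: "sum w' A = sum w A" if "e \<notin> A" for A
    unfolding w'_def by (rule sum.cong) (use that in auto)
  have w'2: "sum w' A = a E - a ?E' + sum w (A - {e})" if "e \<in> A" "A \<subseteq> E" for A
  proof -
    have "finite A" using that Suc(3) finite_subset by blast
    then have "sum w' A = w' e + sum w' (A - {e})" using that by (simp add: sum.remove)
    then show ?thesis using w'1[of "A - {e}"] by (simp add: w'_def)
  qed
  have "sum w' A = a A" if "A \<in> C" for A
  proof (cases "A = E")
    case True
    then show ?thesis using w'2[of E] e w(2) by simp
  next
    case False
    then show ?thesis using w'1[of A] w(1) e that by simp
  qed
  moreover have "sum w' A \<le> a A" if sm: "\<forall>A B. A \<subseteq> E \<and> B \<subseteq> E \<longrightarrow> a A + a B \<ge> a (A \<union> B) + a (A \<inter> B)" and A: "A \<subseteq> E" for A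
  proof -
    have "\<forall>A B. A \<subseteq> ?E' \<and> B \<subseteq> ?E' \<longrightarrow> a A + a B \<ge> a (A \<union> B) + a (A \<inter> B)"
      using sm by (meson Diff_subset subset_trans)
    then have le: "\<forall>A\<subseteq>?E'. sum w A \<le> a A" using w(3) by blast
    show ?thesis
    proof (cases "e \<in> A")
      case True
      have "A \<union> ?E' = E" "A \<inter> ?E' = A - {e}" using A True by auto
      then have "a A + a ?E' \<ge> a E + a (A - {e})" using sm A by (metis Diff_subset)
      moreover have "sum w (A - {e}) \<le> a (A - {e})" by (rule le[rule_format]) (use A in blast)
      ultimately show ?thesis using w'2[OF True A] by linarith
    next
      case False
      then have "A \<subseteq> ?E'" using A by blast
      then show ?thesis using le w'1[OF False] by auto
    qed
  qed
  ultimately show ?case by (intro exI[of _ w'] conjI ballI impI allI) simp_all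
qed

definition cmp :: "'a set \<Rightarrow> 'a set \<Rightarrow> bool" where
  "cmp F G \<longleftrightarrow> F \<subseteq> G \<or> G \<subseteq> F"

lemma cmp_refl [simp]: "cmp F F" and cmp_sym: "cmp F G \<Longrightarrow> cmp G F"
  unfolding cmp_def by simp_all (erule disj_commute[THEN iffD1])

section \<open>Chains of flats, their links and gaps\<close>

context chow
begin

definition chain :: "'a set set \<Rightarrow> bool" where
  "chain \<sigma> \<longleftrightarrow> \<sigma> \<subseteq> V \<and> (\<forall>F\<in>\<sigma>. \<forall>G\<in>\<sigma>. cmp F G)"

definition link :: "'a set set \<Rightarrow> 'a set set" where
  "link \<sigma> = {G \<in> V - \<sigma>. \<forall>F\<in>\<sigma>. cmp F G}"

definition X :: "'a set set \<Rightarrow> 'a cpoly" where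
  "X \<sigma> = (\<Prod>F\<in>\<sigma>. var F)"

text \<open>The neighbours of rank j in the chain completed by the empty set and E. When rank j is
  missing from the chain, the flats strictly between H and K belong to the link, which is thus the
  join of such intervals.\<close>

definition gap :: "'a set set \<Rightarrow> nat \<Rightarrow> 'a set \<Rightarrow> 'a set \<Rightarrow> bool" where
  "gap \<sigma> j H K \<longleftrightarrow> H \<in> insert {} \<sigma> \<and> K \<in> insert E \<sigma> \<and> r H < j \<and> j < r K \<and> H \<subseteq> K \<and>
     (\<forall>F\<in>\<sigma>. r F < j \<longrightarrow> F \<subseteq> H) \<and> (\<forall>F\<in>\<sigma>. j < r F \<longrightarrow> K \<subseteq> F)"

lemma E_ne: "E \<noteq> {}"
  using rank_E rank_empty by (metis Suc_eq_plus1 Zero_neq_Suc)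

lemma V_rank: "F \<in> V \<Longrightarrow> 1 \<le> r F \<and> r F \<le> d"
  using np_rank rank_E by fastforce

lemma VI: "is_flat E r F \<Longrightarrow> 1 \<le> r F \<Longrightarrow> r F \<le> d \<Longrightarrow> F \<in> V"
  using npI rank_E by simp

lemma E_notin_V: "E \<notin> V" and empty_notin_V: "{} \<notin> V"
  by (auto simp: np_flats_def)

lemma V_rank_less: "F \<in> V \<Longrightarrow> G \<in> V \<Longrightarrow> F \<subset> G \<Longrightarrow> r F < r G"
  by (rule flat_rank_less) (auto dest: np_flat np_subset)

lemma chain_V: "chain \<sigma> \<Longrightarrow> F \<in> \<sigma> \<Longrightarrow> F \<in> V" unfolding chain_def by blast

lemma chain_comp: "chain \<sigma> \<Longrightarrow> F \<in> \<sigma> \<Longrightarrow> G \<in> \<sigma> \<Longrightarrow> F \<subseteq> G \<or> G \<subseteq> F"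
  unfolding chain_def cmp_def[symmetric] by blast

lemma chain_finite: "chain \<sigma> \<Longrightarrow> finite \<sigma>"
  by (rule finite_subset[OF _ finite_flats(2)]) (auto dest: chain_V)

lemma chain_mono: "chain \<sigma> \<Longrightarrow> \<tau> \<subseteq> \<sigma> \<Longrightarrow> chain \<tau>" unfolding chain_def by blast

lemma chain_empty [simp]: "chain {}" by (simp add: chain_def)

lemma link_V: "G \<in> link \<sigma> \<Longrightarrow> G \<in> V" and link_notin: "G \<in> link \<sigma> \<Longrightarrow> G \<notin> \<sigma>"
  and link_comp: "G \<in> link \<sigma> \<Longrightarrow> F \<in> \<sigma> \<Longrightarrow> F \<subseteq> G \<or> G \<subseteq> F"
  unfolding link_def cmp_def[symmetric] by blast+

lemma link_finite [simp]: "finite (link \<sigma>)"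
  by (rule finite_subset[OF _ finite_flats(2)]) (auto dest: link_V)

lemma chain_insert: "chain \<sigma> \<Longrightarrow> G \<in> link \<sigma> \<Longrightarrow> chain (insert G \<sigma>)"
  unfolding chain_def link_def by (auto intro: cmp_sym)

lemma link_insert_iff: "F \<in> V \<Longrightarrow> G \<in> link (insert F \<sigma>) \<longleftrightarrow> G \<in> link \<sigma> \<and> G \<noteq> F \<and> cmp F G"
  unfolding link_def by blast

lemma insert_chain_link: "chain (insert G \<sigma>) \<Longrightarrow> G \<notin> \<sigma> \<Longrightarrow> G \<in> link \<sigma>"
  unfolding link_def chain_def by blast

lemma chain_rank_le: "chain \<sigma> \<Longrightarrow> F \<in> \<sigma> \<Longrightarrow> G \<in> \<sigma> \<Longrightarrow> r F \<le> r G \<Longrightarrow> F \<subseteq> G"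
  using chain_comp[of \<sigma> F G] V_rank_less[of G F] chain_V by (metis leD psubsetI)

lemma chain_rank_inj: "chain \<sigma> \<Longrightarrow> inj_on r \<sigma>"
proof (rule inj_onI, rule subset_antisym)
  fix F G assume a: "chain \<sigma>" "F \<in> \<sigma>" "G \<in> \<sigma>" "r F = r G"
  show "F \<subseteq> G" by (rule chain_rank_le[OF a(1-3)]) (simp add: a(4))
  show "G \<subseteq> F" by (rule chain_rank_le[OF a(1,3,2)]) (simp add: a(4))
qed

lemma chain_ranks: "chain \<sigma> \<Longrightarrow> r ` \<sigma> \<subseteq> {1..d}"
  using chain_V V_rank by fastforce

lemma chain_card: "chain \<sigma> \<Longrightarrow> card (r ` \<sigma>) = card \<sigma>"
  by (simp add: card_image chain_rank_inj)

lemma chain_card_le: "chain \<sigma> \<Longrightarrow> card \<sigma> \<le> d"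
  using chain_card[of \<sigma>] card_mono[OF _ chain_ranks[of \<sigma>]] by simp

lemma link_rank: "chain \<sigma> \<Longrightarrow> G \<in> link \<sigma> \<Longrightarrow> r G \<notin> r ` \<sigma>"
  using chain_rank_inj[OF chain_insert, of \<sigma> G] link_notin[of G \<sigma>] by (auto simp: inj_on_def)

lemma gap_exists:
  assumes \<sigma>: "chain \<sigma>" and j: "1 \<le> j" "j \<le> d"
  shows "\<exists>H K. gap \<sigma> j H K"
proof -
  let ?L = "{F\<in>\<sigma>. r F < j}" and ?U = "{F\<in>\<sigma>. j < r F}"
  have f: "finite ?L" "finite ?U" using chain_finite[OF \<sigma>] by auto
  have "\<exists>H\<in>insert {} \<sigma>. r H < j \<and> (\<forall>F\<in>\<sigma>. r F < j \<longrightarrow> F \<subseteq> H)"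
  proof (cases "?L = {}")
    case True
    then show ?thesis using j by auto
  next
    case False
    then obtain H where "H \<in> ?L" "\<forall>F\<in>?L. F \<subseteq> H"
      using chain_has_max[OF f(1) False] chain_comp[OF \<sigma>] by blast
    then show ?thesis by blast
  qed
  then obtain H where H: "H\<in>insert {} \<sigma>" "r H < j" "\<forall>F\<in>\<sigma>. r F < j \<longrightarrow> F \<subseteq> H" by blast
  have "\<exists>K\<in>insert E \<sigma>. j < r K \<and> (\<forall>F\<in>\<sigma>. j < r F \<longrightarrow> K \<subseteq> F)"
  proof (cases "?U = {}")
    case True
    then show ?thesis using j rank_E by auto
  next
    case False
    then obtain K where "K \<in> ?U" "\<forall>F\<in>?U. K \<subseteq> F"
      using chain_has_min[OF f(2) False] chain_comp[OF \<sigma>] by blast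
    then show ?thesis by blast
  qed
  then obtain K where K: "K\<in>insert E \<sigma>" "j < r K" "\<forall>F\<in>\<sigma>. j < r F \<longrightarrow> K \<subseteq> F" by blast
  have "H \<subseteq> K"
  proof (cases "H = {} \<or> K = E")
    case True
    moreover have "H \<subseteq> E" using H(1) chain_V[OF \<sigma>] np_subset by blast
    ultimately show ?thesis by auto
  next
    case False
    then have "H \<in> \<sigma>" "K \<in> \<sigma>" using H(1) K(1) by auto
    moreover have "r H \<le> r K" using H(2) K(2) by linarith
    ultimately show ?thesis by (rule chain_rank_le[OF \<sigma>])
  qed
  then have "gap \<sigma> j H K" unfolding gap_def by (intro conjI H K)
  then show ?thesis by blast
qed

lemma gap_flats:
  assumes "chain \<sigma>" "gap \<sigma> j H K"
  shows "is_flat E r H" "is_flat E r K" "H \<subseteq> K" "r H < j" "j < r K"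
proof -
  have "is_flat E r F" if "F \<in> \<sigma>" for F using np_flat chain_V[OF assms(1)] that by blast
  then show "is_flat E r H" "is_flat E r K" "H \<subseteq> K" "r H < j" "j < r K"
    using assms(2) flat_empty flat_E unfolding gap_def by auto
qed

lemma gap_linkI:
  assumes \<sigma>: "chain \<sigma>" and g: "gap \<sigma> j H K" and j: "j \<notin> r ` \<sigma>"
    and G: "is_flat E r G" "H \<subset> G" "G \<subset> K"
  shows "G \<in> link \<sigma>"
proof -
  have "K \<subseteq> E" using gap_flats(2)[OF \<sigma> g] flat_subset by blast
  then have "r G < r K" "r K \<le> r E" "r H < r G"
    using flat_rank_less[OF G(1) _ G(3)] rank_mono[of K E] flat_rank_less[OF gap_flats(1)[OF \<sigma> g] _ G(2)] flat_subset[OF G(1)] by auto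
  then have GV: "G \<in> V" using VI[OF G(1)] rank_E by simp
  have c: "F \<subseteq> H \<or> K \<subseteq> F" if "F \<in> \<sigma>" for F
  proof -
    have "r F \<noteq> j" using j that by blast
    then show ?thesis using g that unfolding gap_def by (meson linorder_neqE_nat)
  qed
  have "G \<notin> \<sigma>" using c G by blast
  moreover have "F \<subseteq> G \<or> G \<subseteq> F" if "F \<in> \<sigma>" for F using c[OF that] G by blast
  ultimately show ?thesis using GV unfolding link_def cmp_def by simp
qed

lemma gap_linkD:
  assumes \<sigma>: "chain \<sigma>" and g: "gap \<sigma> j H K" and G: "G \<in> link \<sigma>" "r G = j"
  shows "H \<subset> G" "G \<subset> K"
proof -
  have GV: "G \<in> V" using G link_V by blast
  have "H \<subseteq> G"
  proof (cases "H = {}")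
    case False
    then have H: "H \<in> \<sigma>" "r H < j" using g unfolding gap_def by auto
    have "\<not> G \<subseteq> H" using rank_mono[of G H] np_subset[OF chain_V[OF \<sigma> H(1)]] H G by auto
    then show ?thesis using link_comp[OF G(1) H(1)] by blast
  qed simp
  then show "H \<subset> G" using g G unfolding gap_def by auto
  have "G \<subseteq> K"
  proof (cases "K = E")
    case True
    then show ?thesis using np_subset[OF GV] by simp
  next
    case False
    then have K: "K \<in> \<sigma>" "j < r K" using g unfolding gap_def by auto
    have "\<not> K \<subseteq> G" using rank_mono[of K G] np_subset[OF GV] K G by auto
    then show ?thesis using link_comp[OF G(1) K(1)] by blast
  qed
  then show "G \<subset> K" using g G unfolding gap_def by auto
qed

lemma extend_rank:
  assumes \<sigma>: "chain \<sigma>" and j: "1 \<le> j" "j \<le> d" "j \<notin> r ` \<sigma>"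
  shows "\<exists>G\<in>link \<sigma>. r G = j"
proof -
  obtain H K where g: "gap \<sigma> j H K" using gap_exists[OF \<sigma>] j by blast
  note gf = gap_flats[OF \<sigma> g]
  obtain G where "is_flat E r G" "H \<subseteq> G" "G \<subseteq> K" "r G = j"
    using flat_between[OF gf(1-3), of j] gf by auto
  moreover have "G \<in> link \<sigma>"
    by (rule gap_linkI[OF \<sigma> g j(3)]) (use calculation gf in auto)
  ultimately show ?thesis by blast
qed

lemma extend_chain:
  assumes "chain \<sigma>" "r ` \<sigma> \<subseteq> J" "J \<subseteq> {1..d}"
  shows "\<exists>\<tau>. chain \<tau> \<and> \<sigma> \<subseteq> \<tau> \<and> r ` \<tau> = J"
  using assms
proof (induction "card (J - r ` \<sigma>)" arbitrary: \<sigma>)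
  case 0
  have "finite J" using 0 finite_subset by blast
  then have "J - r ` \<sigma> = {}" using 0(1) by simp
  then show ?case using 0 by blast
next
  case (Suc n)
  then obtain j where j: "j \<in> J - r ` \<sigma>" by (metis card.empty empty_iff ex_in_conv nat.distinct(1))
  then have "1 \<le> j" "j \<le> d" "j \<notin> r ` \<sigma>" using Suc(5) by auto
  from extend_rank[OF Suc(3) this] obtain G where G: "G \<in> link \<sigma>" "r G = j" by blast
  have "J - r ` insert G \<sigma> = (J - r ` \<sigma>) - {j}" using G by auto
  then have "n = card (J - r ` insert G \<sigma>)" using Suc(2) j finite_subset[OF Suc(5)] by simp
  from Suc(1)[OF this chain_insert[OF Suc(3) G(1)] _ Suc(5)] show ?case using Suc(4) j G by auto
qed

lemma X_empty [simp]: "X {} = 1" by (simp add: X_def)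

lemma X_insert: "chain \<sigma> \<Longrightarrow> G \<notin> \<sigma> \<Longrightarrow> X (insert G \<sigma>) = var G * X \<sigma>"
  by (simp add: X_def chain_finite)

lemma X_homs: "chain \<sigma> \<Longrightarrow> X \<sigma> \<in> homs V (card \<sigma>)"
  unfolding X_def by (rule homs_prod_var) (auto simp: chain_finite dest: chain_V)

lemma X_vars: "chain \<sigma> \<Longrightarrow> vars_in V (X \<sigma>)"
  using X_homs homs_vars by blast

lemma dg_flag:
  assumes \<tau>: "chain \<tau>" and c: "card \<tau> = d"
  shows "dg (X \<tau>) = 1"
proof -
  have im: "r ` \<tau> = {1..d}"
    by (rule card_subset_eq) (use chain_ranks[OF \<tau>] chain_card[OF \<tau>] c in auto)
  define f where "f = inv_into \<tau> r"
  have f: "f j \<in> \<tau>" "r (f j) = j" if "j \<in> {1..d}" for j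
    using that im unfolding f_def by (auto intro: inv_into_into f_inv_into_f)
  define Fs where "Fs = map f (rev [1..<Suc d])"
  have len: "length Fs = d" by (simp add: Fs_def)
  have ranks: "map r Fs = rev [1..<Suc d]"
    unfolding Fs_def map_map by (rule map_idI) (use f in auto)
  have "set Fs = f ` {1..d}" by (auto simp: Fs_def)
  moreover have "f ` {1..d} = \<tau>"
    unfolding f_def im[symmetric] using inv_into_image_cancel[OF chain_rank_inj[OF \<tau>]]
    by (simp add: chain_rank_inj[OF \<tau>])
  ultimately have set: "set Fs = \<tau>" by simp
  then have dist: "distinct Fs" using c len by (simp add: card_distinct)
  have "sorted_wrt (\<lambda>i j. j < i) (rev [1..<Suc d])"
    unfolding sorted_wrt_rev by (rule sorted_wrt_upt)
  then have "sorted_wrt (\<lambda>A B. r B < r A) Fs"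
    unfolding ranks[symmetric] by (simp add: sorted_wrt_map)
  then have "sorted_wrt (\<lambda>A B. B \<subset> A) Fs"
  proof (rule sorted_wrt_mono_rel[rotated])
    fix A B assume "A \<in> set Fs" "B \<in> set Fs" "r B < r A"
    then show "B \<subset> A" using chain_rank_le[OF \<tau>, of B A] set by fastforce
  qed
  then have "D E r (map xi Fs) = 1"
    using D_flag[OF loopless_matroid_axioms, of Fs] rank_E len ranks set chain_V[OF \<tau>] np_flat by auto
  moreover have "X \<tau> = vmon Fs"
    unfolding X_def vmon_def set[symmetric] using dist by (rule prod.distinct_set_conv_list)
  ultimately show ?thesis using dg_vmon[of Fs] len by simp
qed

text \<open>The lattice of flats is graded, so a chain is maximal exactly when every rank from 1 to
  d occurs. This matches the normalisation of \<open>chow_deg\<close> with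
  \<open>dg_flag\<close>.\<close>

lemma max_chain_iff: "max_chain E r C \<longleftrightarrow> chain C \<and> card C = d"
proof
  assume m: "max_chain E r C"
  then have C: "chain C" unfolding max_chain_def chain_def cmp_def by simp
  have "card C = d"
  proof (rule ccontr)
    assume "card C \<noteq> d"
    then have "r ` C \<noteq> {1..d}" using chain_card[OF C] by auto
    then obtain j where "j \<in> {1..d}" "j \<notin> r ` C" using chain_ranks[OF C] by blast
    then obtain G where G: "G \<in> link C" using extend_rank[OF C, of j] by (meson atLeastAtMost_iff)
    have "\<forall>H\<in>V - C. \<exists>F\<in>C. \<not> F \<subseteq> H \<and> \<not> H \<subseteq> F" using m unfolding max_chain_def by (elim conjE)
    then show False using link_V[OF G] link_notin[OF G] link_comp[OF G] by (meson DiffI)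
  qed
  then show "chain C \<and> card C = d" using C by blast
next
  assume C: "chain C \<and> card C = d"
  have "\<exists>F\<in>C. \<not> F \<subseteq> H \<and> \<not> H \<subseteq> F" if H: "H \<in> V - C" for H
  proof (rule ccontr)
    assume "\<not> ?thesis"
    then have "H \<in> link C" using H unfolding link_def cmp_def by blast
    then have "card (insert H C) \<le> d" using chain_card_le chain_insert C by blast
    then show False using H C chain_finite by auto
  qed
  then show "max_chain E r C" using C unfolding max_chain_def chain_def cmp_def by (intro conjI ballI) simp_all
qed

lemma X_nonlink: 
  assumes "chain \<sigma>" "G \<in> V" "G \<notin> \<sigma>" "G \<notin> link \<sigma>"
  shows "var G * X \<sigma> \<in> I"
proof -
  obtain F where F: "F \<in> \<sigma>" "\<not> F \<subseteq> G" "\<not> G \<subseteq> F" using assms unfolding link_def cmp_def by blast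
  have "X \<sigma> = var F * X (\<sigma> - {F})"
    unfolding X_def using F chain_finite[OF assms(1)] by (simp add: prod.remove)
  moreover have "X (\<sigma> - {F}) * (var F * var G) \<in> I"
    by (intro ideal_mult incomparable_ideal X_vars chain_mono[OF assms(1)])
      (use F assms chain_V in auto)
  ultimately show ?thesis by (simp add: mult_ac)
qed

section \<open>Divisors and their restriction to links\<close>

lemma divisor_homs: "divisor E r u \<in> homs V 1"
  unfolding divisor_def by (intro homs_sum homs_scale homs_var)

lemma divisor_vars: "vars_in V (divisor E r u)"
  using divisor_homs homs_vars by blast

lemma divisor_xi: "F \<in> V \<Longrightarrow> divisor E r (xi F) = var F"
proof -
  assume F: "F \<in> V"
  have "divisor E r (xi F) = (\<Sum>G\<in>V. if G = F then var G else 0)"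
    unfolding divisor_def by (intro sum.cong refl) auto
  then show ?thesis using F by (simp add: sum.delta)
qed

lemma divisor_add: "divisor E r (\<lambda>F. u F + v F) = divisor E r u + divisor E r v"
  by (simp add: divisor_def const_add ring_distribs sum.distrib)

lemma divisor_scale: "divisor E r (\<lambda>F. c * u F) = const c * divisor E r u"
  by (simp add: divisor_def const_mult sum_distrib_left mult.assoc)

lemma divisor_diff: "divisor E r (\<lambda>F. u F - v F) = divisor E r u - divisor E r v"
  using divisor_add[of u "\<lambda>F. (-1) * v F"] divisor_scale[of "-1" v] by (simp add: const_uminus)

lemma divisor_cong: "(\<And>F. F \<in> V \<Longrightarrow> u F = v F) \<Longrightarrow> divisor E r u = divisor E r v"
  unfolding divisor_def by (rule sum.cong) auto

text \<open>The divisor is the combination of the \<open>alpha e\<close> with weights w e. All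
  \<open>alpha e\<close> agree modulo the ideal, so only the total weight matters.\<close>

lemma modular_divisor_ideal:
  assumes "sum w E = 0"
  shows "divisor E r (\<lambda>F. sum w F) \<in> I"
proof -
  obtain e0 where e0: "e0 \<in> E" using E_ne by blast
  have "divisor E r (\<lambda>F. sum w F) = (\<Sum>F\<in>V. \<Sum>e\<in>E. if e \<in> F then const (w e) * var F else 0)"
    unfolding divisor_def
  proof (intro sum.cong refl)
    fix F assume "F \<in> V"
    then have "E \<inter> F = F" using np_subset by blast
    then show "const (sum w F) * var F = (\<Sum>e\<in>E. if e \<in> F then const (w e) * var F else 0)"
      by (simp add: sum.inter_restrict[symmetric] const_sum sum_distrib_right)
  qed
  also have "\<dots> = (\<Sum>e\<in>E. const (w e) * alpha e)"
    by (subst sum.swap) (simp add: alpha_def sum_distrib_left sum.inter_filter if_distrib[of "(*) _"] cong: if_cong)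
  also have "\<dots> = (\<Sum>e\<in>E. const (w e) * (alpha e - alpha e0)) + const (sum w E) * alpha e0"
    by (simp add: right_diff_distrib sum_subtractf const_sum sum_distrib_right)
  also have "\<dots> \<in> I" 
    using assms by (simp add: ideal_sum ideal_scale alpha_diff_ideal e0)
  finally show ?thesis .
qed

text \<open>Variables outside the link and the chain are incomparable to some member of the chain
  and die; those in the chain would give squares, which the vanishing of u removes. So multiplying
  by \<open>X \<sigma>\<close> acts as restriction to the link.\<close>

lemma X_divisor:
  assumes \<sigma>: "chain \<sigma>" and u: "\<And>F. F \<in> \<sigma> \<Longrightarrow> u F = 0"
  shows "X \<sigma> * divisor E r u - (\<Sum>G\<in>link \<sigma>. const (u G) * X (insert G \<sigma>)) \<in> I"
proof -
  have V: "V = link \<sigma> \<union> \<sigma> \<union> (V - link \<sigma> - \<sigma>)" using chain_V[OF \<sigma>] link_V by blast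
  let ?f = "\<lambda>G. const (u G) * (var G * X \<sigma>)"
  have "X \<sigma> * divisor E r u = (\<Sum>G\<in>V. ?f G)"
    by (simp add: divisor_def sum_distrib_left mult_ac)
  also have "\<dots> = (\<Sum>G\<in>link \<sigma> \<union> \<sigma>. ?f G) + (\<Sum>G\<in>V - link \<sigma> - \<sigma>. ?f G)"
    by (subst V, rule sum.union_disjoint) (use chain_finite[OF \<sigma>] in auto)
  also have "(\<Sum>G\<in>link \<sigma> \<union> \<sigma>. ?f G) = (\<Sum>G\<in>link \<sigma>. ?f G) + (\<Sum>G\<in>\<sigma>. ?f G)"
    by (rule sum.union_disjoint) (use chain_finite[OF \<sigma>] link_notin in auto)
  also have "(\<Sum>G\<in>\<sigma>. ?f G) = 0" using u by simp
  also have "(\<Sum>G\<in>link \<sigma>. ?f G) = (\<Sum>G\<in>link \<sigma>. const (u G) * X (insert G \<sigma>))"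
    by (intro sum.cong refl) (simp add: X_insert[OF \<sigma>] link_notin)
  finally have "X \<sigma> * divisor E r u - (\<Sum>G\<in>link \<sigma>. const (u G) * X (insert G \<sigma>)) = (\<Sum>G\<in>V - link \<sigma> - \<sigma>. ?f G)"
    by simp
  also have "\<dots> \<in> I" by (intro ideal_sum ideal_scale X_nonlink[OF \<sigma>]) auto
  finally show ?thesis .
qed

lemma chain_E_comp: "chain \<sigma> \<Longrightarrow> A \<in> insert E \<sigma> \<Longrightarrow> B \<in> insert E \<sigma> \<Longrightarrow> A \<subseteq> B \<or> B \<subseteq> A"
  using chain_comp[of \<sigma>] chain_V[of \<sigma>] np_subset by blast

text \<open>Modular functions of total weight 0 do not change the class and interpolate any values
  on a chain. This is how repeated variables are eliminated.\<close>

lemma normalize: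
  assumes \<sigma>: "chain \<sigma>"
  shows "\<exists>u'. (\<forall>F\<in>\<sigma>. u' F = 0) \<and> divisor E r u - divisor E r u' \<in> I"
proof -
  \<comment> \<open>The values of u at the empty set and at E are not coefficients of the divisor.
    The interpolation requires 0 at the former, and 0 at the latter makes the total weight
    vanish.\<close>
  define v where "v A = (if A = E \<or> A = {} then 0 else u A)" for A
  have "\<exists>w. \<forall>A\<in>insert E \<sigma>. sum w A = v A"
  proof -
    have "insert E \<sigma> \<subseteq> Pow E" using chain_V[OF \<sigma>] np_subset by blast
    moreover have "v {} = 0" by (simp add: v_def)
    ultimately show ?thesis
      using modular_interpolation[OF finite_E _ chain_E_comp[OF \<sigma>], where a = v] by metis
  qed
  then obtain w where w: "\<And>A. A \<in> insert E \<sigma> \<Longrightarrow> sum w A = v A" by blast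
  have "u F - sum w F = 0" if "F \<in> \<sigma>" for F
    using w[of F] that chain_V[OF \<sigma>] E_notin_V empty_notin_V by (auto simp: v_def)
  moreover have "divisor E r u - divisor E r (\<lambda>F. u F - sum w F) \<in> I"
    using modular_divisor_ideal[of w] w[of E] by (simp add: divisor_diff v_def)
  ultimately show ?thesis by (intro exI[of _ "\<lambda>F. u F - sum w F"]) auto
qed

lemma X_divisor_link:
  assumes \<sigma>: "chain \<sigma>"
  shows "\<exists>c. X \<sigma> * divisor E r u - (\<Sum>G\<in>link \<sigma>. const (c G) * X (insert G \<sigma>)) \<in> I"
proof -
  obtain u' where u': "\<forall>F\<in>\<sigma>. u' F = 0" "divisor E r u - divisor E r u' \<in> I" using normalize[OF \<sigma>] by blast
  have "X \<sigma> * (divisor E r u - divisor E r u') \<in> I" using ideal_mult[OF u'(2) X_vars[OF \<sigma>]] .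
  from ideal_add[OF this X_divisor[OF \<sigma>, of u']] u'(1)
  show ?thesis by (intro exI[of _ u']) (simp add: right_diff_distrib)
qed

section \<open>Spans of chain monomials modulo the ideal\<close>

definition cspan :: "'a set set set \<Rightarrow> 'a cpoly set" where
  "cspan T = {p. \<exists>c. p - (\<Sum>\<sigma>\<in>T. const (c \<sigma>) * X \<sigma>) \<in> I}"

lemma cspan_ideal: "p \<in> I \<Longrightarrow> p \<in> cspan T"
  unfolding cspan_def by (rule CollectI, rule exI[of _ "\<lambda>_. 0"]) simp

lemma cspan_add: "p \<in> cspan T \<Longrightarrow> q \<in> cspan T \<Longrightarrow> p + q \<in> cspan T"
proof -
  assume "p \<in> cspan T" "q \<in> cspan T"
  then obtain b c where bc: "p - (\<Sum>\<sigma>\<in>T. const (b \<sigma>) * X \<sigma>) \<in> I" "q - (\<Sum>\<sigma>\<in>T. const (c \<sigma>) * X \<sigma>) \<in> I"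
    unfolding cspan_def by blast
  from ideal_add[OF this] show ?thesis unfolding cspan_def
    by (intro CollectI exI[of _ "\<lambda>\<sigma>. b \<sigma> + c \<sigma>"]) (simp add: const_add ring_distribs sum.distrib add_diff_add)
qed

lemma cspan_scale: "p \<in> cspan T \<Longrightarrow> const a * p \<in> cspan T"
proof -
  assume "p \<in> cspan T"
  then obtain b where b: "p - (\<Sum>\<sigma>\<in>T. const (b \<sigma>) * X \<sigma>) \<in> I" unfolding cspan_def by blast
  from ideal_scale[OF this, of a] show ?thesis unfolding cspan_def
    by (intro CollectI exI[of _ "\<lambda>\<sigma>. a * b \<sigma>"]) (simp add: const_mult right_diff_distrib sum_distrib_left mult.assoc)
qed

lemma cspan_uminus: "p \<in> cspan T \<Longrightarrow> - p \<in> cspan T"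
  using cspan_scale[of p T "-1"] by (simp add: const_uminus)

lemma cspan_diff: "p \<in> cspan T \<Longrightarrow> q \<in> cspan T \<Longrightarrow> p - q \<in> cspan T"
  using cspan_add[OF _ cspan_uminus, of p T q] by simp

lemma cspan_cong: "q \<in> cspan T \<Longrightarrow> p - q \<in> I \<Longrightarrow> p \<in> cspan T"
  using cspan_add[of "p - q" T q] cspan_ideal[of "p - q" T] by simp

lemma cspan_sum: "(\<And>s. s \<in> S \<Longrightarrow> f s \<in> cspan T) \<Longrightarrow> (\<Sum>s\<in>S. f s) \<in> cspan T"
  by (induction S rule: infinite_finite_induct) (auto intro: cspan_add cspan_ideal)

lemma cspan_X: "finite T \<Longrightarrow> \<sigma> \<in> T \<Longrightarrow> X \<sigma> \<in> cspan T"
proof -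
  assume T: "finite T" "\<sigma> \<in> T"
  have "(\<Sum>\<tau>\<in>T. const (if \<tau> = \<sigma> then 1 else 0) * X \<tau>) = (\<Sum>\<tau>\<in>T. if \<tau> = \<sigma> then X \<tau> else 0)"
    by (intro sum.cong refl) auto
  then show ?thesis unfolding cspan_def using T
    by (intro CollectI exI[of _ "\<lambda>\<tau>. if \<tau> = \<sigma> then 1 else 0"]) (simp add: sum.delta)
qed

lemma cspan_X_divisor:
  assumes \<sigma>: "chain \<sigma>" and T: "finite T" "\<And>G. G \<in> link \<sigma> \<Longrightarrow> insert G \<sigma> \<in> T"
  shows "X \<sigma> * divisor E r u \<in> cspan T"
proof -
  obtain c where c: "X \<sigma> * divisor E r u - (\<Sum>G\<in>link \<sigma>. const (c G) * X (insert G \<sigma>)) \<in> I"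
    using X_divisor_link[OF \<sigma>] by blast
  show ?thesis by (rule cspan_cong[OF _ c]) (intro cspan_sum cspan_scale cspan_X T)
qed

definition chains :: "nat \<Rightarrow> 'a set set set" where
  "chains k = {\<sigma>. chain \<sigma> \<and> card \<sigma> = k}"

lemma finite_chains [simp]: "finite (chains k)"
  by (rule finite_subset[of _ "Pow V"]) (auto simp: chains_def dest: chain_V)

text \<open>Squarefree chain monomials suffice: a chain monomial times one more variable, repeated
  or not, is rewritten over the link of the chain.\<close>

lemma homs_cspan: "p \<in> homs V k \<Longrightarrow> p \<in> cspan (chains k)"
proof (induction p rule: homs_induct)
  case (step c xs q)
  have "vmon xs \<in> cspan (chains (length xs))"
    using step(1)
  proof (induction xs)
    case Nil
    show ?case using cspan_X[OF finite_chains, of "{}" 0] by (simp add: chains_def)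
  next
    case (Cons F xs)
    then obtain b where b: "vmon xs - (\<Sum>\<sigma>\<in>chains (length xs). const (b \<sigma>) * X \<sigma>) \<in> I"
      unfolding cspan_def by auto
    have FV: "F \<in> V" using Cons by simp
    have m: "var F * (vmon xs - (\<Sum>\<sigma>\<in>chains (length xs). const (b \<sigma>) * X \<sigma>)) \<in> I"
      by (rule ideal_mult[OF b vars_in_var[OF FV]])
    have "(\<Sum>\<sigma>\<in>chains (length xs). const (b \<sigma>) * (X \<sigma> * divisor E r (xi F))) \<in> cspan (chains (Suc (length xs)))"
    proof (intro cspan_sum cspan_scale cspan_X_divisor finite_chains)
      fix \<sigma> G assume "\<sigma> \<in> chains (length xs)"
      then show "chain \<sigma>" by (simp add: chains_def)
      assume "\<sigma> \<in> chains (length xs)" "G \<in> link \<sigma>"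
      then show "insert G \<sigma> \<in> chains (Suc (length xs))"
        using link_notin[of G \<sigma>] chain_finite chain_insert by (auto simp: chains_def)
    qed
    then have "var F * (\<Sum>\<sigma>\<in>chains (length xs). const (b \<sigma>) * X \<sigma>) \<in> cspan (chains (Suc (length xs)))"
      by (simp add: divisor_xi[OF FV] sum_distrib_left mult_ac)
    from cspan_cong[OF this] m show ?case by (simp add: right_diff_distrib)
  qed
  then show ?case using step by (simp add: cspan_add cspan_scale)
qed (simp add: cspan_ideal)

end

section \<open>A spectral lemma\<close>

lemma quadratic_nonneg_linear_zero:
  fixes b c :: real
  assumes "\<And>s. 0 \<le> 2 * s * b + s\<^sup>2 * c"
  shows "b = 0"
proof (rule ccontr)
  assume b: "b \<noteq> 0"
  \<comment> \<open>k exceeds c, so the linear term wins at s = - b / k.\<close>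
  define k where "k = \<bar>c\<bar> + 1"
  have k: "k > 0" "c < k" by (auto simp: k_def)
  have "0 \<le> 2 * (- b / k) * b + (- b / k)\<^sup>2 * c" by (rule assms)
  also have "\<dots> = (b\<^sup>2 / k) * (c / k - 2)"
    using k by (simp add: field_simps power2_eq_square)
  also have "\<dots> < 0"
    by (rule mult_pos_neg) (use b k in \<open>auto simp: field_simps\<close>)
  finally show False by simp
qed

text \<open>Functions vanishing off S stand for vectors indexed by S. The ambient function space has
  the product topology, so the box is compact by Tychonoff.\<close>

lemma compact_box:
  fixes S :: "'b set"
  shows "compact {u :: 'b \<Rightarrow> real. \<forall>F. u F \<in> (if F \<in> S then {-C..C} else {0})}"
proof -
  have "compactin (product_topology (\<lambda>_. euclidean) UNIV) (PiE UNIV (\<lambda>F. if F \<in> S then {-C..C} else {0::real}))"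
    by (simp add: compactin_PiE)
  moreover have "PiE UNIV (\<lambda>F. if F \<in> S then {-C..C} else {0::real}) = {u. \<forall>F. u F \<in> (if F \<in> S then {-C..C} else {0})}"
    by (auto simp: PiE_def Pi_def)
  ultimately show ?thesis by (simp add: euclidean_product_topology)
qed

text \<open>The spectral argument of Shenfeld and van Handel: with respect to the weights w, the
  operator A of the form q satisfies A \<le> A A and A 1 = 1, and 1 - A is a graph Laplacian, so the
  top eigenvalue of A on the orthogonal complement of 1 is not positive.\<close>
lemma bochner:
  fixes q :: "'b \<Rightarrow> 'b \<Rightarrow> real" and w :: "'b \<Rightarrow> real"
  assumes S: "finite S"
    and sym: "\<And>F G. F \<in> S \<Longrightarrow> G \<in> S \<Longrightarrow> q F G = q G F"
    and off: "\<And>F G. F \<in> S \<Longrightarrow> G \<in> S \<Longrightarrow> F \<noteq> G \<Longrightarrow> 0 \<le> q F G"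
    and w: "\<And>F. F \<in> S \<Longrightarrow> w F = (\<Sum>G\<in>S. q F G)" "\<And>F. F \<in> S \<Longrightarrow> 0 < w F"
    and conn: "\<And>u :: 'b \<Rightarrow> real. (\<And>F G. F \<in> S \<Longrightarrow> G \<in> S \<Longrightarrow> q F G \<noteq> 0 \<Longrightarrow> u F = u G) \<Longrightarrow> \<forall>F\<in>S. \<forall>G\<in>S. u F = u G"
    and hyp: "\<And>v :: 'b \<Rightarrow> real. (\<Sum>F\<in>S. \<Sum>G\<in>S. q F G * v F * v G) \<le> (\<Sum>F\<in>S. (\<Sum>G\<in>S. q F G * v G)\<^sup>2 / w F)"
    and v: "(\<Sum>F\<in>S. w F * v F) = 0"
  shows "(\<Sum>F\<in>S. \<Sum>G\<in>S. q F G * v F * v G) \<le> 0"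
    and "(\<Sum>F\<in>S. \<Sum>G\<in>S. q F G * v F * v G) = 0 \<Longrightarrow> F \<in> S \<Longrightarrow> (\<Sum>G\<in>S. q F G * v G) = 0"
proof -
  define B where "B u v = (\<Sum>F\<in>S. \<Sum>G\<in>S. q F G * u F * v G)" for u v :: "'b \<Rightarrow> real"
  define N where "N u v = (\<Sum>F\<in>S. w F * u F * v F)" for u v :: "'b \<Rightarrow> real"
  define W where "W u \<longleftrightarrow> (\<Sum>F\<in>S. w F * u F) = 0" for u :: "'b \<Rightarrow> real"
  have B_sym: "B u v = B v u" for u v
    unfolding B_def by (subst sum.swap) (intro sum.cong refl, simp add: sym)
  have B_lin: "B (\<lambda>F. u F + s * t F) v = B u v + s * B t v" for u t v s
    unfolding B_def by (simp add: algebra_simps sum.distrib sum_distrib_left)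
  have N_sym: "N u v = N v u" for u v unfolding N_def by (simp add: mult_ac)
  have N_lin: "N (\<lambda>F. u F + s * t F) v = N u v + s * N t v" for u t v s
    unfolding N_def by (simp add: algebra_simps sum.distrib sum_distrib_left)
  have B_quad: "B (\<lambda>F. u F + s * t F) (\<lambda>F. u F + s * t F) = B u u + 2 * s * B u t + s\<^sup>2 * B t t" for u t s
    unfolding B_lin B_sym[of _ "\<lambda>F. u F + s * t F"]
    using B_sym[of t u] by (simp add: algebra_simps power2_eq_square)
  have N_quad: "N (\<lambda>F. u F + s * t F) (\<lambda>F. u F + s * t F) = N u u + 2 * s * N u t + s\<^sup>2 * N t t" for u t s
    unfolding N_lin N_sym[of _ "\<lambda>F. u F + s * t F"]
    using N_sym[of t u] by (simp add: algebra_simps power2_eq_square)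
  have W_lin: "W u \<Longrightarrow> W t \<Longrightarrow> W (\<lambda>F. u F + s * t F)" for u t s
    unfolding W_def by (simp add: algebra_simps sum.distrib sum_distrib_left[symmetric])
  have one: "B u (\<lambda>_. 1) = (\<Sum>F\<in>S. w F * u F)" for u
    unfolding B_sym[of u] unfolding B_def
    by (subst sum.swap) (intro sum.cong refl, simp add: w(1) sum_distrib_right sym)
  have N_one: "N u (\<lambda>_. 1) = (\<Sum>F\<in>S. w F * u F)" for u
    unfolding N_def by simp
  have B_delta: "B u (\<lambda>G. if G = F then 1 else 0) = (\<Sum>G\<in>S. q F G * u G)" if "F \<in> S" for u F
    unfolding B_sym[of u] unfolding B_def using S that
    by (simp add: if_distrib[of "\<lambda>x. _ * x * _"] sum.delta mult.assoc if_distrib[of "\<lambda>x. x * _"] sum.If_cases cong: if_cong)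
      (simp add: if_distrib[of "\<lambda>x. x * _"] if_distrib[of "\<lambda>x. _ * x"] sum.delta' sum.swap[of _ S S] cong: if_cong)
  have N_delta: "N u (\<lambda>G. if G = F then 1 else 0) = w F * u F" if "F \<in> S" for u F
    unfolding N_def using S that by (simp add: if_distrib[of "\<lambda>x. _ * x"] sum.delta cong: if_cong)
  have N_pos: "0 \<le> N u u" for u
    unfolding N_def by (intro sum_nonneg) (simp add: w(2) less_imp_le mult.assoc)
  have N_zero: "F \<in> S \<Longrightarrow> u F = 0" if "N u u = 0" for u F
  proof -
    assume F: "F \<in> S"
    have "\<forall>F\<in>S. w F * u F * u F = 0"
      using that unfolding N_def
      by (subst (asm) sum_nonneg_eq_0_iff) (use S w(2) in \<open>auto simp: less_imp_le mult.assoc\<close>)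
    then have "w F * (u F * u F) = 0" using F by (simp add: mult.assoc)
    then show "u F = 0" using w(2)[OF F] by simp
  qed
  \<comment> \<open>If b is semidefinite on the hyperplane W, a null vector in W is orthogonal to
    all of W; being orthogonal also to the constant 1, which is not in W, it is orthogonal to
    everything. Applied below to \<mu> N - B and to - B.\<close>
  have kernel: "b u t = 0"
    if lin: "\<And>u s t v. b v (\<lambda>F. u F + s * t F) = b v u + s * b v t"
      and quad: "\<And>u s t. b (\<lambda>F. u F + s * t F) (\<lambda>F. u F + s * t F) = b u u + 2 * s * b u t + s\<^sup>2 * b t t"
      and pos: "\<And>t. W t \<Longrightarrow> 0 \<le> b t t" and u: "W u" "b u u = 0" and o: "b u (\<lambda>_. 1) = 0"
      and ne: "S \<noteq> {}"
    for b :: "('b \<Rightarrow> real) \<Rightarrow> ('b \<Rightarrow> real) \<Rightarrow> real" and u t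
  proof -
    have wS: "0 < sum w S" using S ne w(2) by (intro sum_pos) auto
    define c where "c = - (\<Sum>F\<in>S. w F * t F) / sum w S"
    define t' where "t' = (\<lambda>F. t F + c * 1)"
    have "(\<Sum>F\<in>S. w F * t' F) = (\<Sum>F\<in>S. w F * t F) + c * sum w S"
      unfolding t'_def by (simp add: ring_distribs sum.distrib sum_distrib_left mult.commute)
    then have t': "W t'" unfolding W_def c_def using wS by simp
    have "0 \<le> 2 * s * b u t' + s\<^sup>2 * b t' t'" for s
      using pos[OF W_lin[OF u(1) t'], of s] quad[of u s t'] u(2) by simp
    then have "b u t' = 0" by (rule quadratic_nonneg_linear_zero)
    then show "b u t = 0" unfolding t'_def lin using o by simp
  qed
  have nonpos: "B u u \<le> 0" if Wu: "W u" for u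
  proof (rule ccontr)
    assume "\<not> B u u \<le> 0"
    then have Bu: "0 < B u u" by simp
    define K where "K = {t. (\<forall>F. F \<notin> S \<longrightarrow> t F = 0) \<and> W t \<and> N t t = 1}"
    have restrict: "B t t = B t' t' \<and> N t t = N t' t' \<and> (W t \<longleftrightarrow> W t')" if "\<And>F. F \<in> S \<Longrightarrow> t F = t' F" for t t'
      unfolding B_def N_def W_def using that by simp
    have scale: "B (\<lambda>F. c * t F) (\<lambda>F. c * t F) = c\<^sup>2 * B t t" "N (\<lambda>F. c * t F) (\<lambda>F. c * t F) = c\<^sup>2 * N t t"
      "W t \<Longrightarrow> W (\<lambda>F. c * t F)" for c t
      using B_quad[of "\<lambda>_. 0" c t] N_quad[of "\<lambda>_. 0" c t] W_lin[of "\<lambda>_. 0" t c]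
      by (auto simp: B_def N_def W_def)
    have norm: "\<exists>c>0. (\<lambda>F. if F \<in> S then c * t F else 0) \<in> K \<and> c\<^sup>2 * N t t = 1" if t: "W t" "N t t \<noteq> 0" for t
    proof -
      define c where "c = 1 / sqrt (N t t)"
      have p: "0 < N t t" using N_pos[of t] t by simp
      then have c: "0 < c" "c\<^sup>2 * N t t = 1" unfolding c_def by (auto simp: power_divide)
      have "(\<lambda>F. if F \<in> S then c * t F else 0) \<in> K"
        unfolding K_def using restrict[of "\<lambda>F. if F \<in> S then c * t F else 0" "\<lambda>F. c * t F"] scale(2)[of c t] scale(3)[OF t(1), of c] c t by simp
      then show ?thesis using c by blast
    qed
    have "N u u \<noteq> 0"
    proof
      assume "N u u = 0"
      then have "B u u = 0" unfolding B_def using N_zero[of u] by simp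
      then show False using Bu by simp
    qed
    from norm[OF Wu this] have Kne: "K \<noteq> {}" by blast
    have ne: "S \<noteq> {}" using Bu by (auto simp: B_def)
    define m where "m = Min (w ` S)"
    have m: "0 < m" "\<And>F. F \<in> S \<Longrightarrow> m \<le> w F" unfolding m_def using S ne w(2) by auto
    \<comment> \<open>On K each squared coordinate is at most 1 / m, and C bounds its root without
      mentioning one.\<close>
    define C where "C = 1 + 1 / m"
    have box: "K \<subseteq> {t. \<forall>F. t F \<in> (if F \<in> S then {-C..C} else {0})}"
    proof (intro subsetI CollectI allI)
      fix t F assume t: "t \<in> K"
      show "t F \<in> (if F \<in> S then {-C..C} else {0})"
      proof (cases "F \<in> S")
        case True
        have "w F * t F * t F \<le> N t t"
          unfolding N_def by (rule member_le_sum) (use True S w(2) in \<open>auto simp: less_imp_le mult.assoc\<close>)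
        then have "w F * (t F)\<^sup>2 \<le> 1" using t by (simp add: K_def power2_eq_square mult.assoc)
        moreover have "m * (t F)\<^sup>2 \<le> w F * (t F)\<^sup>2" using m(2)[OF True] by (intro mult_right_mono) auto
        ultimately have "(t F)\<^sup>2 \<le> 1 / m" using m(1) by (simp add: field_simps)
        moreover have "1 / m \<le> C\<^sup>2" using m(1) by (simp add: C_def power2_eq_square field_simps)
        ultimately have "\<bar>t F\<bar> \<le> C" using m(1) by (intro abs_le_square_iff[THEN iffD2, of "t F" C, THEN order_trans]) (auto simp: C_def)
        then show ?thesis using True by auto
      next
        case False
        then show ?thesis using t by (simp add: K_def)
      qed
    qed
    have cont: "continuous_on UNIV (\<lambda>t. B t t)" "continuous_on UNIV (\<lambda>t. N t t)" "continuous_on UNIV (\<lambda>t. \<Sum>F\<in>S. w F * t F)"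
      unfolding B_def N_def
      by (intro continuous_on_sum continuous_on_mult continuous_on_const continuous_on_product_coordinates)+
    have Keq: "K = {t. \<forall>F. t F \<in> (if F \<in> S then {-C..C} else {0})} \<inter> ({t. (\<Sum>F\<in>S. w F * t F) = 0} \<inter> {t. N t t = 1})"
      using box unfolding K_def W_def by (auto split: if_splits)
    have "closed ({t. (\<Sum>F\<in>S. w F * t F) = 0} \<inter> {t. N t t = 1})"
      by (intro closed_Int closed_Collect_eq cont continuous_on_const)
    then have "compact K" unfolding Keq by (rule compact_Int_closed[OF compact_box])
    from continuous_attains_sup[OF this Kne continuous_on_subset[OF cont(1)]]
    obtain u0 where u0: "u0 \<in> K" "\<And>t. t \<in> K \<Longrightarrow> B t t \<le> B u0 u0" by auto
    define \<mu> where "\<mu> = B u0 u0"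
    have u0': "W u0" "N u0 u0 = 1" using u0(1) by (auto simp: K_def)
    have max: "B t t \<le> \<mu> * N t t" if t: "W t" for t
    proof (cases "N t t = 0")
      case True
      then have "B t t = 0" unfolding B_def using N_zero[of t] by simp
      then show ?thesis using True by simp
    next
      case False
      from norm[OF t this] obtain c where c: "0 < c" "(\<lambda>F. if F \<in> S then c * t F else 0) \<in> K" "c\<^sup>2 * N t t = 1" by blast
      have "c\<^sup>2 * B t t \<le> \<mu>"
        using u0(2)[OF c(2)] restrict[of "\<lambda>F. if F \<in> S then c * t F else 0" "\<lambda>F. c * t F"] scale(1)[of c t]
        by (simp add: \<mu>_def)
      also have "\<mu> = c\<^sup>2 * (\<mu> * N t t)" using c(3) by (simp add: algebra_simps)
      finally show ?thesis using c(1) by simp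
    qed
    have "0 < \<mu>"
    proof -
      have "0 < \<mu> * N u u" using max[OF Wu] Bu by linarith
      then show ?thesis using N_pos[of u] by (simp add: zero_less_mult_iff)
    qed
    \<comment> \<open>A maximiser of the Rayleigh quotient is an eigenvector: \<mu> N - B is
      nonnegative on the hyperplane and vanishes at \<open>u0\<close>.\<close>
    have eig: "B u0 t = \<mu> * N u0 t" for t
    proof -
      have "\<mu> * N u0 t - B u0 t = 0"
      proof (rule kernel[of "\<lambda>u t. \<mu> * N u t - B u t"])
        show "\<mu> * N v (\<lambda>F. u F + s * t F) - B v (\<lambda>F. u F + s * t F) = \<mu> * N v u - B v u + s * (\<mu> * N v t - B v t)" for u s t v
          unfolding N_sym[of v] B_sym[of v] N_lin B_lin by (simp add: algebra_simps)
        show "\<mu> * N (\<lambda>F. u F + s * t F) (\<lambda>F. u F + s * t F) - B (\<lambda>F. u F + s * t F) (\<lambda>F. u F + s * t F) =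
           \<mu> * N u u - B u u + 2 * s * (\<mu> * N u t - B u t) + s\<^sup>2 * (\<mu> * N t t - B t t)" for u s t
          unfolding N_quad B_quad by (simp add: algebra_simps)
        show "0 \<le> \<mu> * N t t - B t t" if "W t" for t using max[OF that] by simp
      qed (use u0' ne one[of u0] N_one[of u0] in \<open>auto simp: W_def \<mu>_def\<close>)
      then show ?thesis by simp
    qed
    have A: "(\<Sum>G\<in>S. q F G * u0 G) = \<mu> * (w F * u0 F)" if "F \<in> S" for F
      using eig[of "\<lambda>G. if G = F then 1 else 0"] B_delta[OF that] N_delta[OF that] by simp
    \<comment> \<open>At an eigenvector the inequality A \<le> A A reads \<mu> \<le> \<mu> \<mu>, so
      a positive eigenvalue is at least 1.\<close>
    have "\<mu> \<le> (\<Sum>F\<in>S. (\<Sum>G\<in>S. q F G * u0 G)\<^sup>2 / w F)"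
      using hyp[of u0] by (simp add: \<mu>_def B_def)
    also have "\<dots> = (\<Sum>F\<in>S. \<mu>\<^sup>2 * (w F * u0 F * u0 F))"
    proof (intro sum.cong refl)
      fix F assume F: "F \<in> S"
      then show "(\<Sum>G\<in>S. q F G * u0 G)\<^sup>2 / w F = \<mu>\<^sup>2 * (w F * u0 F * u0 F)"
        using w(2)[OF F] A[OF F] by (simp add: power2_eq_square field_simps)
    qed
    also have "\<dots> = \<mu>\<^sup>2" using u0'(2) by (simp add: sum_distrib_left[symmetric] N_def)
    finally have "1 \<le> \<mu>" using \<open>0 < \<mu>\<close> by (simp add: power2_eq_square)
    \<comment> \<open>The Laplacian has the value 1 - \<mu> \<le> 0 at \<open>u0\<close>, so all its
      terms vanish and \<open>u0\<close> is constant by connectedness; a constant in the hyperplane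
      is 0. Diagonal entries of q can be negative, but their terms are 0.\<close>
    have lap: "N u0 u0 - B u0 u0 = (\<Sum>F\<in>S. \<Sum>G\<in>S. q F G * (u0 F - u0 G)\<^sup>2) / 2"
    proof -
      have "(\<Sum>F\<in>S. \<Sum>G\<in>S. q F G * (u0 F - u0 G)\<^sup>2)
         = (\<Sum>F\<in>S. \<Sum>G\<in>S. q F G * u0 F * u0 F) + (\<Sum>F\<in>S. \<Sum>G\<in>S. q F G * u0 G * u0 G) - 2 * B u0 u0"
        unfolding B_def by (simp add: power2_eq_square algebra_simps sum.distrib sum_subtractf sum_distrib_left)
      moreover have "(\<Sum>F\<in>S. \<Sum>G\<in>S. q F G * u0 F * u0 F) = N u0 u0"
        unfolding N_def by (intro sum.cong refl) (simp add: w(1) sum_distrib_right)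
      moreover have "(\<Sum>F\<in>S. \<Sum>G\<in>S. q F G * u0 G * u0 G) = N u0 u0"
        unfolding N_def by (subst sum.swap) (intro sum.cong refl, simp add: w(1) sum_distrib_right sym)
      ultimately show ?thesis by simp
    qed
    have terms: "0 \<le> q F G * (u0 F - u0 G)\<^sup>2" if "F \<in> S" "G \<in> S" for F G
      using off[OF that] by (cases "F = G") auto
    have inner: "0 \<le> (\<Sum>G\<in>S. q F G * (u0 F - u0 G)\<^sup>2)" if "F \<in> S" for F
      by (intro sum_nonneg terms that)
    have "1 - \<mu> = (\<Sum>F\<in>S. \<Sum>G\<in>S. q F G * (u0 F - u0 G)\<^sup>2) / 2"
      using lap u0'(2) by (simp add: \<mu>_def)
    moreover have "0 \<le> (\<Sum>F\<in>S. \<Sum>G\<in>S. q F G * (u0 F - u0 G)\<^sup>2)" by (intro sum_nonneg inner)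
    ultimately have z: "(\<Sum>F\<in>S. \<Sum>G\<in>S. q F G * (u0 F - u0 G)\<^sup>2) = 0" using \<open>1 \<le> \<mu>\<close> by linarith
    have "u0 F = u0 G" if "F \<in> S" "G \<in> S" "q F G \<noteq> 0" for F G
    proof -
      have "(\<Sum>G\<in>S. q F G * (u0 F - u0 G)\<^sup>2) = 0"
        using z S inner that(1) by (simp add: sum_nonneg_eq_0_iff)
      then have "q F G * (u0 F - u0 G)\<^sup>2 = 0"
        using S terms[OF that(1)] that(2) by (simp add: sum_nonneg_eq_0_iff)
      then show ?thesis using that by simp
    qed
    then have const: "\<forall>F\<in>S. \<forall>G\<in>S. u0 F = u0 G" by (rule conn)
    obtain F0 where F0: "F0 \<in> S" using ne by blast
    have c0: "u0 F = u0 F0" if "F \<in> S" for F using const that F0 by blast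
    have "(\<Sum>F\<in>S. w F * u0 F) = (\<Sum>F\<in>S. u0 F0 * w F)"
      by (intro sum.cong refl) (simp add: c0)
    then have "(\<Sum>F\<in>S. w F * u0 F) = u0 F0 * sum w S" by (simp add: sum_distrib_left)
    moreover have "0 < sum w S" using S ne w(2) by (intro sum_pos) auto
    ultimately have "u0 F0 = 0" using u0'(1) by (simp add: W_def)
    then have "N u0 u0 = 0" unfolding N_def using c0 by (intro sum.neutral) simp
    then show False using u0'(2) by simp
  qed
  have Wv: "W v" using v by (simp add: W_def)
  from nonpos[OF this] show "(\<Sum>F\<in>S. \<Sum>G\<in>S. q F G * v F * v G) \<le> 0" by (simp add: B_def)
  \<comment> \<open>Now - B is known to be semidefinite on the hyperplane, so a null vector lies in
    the kernel of the form.\<close>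
  assume z: "(\<Sum>F\<in>S. \<Sum>G\<in>S. q F G * v F * v G) = 0" and F: "F \<in> S"
  have "- B v t = 0" for t
  proof (rule kernel[of "\<lambda>u t. - B u t"])
    show "- B v (\<lambda>F. u F + s * t F) = - B v u + s * - B v t" for u s t v
      unfolding B_sym[of v] B_lin by simp
    show "- B (\<lambda>F. u F + s * t F) (\<lambda>F. u F + s * t F) = - B u u + 2 * s * - B u t + s\<^sup>2 * - B t t" for u s t
      unfolding B_quad by simp
    show "0 \<le> - B t t" if "W t" for t using nonpos[OF that] by simp
  qed (use Wv z F one[of v] in \<open>auto simp: W_def B_def\<close>)
  from this[of "\<lambda>G. if G = F then 1 else 0"] show "(\<Sum>G\<in>S. q F G * v G) = 0"
    using B_delta[OF F] by simp
qed

section \<open>Ample classes\<close>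

text \<open>The Hodge index property of a Lorentzian form: Cauchy-Schwarz for f and g, with
  orthogonality and the positive value at (s', g), leaves no room for a positive value at (s,
  f).\<close>

lemma reversed_Cauchy_Schwarz:
  fixes s s' :: real and f g :: "'b \<Rightarrow> real"
  assumes T: "finite T" and pos: "s' * s' - (\<Sum>x\<in>T. g x * g x) > 0" and orth: "s * s' - (\<Sum>x\<in>T. f x * g x) = 0"
  shows "s * s - (\<Sum>x\<in>T. f x * f x) \<le> 0"
    and "s * s - (\<Sum>x\<in>T. f x * f x) = 0 \<Longrightarrow> s = 0 \<and> (\<forall>x\<in>T. f x = 0)"
proof -
  let ?f = "\<Sum>x\<in>T. f x * f x" and ?g = "\<Sum>x\<in>T. g x * g x"
  have "(\<Sum>x\<in>T. f x * g x)\<^sup>2 \<le> (\<Sum>x\<in>T. (f x)\<^sup>2) * (\<Sum>x\<in>T. (g x)\<^sup>2)"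
    by (rule Cauchy_Schwarz_ineq_sum)
  then have "(s * s')\<^sup>2 \<le> ?f * ?g" using orth by (simp add: power2_eq_square)
  then have cs: "(s * s) * (s' * s') \<le> ?f * ?g" by (simp add: power2_eq_square mult_ac)
  have f: "0 \<le> ?f" "0 \<le> ?g" by (simp_all add: sum_nonneg)
  have s': "0 < s' * s'" using pos f by linarith
  have strict: "s * s < ?f" if "0 < ?f"
  proof -
    have "?f * ?g < ?f * (s' * s')" using that pos by simp
    then have "(s * s) * (s' * s') < ?f * (s' * s')" using cs by linarith
    then show ?thesis using s' by (simp add: mult_less_cancel_right)
  qed
  have zero: "s = 0 \<and> (\<forall>x\<in>T. f x = 0)" if "?f = 0"
  proof -
    have "\<forall>x\<in>T. f x = 0" using that T by (subst (asm) sum_nonneg_eq_0_iff) auto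
    moreover have "s * s' = 0" using orth calculation by simp
    ultimately show ?thesis using s' by auto
  qed
  consider "?f = 0" | "0 < ?f" using f by linarith
  then have "s * s - ?f \<le> 0 \<and> (s * s - ?f = 0 \<longrightarrow> s = 0 \<and> (\<forall>x\<in>T. f x = 0))"
  proof cases
    case 1
    then show ?thesis using zero by simp
  next
    case 2
    then show ?thesis using strict by linarith
  qed
  then show "s * s - ?f \<le> 0" "s * s - ?f = 0 \<Longrightarrow> s = 0 \<and> (\<forall>x\<in>T. f x = 0)" by blast+
qed

lemma const_2: "const 2 = 2"
  using const_add[of 1 1] by simp

section \<open>Pairings on links and their connectedness\<close>

context chow
begin

lemma dg_mult_ideal: "p \<in> I \<Longrightarrow> vars_in V q \<Longrightarrow> dg (p * q) = 0"
  using dg_ideal[OF ideal_mult[of p q]] by (simp add: mult.commute)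

lemma dg_cong: "p - p' \<in> I \<Longrightarrow> vars_in V q \<Longrightarrow> dg (p * q) = dg (p' * q)"
  using dg_mult_ideal[of "p - p'" q] by (simp add: left_diff_distrib dg_diff)

lemma dg_expand:
  assumes "p - (\<Sum>G\<in>S. const (c G) * Y G) \<in> I" "vars_in V q"
  shows "dg (p * q) = (\<Sum>G\<in>S. c G * dg (Y G * q))"
  unfolding dg_cong[OF assms] by (simp add: sum_distrib_right mult.assoc dg_sum dg_scale)

lemma V_rank_eq: "F \<in> V \<Longrightarrow> G \<in> V \<Longrightarrow> r F = r G \<Longrightarrow> cmp F G \<Longrightarrow> F = G"
  using V_rank_less[of F G] V_rank_less[of G F] unfolding cmp_def by (metis less_irrefl psubsetI)

lemma card_insert_link: "chain \<sigma> \<Longrightarrow> G \<in> link \<sigma> \<Longrightarrow> card (insert G \<sigma>) = Suc (card \<sigma>)"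
  by (simp add: chain_finite link_notin)

lemma X_insert_link: "chain \<sigma> \<Longrightarrow> G \<in> link \<sigma> \<Longrightarrow> X (insert G \<sigma>) = var G * X \<sigma>"
  by (simp add: X_insert link_notin)

text \<open>Lets the degree form of divisors on a link be computed in the variables of the link,
  even when the divisors involve members of the chain.\<close>

lemma link_rep:
  assumes \<sigma>: "chain \<sigma>"
  shows "\<exists>b. X \<sigma> * divisor E r u - X \<sigma> * divisor E r (\<lambda>G. if G \<in> link \<sigma> then b G else 0) \<in> I"
proof -
  obtain b where b: "X \<sigma> * divisor E r u - (\<Sum>G\<in>link \<sigma>. const (b G) * X (insert G \<sigma>)) \<in> I"
    using X_divisor_link[OF \<sigma>] by blast
  have "X \<sigma> * divisor E r (\<lambda>G. if G \<in> link \<sigma> then b G else 0)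
      - (\<Sum>G\<in>link \<sigma>. const (if G \<in> link \<sigma> then b G else 0) * X (insert G \<sigma>)) \<in> I"
    by (rule X_divisor[OF \<sigma>]) (simp add: link_def)
  moreover have "(\<Sum>G\<in>link \<sigma>. const (if G \<in> link \<sigma> then b G else 0) * X (insert G \<sigma>))
      = (\<Sum>G\<in>link \<sigma>. const (b G) * X (insert G \<sigma>))" by (rule sum.cong) auto
  ultimately have "X \<sigma> * divisor E r (\<lambda>G. if G \<in> link \<sigma> then b G else 0)
      - (\<Sum>G\<in>link \<sigma>. const (b G) * X (insert G \<sigma>)) \<in> I" by simp
  from ideal_diff[OF b this] show ?thesis by (intro exI[of _ b]) simp
qed

lemma divisor_link: "divisor E r (\<lambda>G. if G \<in> link \<sigma> then b G else 0) = (\<Sum>G\<in>link \<sigma>. const (b G) * var G)"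
proof -
  have "divisor E r (\<lambda>G. if G \<in> link \<sigma> then b G else 0) = (\<Sum>G\<in>V. if G \<in> link \<sigma> then const (b G) * var G else 0)"
    unfolding divisor_def by (intro sum.cong refl) auto
  also have "\<dots> = (\<Sum>G\<in>V \<inter> link \<sigma>. const (b G) * var G)" by (simp add: sum.inter_restrict)
  also have "V \<inter> link \<sigma> = link \<sigma>" using link_V by blast
  finally show ?thesis .
qed

lemma gap_link_cases:
  assumes \<sigma>: "chain \<sigma>" and g: "gap \<sigma> j H K" and G: "G \<in> link \<sigma>"
  shows "G \<subseteq> H \<or> K \<subseteq> G \<or> (H \<subset> G \<and> G \<subset> K)"
proof -
  have GV: "G \<in> V" "G \<notin> \<sigma>" "G \<noteq> {}" "G \<noteq> E" "G \<subseteq> E"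
    using link_V[OF G] link_notin[OF G] E_notin_V empty_notin_V np_subset by auto
  have "H = {} \<or> H \<in> \<sigma>" "K = E \<or> K \<in> \<sigma>" using g unfolding gap_def by auto
  then have "H \<subseteq> G \<or> G \<subseteq> H" "K \<subseteq> G \<or> G \<subseteq> K" "H \<noteq> G" "K \<noteq> G"
    using link_comp[OF G] GV by auto
  then show ?thesis by auto
qed

text \<open>Two incomparable vertices lie in one gap. If it has at least two inner ranks, descend to
  atoms above H and join these: the join has rank at most r H + 2 and stays below K. Otherwise some
  other rank is missing, and a flat from its gap is comparable to both.\<close>

lemma link_connected:
  assumes \<sigma>: "chain \<sigma>" "card \<sigma> + 2 \<le> d"
    and u: "\<And>F G. F \<in> link \<sigma> \<Longrightarrow> G \<in> link \<sigma> \<Longrightarrow> cmp F G \<Longrightarrow> u F = u G"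
    and F: "F \<in> link \<sigma>" and G: "G \<in> link \<sigma>"
  shows "u F = u G"
proof (cases "cmp F G")
  case True
  then show ?thesis using u F G by blast
next
  case False
  define j where "j = r F"
  have j: "j \<notin> r ` \<sigma>" "1 \<le> j" "j \<le> d"
    using link_rank[OF \<sigma>(1) F] V_rank[OF link_V[OF F]] by (auto simp: j_def)
  obtain H K where g: "gap \<sigma> j H K" using gap_exists[OF \<sigma>(1) j(2,3)] by blast
  note gf = gap_flats[OF \<sigma>(1) g]
  have HFK: "H \<subset> F" "F \<subset> K" using gap_linkD[OF \<sigma>(1) g F] by (auto simp: j_def)
  have HGK: "H \<subset> G" "G \<subset> K"
    using gap_link_cases[OF \<sigma>(1) g G] False HFK unfolding cmp_def by (meson psubset_imp_subset subset_trans)+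
  have fl: "is_flat E r F" "is_flat E r G" "F \<subseteq> E" "G \<subseteq> E" "K \<subseteq> E"
    using np_flat[OF link_V[OF F]] np_flat[OF link_V[OF G]] gf flat_subset by auto
  have rk: "r H < r F" "r F < r K" "r H < r G" "r G < r K"
    using flat_rank_less[OF gf(1) fl(3) HFK(1)] flat_rank_less[OF gf(1) fl(4) HGK(1)]
      flat_rank_less[OF fl(1,5) HFK(2)] flat_rank_less[OF fl(2,5) HGK(2)] by auto
  show ?thesis
  proof (cases "r H + 3 \<le> r K")
    case True
    obtain P where P: "is_flat E r P" "H \<subseteq> P" "P \<subseteq> F" "r P = Suc (r H)"
      using flat_between[OF gf(1) fl(1), of "Suc (r H)"] HFK rk by auto
    obtain P' where P': "is_flat E r P'" "H \<subseteq> P'" "P' \<subseteq> G" "r P' = Suc (r H)"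
      using flat_between[OF gf(1) fl(2), of "Suc (r H)"] HGK rk by auto
    have sub: "P \<subseteq> E" "P' \<subseteq> E" using P P' flat_subset by auto
    define J where "J = cl E r (P \<union> P')"
    have J: "is_flat E r J" "P \<subseteq> J" "P' \<subseteq> J" "r J = r (P \<union> P')" "J \<subseteq> K"
    proof -
      have PP: "P \<union> P' \<subseteq> E" "P \<union> P' \<subseteq> K" using sub P(3) P'(3) HFK(2) HGK(2) by blast+
      show "is_flat E r J" "P \<subseteq> J" "P' \<subseteq> J" "r J = r (P \<union> P')" "J \<subseteq> K"
        unfolding J_def using flat_cl[OF PP(1)] subset_cl[OF PP(1)] rank_cl[OF PP(1)]
          cl_mono_flat[OF gf(2) PP(2)] by simp_all
    qed
    have "r (P \<union> P') + r (P \<inter> P') \<le> r P + r P'" by (rule rank_submod) (use sub in auto)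
    moreover have "r H \<le> r (P \<inter> P')" by (rule rank_mono) (use P P' sub in auto)
    ultimately have rJ: "r J < r K" using J P P' True by linarith
    have Pl: "P \<in> link \<sigma>" by (rule gap_linkI[OF \<sigma>(1) g j(1) P(1)]) (use P HFK in auto)
    have P'l: "P' \<in> link \<sigma>" by (rule gap_linkI[OF \<sigma>(1) g j(1) P'(1)]) (use P' HGK in auto)
    have "H \<subset> J" using J P by auto
    moreover have "J \<subset> K" using J(5) rJ by auto
    ultimately have Jl: "J \<in> link \<sigma>" by (rule gap_linkI[OF \<sigma>(1) g j(1) J(1)])
    have "u F = u P" "u P = u J" "u J = u P'" "u P' = u G"
      by (rule u; use F G Pl P'l Jl J P P' in \<open>simp add: cmp_def\<close>)+
    then show ?thesis by simp
  next
    case False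
    then have rj: "r F = j" "r G = j" "j = Suc (r H)" "r K = Suc j" using rk by (auto simp: j_def)
    have "card (r ` \<sigma> \<union> {j}) < card {1..d}"
      using \<sigma> chain_card[OF \<sigma>(1)] card_Un_le[of "r ` \<sigma>" "{j}"] by simp
    then have "\<not> {1..d} \<subseteq> r ` \<sigma> \<union> {j}" using card_mono[of "r ` \<sigma> \<union> {j}" "{1..d}"] chain_finite[OF \<sigma>(1)] by auto
    then obtain j' where "j' \<in> {1..d}" "j' \<notin> r ` \<sigma>" "j' \<noteq> j" by blast
    then obtain M where M: "M \<in> link \<sigma>" "r M = j'" using extend_rank[OF \<sigma>(1), of j'] by (meson atLeastAtMost_iff)
    have "\<not> (H \<subset> M \<and> M \<subset> K)"
    proof
      assume a: "H \<subset> M \<and> M \<subset> K"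
      have "M \<subseteq> E" "is_flat E r M" using M link_V np_flat np_subset by auto
      then have "r H < r M" "r M < r K"
        using a flat_rank_less[OF gf(1)] flat_rank_less[OF _ fl(5)] by auto
      then show False using rj M \<open>j' \<noteq> j\<close> by simp
    qed
    then have "M \<subseteq> H \<or> K \<subseteq> M" using gap_link_cases[OF \<sigma>(1) g M(1)] by blast
    then have "cmp F M" "cmp M G" using HFK HGK unfolding cmp_def by auto
    then show ?thesis using u F G M by metis
  qed
qed

end

section \<open>Positivity of ample classes on links\<close>

locale chow_ample = chow +
  fixes a :: "'a set \<Rightarrow> real"
  assumes ample: "comb_ample_fun E a"
begin

abbreviation "L \<equiv> divisor E r a"

lemma L_homs: "L \<in> homs V 1" by (rule divisor_homs)

lemma L_vars: "vars_in V (L ^ n)" by (intro vars_in_power divisor_vars)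

lemma a_simps: "a {} = 0" "a E = 0"
  using ample by (auto simp: comb_ample_fun_def)

lemma a_submod: "\<forall>A B. A \<subseteq> E \<and> B \<subseteq> E \<longrightarrow> a A + a B \<ge> a (A \<union> B) + a (A \<inter> B)"
  using ample by (auto simp: comb_ample_fun_def)

lemma a_strict: "A \<subseteq> E \<Longrightarrow> B \<subseteq> E \<Longrightarrow> \<not> A \<subseteq> B \<Longrightarrow> \<not> B \<subseteq> A \<Longrightarrow> a A + a B > a (A \<union> B) + a (A \<inter> B)"
  using ample unfolding comb_ample_fun_def by blast

text \<open>To make the interpolating modular function strictly smaller than a at G, force it to be tight
  at a set S incomparable to G.\<close>
lemma strict_interpolation:
  assumes \<sigma>: "chain \<sigma>" and G: "G \<in> link \<sigma>"
  shows "\<exists>w. (\<forall>A\<in>insert E \<sigma>. sum w A = a A) \<and> (\<forall>A\<subseteq>E. sum w A \<le> a A) \<and> sum w G < a G"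
proof -
  define j where "j = r G"
  have j: "j \<notin> r ` \<sigma>" "1 \<le> j" "j \<le> d"
    using link_rank[OF \<sigma> G] V_rank[OF link_V[OF G]] by (auto simp: j_def)
  obtain H K where g: "gap \<sigma> j H K" using gap_exists[OF \<sigma> j(2,3)] by blast
  note gf = gap_flats[OF \<sigma> g]
  have HGK: "H \<subset> G" "G \<subset> K" using gap_linkD[OF \<sigma> g G] by (auto simp: j_def)
  then obtain f where f: "f \<in> K" "f \<notin> G" by blast
  \<comment> \<open>S lies between H and K, hence is comparable to the whole chain, but it is
    incomparable to G: it contains f outside G and misses an element of G outside H.\<close>
  define S where "S = insert f H"
  have KE: "K \<subseteq> E" "G \<subseteq> E" using flat_subset[OF gf(2)] np_subset[OF link_V[OF G]] by simp_all
  then have SE: "S \<subseteq> E" "S \<subseteq> K" "H \<subseteq> S" unfolding S_def using f(1) gf(3) by blast+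
  have c: "F \<subseteq> S \<or> S \<subseteq> F" if "F \<in> \<sigma>" for F
  proof -
    have "r F \<noteq> j" using j that by blast
    then have "F \<subseteq> H \<or> K \<subseteq> F" using g that unfolding gap_def by (meson linorder_neqE_nat)
    then show ?thesis using SE by blast
  qed
  have sub: "insert S (insert E \<sigma>) \<subseteq> Pow E" using SE chain_V[OF \<sigma>] np_subset by blast
  have ch: "A \<subseteq> B \<or> B \<subseteq> A" if "A \<in> insert S (insert E \<sigma>)" "B \<in> insert S (insert E \<sigma>)" for A B
  proof (cases "A = S \<or> B = S")
    case True
    then show ?thesis using that c SE(1) by blast
  next
    case False
    then show ?thesis using that chain_E_comp[OF \<sigma>, of A B] by blast
  qed
  obtain w where w: "\<And>A. A \<in> insert S (insert E \<sigma>) \<Longrightarrow> sum w A = a A" "\<And>A. A \<subseteq> E \<Longrightarrow> sum w A \<le> a A"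
    using modular_interpolation[OF finite_E sub ch, where a = a] a_simps(1) a_submod by metis
  have fin: "finite G" "finite S" using KE SE finite_subset finite_E by metis+
  \<comment> \<open>Tightness at S, modularity of w and strict submodularity of a for the pair G, S
    force strictness at G.\<close>
  have "sum w (G \<union> S) + sum w (G \<inter> S) = sum w G + sum w S" by (rule sum.union_inter[OF fin])
  moreover have "sum w (G \<union> S) \<le> a (G \<union> S)" "sum w (G \<inter> S) \<le> a (G \<inter> S)"
    by (rule w(2); use KE SE in blast)+
  moreover have "a (G \<union> S) + a (G \<inter> S) < a G + a S"
  proof (rule a_strict)
    show "\<not> G \<subseteq> S" using HGK f by (auto simp: S_def)
    show "\<not> S \<subseteq> G" using f by (auto simp: S_def)
  qed (use KE SE in auto)
  moreover have "sum w S = a S" using w(1) by simp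
  ultimately have "sum w G < a G" by linarith
  then show ?thesis using w by (intro exI[of _ w]) simp
qed

text \<open>A function from \<open>strict_interpolation\<close> is only known to be strict at one
  vertex. The average over the link is still tight on the chain and strict at all vertices; c is the
  difference between a and this average.\<close>

lemma ample_link:
  assumes \<sigma>: "chain \<sigma>"
  shows "\<exists>c. (\<forall>G\<in>link \<sigma>. 0 < c G) \<and> X \<sigma> * L - (\<Sum>G\<in>link \<sigma>. const (c G) * X (insert G \<sigma>)) \<in> I"
proof (cases "link \<sigma> = {}")
  case True
  then show ?thesis using X_divisor_link[OF \<sigma>, of a] by auto
next
  case False
  let ?n = "real (card (link \<sigma>))"
  have n: "0 < ?n" using False by (simp add: card_gt_0_iff)
  have "\<forall>G\<in>link \<sigma>. \<exists>w. (\<forall>A\<in>insert E \<sigma>. sum w A = a A) \<and> (\<forall>A\<subseteq>E. sum w A \<le> a A) \<and> sum w G < a G"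
    using strict_interpolation[OF \<sigma>] by blast
  then obtain w where w: "\<And>G A. G \<in> link \<sigma> \<Longrightarrow> A \<in> insert E \<sigma> \<Longrightarrow> sum (w G) A = a A"
    "\<And>G A. G \<in> link \<sigma> \<Longrightarrow> A \<subseteq> E \<Longrightarrow> sum (w G) A \<le> a A" "\<And>G. G \<in> link \<sigma> \<Longrightarrow> sum (w G) G < a G"
    by metis
  define m where "m e = (\<Sum>G\<in>link \<sigma>. w G e) / ?n" for e
  have m: "sum m A = (\<Sum>G\<in>link \<sigma>. sum (w G) A) / ?n" for A
    unfolding m_def sum_divide_distrib[symmetric] by (subst sum.swap) simp
  have tight: "sum m A = a A" if "A \<in> insert E \<sigma>" for A
    unfolding m using w(1)[OF _ that] n False by simp
  have less: "sum m G < a G" if G: "G \<in> link \<sigma>" for G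
  proof -
    have GE: "G \<subseteq> E" using link_V[OF G] np_subset by blast
    have "(\<Sum>G'\<in>link \<sigma>. sum (w G') G) < (\<Sum>G'\<in>link \<sigma>. a G)"
      by (rule sum_strict_mono_ex1) (use w(2)[OF _ GE] w(3)[OF G] G in auto)
    then show ?thesis unfolding m using n by (simp add: field_simps)
  qed
  define c where "c F = a F - sum m F" for F
  have "X \<sigma> * divisor E r c - (\<Sum>G\<in>link \<sigma>. const (c G) * X (insert G \<sigma>)) \<in> I"
    by (rule X_divisor[OF \<sigma>]) (simp add: c_def tight)
  moreover have "X \<sigma> * divisor E r (\<lambda>F. sum m F) \<in> I"
    by (intro ideal_mult modular_divisor_ideal X_vars \<sigma>) (simp add: tight a_simps)
  ultimately have "X \<sigma> * divisor E r c - (\<Sum>G\<in>link \<sigma>. const (c G) * X (insert G \<sigma>)) + X \<sigma> * divisor E r (\<lambda>F. sum m F) \<in> I"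
    by (rule ideal_add)
  moreover have "divisor E r c = L - divisor E r (\<lambda>F. sum m F)" unfolding c_def by (rule divisor_diff)
  ultimately show ?thesis using less by (intro exI[of _ c]) (simp add: c_def algebra_simps)
qed

text \<open>Expanding one factor L over the link leaves positive multiples of the same number for
  longer chains, down to complete flags of degree 1.\<close>

lemma dg_pos: "chain \<sigma> \<Longrightarrow> card \<sigma> + k = d \<Longrightarrow> 0 < dg (X \<sigma> * L ^ k)"
proof (induction k arbitrary: \<sigma>)
  case 0
  then show ?case using dg_flag by simp
next
  case (Suc k)
  obtain c where c: "\<forall>G\<in>link \<sigma>. 0 < c G" "X \<sigma> * L - (\<Sum>G\<in>link \<sigma>. const (c G) * X (insert G \<sigma>)) \<in> I"
    using ample_link[OF Suc(2)] by blast
  have "r ` \<sigma> \<noteq> {1..d}" using chain_card[OF Suc(2)] Suc(3) by auto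
  then obtain j where "j \<in> {1..d}" "j \<notin> r ` \<sigma>" using chain_ranks[OF Suc(2)] by blast
  then obtain G where G: "G \<in> link \<sigma>" using extend_rank[OF Suc(2), of j] by (meson atLeastAtMost_iff)
  have "dg (X \<sigma> * L ^ Suc k) = (\<Sum>G\<in>link \<sigma>. c G * dg (X (insert G \<sigma>) * L ^ k))"
    using dg_expand[OF c(2) L_vars, of k] by (simp add: mult.assoc)
  also have "\<dots> > 0"
  proof (rule sum_pos)
    show "link \<sigma> \<noteq> {}" using G by blast
    fix F assume F: "F \<in> link \<sigma>"
    have "0 < dg (X (insert F \<sigma>) * L ^ k)"
      by (rule Suc(1)[OF chain_insert[OF Suc(2) F]]) (use card_insert_link[OF Suc(2) F] Suc(3) in simp)
    then show "0 < c F * dg (X (insert F \<sigma>) * L ^ k)" using c(1) F by simp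
  qed simp
  finally show ?case .
qed

text \<open>k is the exponent of L; it is used with card \<sigma> + k + 2 = d, where the link has
  dimension k + 2. Null divisors are described by their pairings because passing to the ideal needs
  duality.\<close>

definition HR :: "'a set set \<Rightarrow> nat \<Rightarrow> bool" where
  "HR \<sigma> k \<longleftrightarrow> (\<forall>u. dg (X \<sigma> * divisor E r u * L ^ Suc k) = 0 \<longrightarrow>
     dg (X \<sigma> * (divisor E r u * divisor E r u) * L ^ k) \<le> 0 \<and>
     (dg (X \<sigma> * (divisor E r u * divisor E r u) * L ^ k) = 0 \<longrightarrow>
       (\<forall>z\<in>homs V (Suc k). dg (X \<sigma> * divisor E r u * z) = 0)))"

lemma HR_D:
  assumes "HR \<sigma> k" "dg (X \<sigma> * divisor E r u * L ^ Suc k) = 0"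
  shows "dg (X \<sigma> * (divisor E r u * divisor E r u) * L ^ k) \<le> 0"
    and "dg (X \<sigma> * (divisor E r u * divisor E r u) * L ^ k) = 0 \<Longrightarrow> z \<in> homs V (Suc k) \<Longrightarrow> dg (X \<sigma> * divisor E r u * z) = 0"
  using assms unfolding HR_def by blast+

text \<open>The reversed Cauchy-Schwarz inequality against L: t is chosen to make u + t a primitive,
  and \<open>HR\<close> for that class is the claim after expanding the square.\<close>

lemma HR_ineq:
  assumes "HR \<sigma> k" "chain \<sigma>" "card \<sigma> + k + 2 = d"
  shows "dg (X \<sigma> * (divisor E r u * divisor E r u) * L ^ k)
    \<le> (dg (X \<sigma> * divisor E r u * L ^ Suc k))\<^sup>2 / dg (X \<sigma> * L ^ Suc (Suc k))"
proof -
  define p where "p = dg (X \<sigma> * L ^ Suc (Suc k))"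
  define b where "b = dg (X \<sigma> * divisor E r u * L ^ Suc k)"
  define A where "A = dg (X \<sigma> * (divisor E r u * divisor E r u) * L ^ k)"
  have p: "0 < p" unfolding p_def using dg_pos[OF assms(2), of "Suc (Suc k)"] assms(3) by simp
  define t where "t = - (b / p)"
  define u' where "u' = (\<lambda>F. u F + t * a F)"
  have u': "divisor E r u' = divisor E r u + const t * L"
    unfolding u'_def divisor_add divisor_scale ..
  have "X \<sigma> * divisor E r u' * L ^ Suc k = X \<sigma> * divisor E r u * L ^ Suc k + const t * (X \<sigma> * L ^ Suc (Suc k))"
    unfolding u' by (simp add: algebra_simps)
  then have "dg (X \<sigma> * divisor E r u' * L ^ Suc k) = b + t * p"
    by (simp only: dg_add dg_scale b_def p_def)
  also have "\<dots> = 0" using p by (simp add: t_def)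
  finally have "dg (X \<sigma> * (divisor E r u' * divisor E r u') * L ^ k) \<le> 0" by (rule HR_D(1)[OF assms(1)])
  moreover have "X \<sigma> * (divisor E r u' * divisor E r u') * L ^ k = X \<sigma> * (divisor E r u * divisor E r u) * L ^ k
    + const (2 * t) * (X \<sigma> * divisor E r u * L ^ Suc k) + const (t * t) * (X \<sigma> * L ^ Suc (Suc k))"
    unfolding u' by (simp add: const_mult const_2 algebra_simps)
  then have "dg (X \<sigma> * (divisor E r u' * divisor E r u') * L ^ k) = A + 2 * t * b + t * t * p"
    by (simp only: dg_add dg_scale A_def b_def p_def)
  ultimately have "A + 2 * t * b + t * t * p \<le> 0" by simp
  moreover have "2 * t * b + t * t * p = - (b\<^sup>2 / p)"
    using p by (simp add: t_def field_simps power2_eq_square)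
  ultimately show ?thesis unfolding A_def[symmetric] b_def[symmetric] p_def[symmetric] by simp
qed

end

section \<open>Hodge-Riemann relations in degree one\<close>

context chow
begin

text \<open>Numerical triviality is local: for every G, even one in the chain,
  \<open>X \<sigma> * var G\<close> is a combination of the \<open>X (insert F \<sigma>)\<close>
  with F in the link.\<close>

lemma dg_link_zero:
  assumes \<sigma>: "chain \<sigma>" and u: "vars_in V y"
    and F: "\<And>F z. F \<in> link \<sigma> \<Longrightarrow> z \<in> homs V k \<Longrightarrow> dg (X (insert F \<sigma>) * y * z) = 0"
    and z: "z \<in> homs V (Suc k)"
  shows "dg (X \<sigma> * y * z) = 0"
  using z
proof (induction z rule: homs_induct)
  case (step c xs q)
  then obtain G ys where xs: "xs = G # ys" "G \<in> V" "set ys \<subseteq> V" "length ys = k" by (cases xs) auto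
  obtain b where b: "X \<sigma> * divisor E r (xi G) - (\<Sum>F\<in>link \<sigma>. const (b F) * X (insert F \<sigma>)) \<in> I"
    using X_divisor_link[OF \<sigma>] by blast
  have ys: "vmon ys \<in> homs V k" using homs_vmon[OF xs(3)] xs(4) by simp
  have "dg (X \<sigma> * divisor E r (xi G) * (y * vmon ys)) = (\<Sum>F\<in>link \<sigma>. b F * dg (X (insert F \<sigma>) * (y * vmon ys)))"
    by (rule dg_expand[OF b]) (intro vars_in_mult u homs_vars[OF ys])
  also have "\<dots> = 0"
    using F[OF _ ys] by (simp add: mult.assoc)
  finally have "dg (X \<sigma> * y * vmon xs) = 0" by (simp add: divisor_xi[OF xs(2)] xs(1) mult_ac)
  then show ?case using step by (simp add: ring_distribs dg_add mult.left_commute[of _ "const c"] dg_scale)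
qed simp

end

section \<open>Induction step and reduction of the two-dimensional case\<close>

context chow_ample
begin

text \<open>One factor L spreads the form of the link over its vertices F with weights c F.
  \<open>HR_ineq\<close> bounds the part at F by the square of row F of q divided by w F, which is
  the hypothesis of \<open>bochner\<close>.\<close>

lemma HR_step:
  assumes \<sigma>: "chain \<sigma>" and card: "card \<sigma> + k + 3 = d"
    and IH: "\<And>F. F \<in> link \<sigma> \<Longrightarrow> HR (insert F \<sigma>) k"
  shows "HR \<sigma> (Suc k)"
  unfolding HR_def
proof (intro allI impI)
  fix u0 assume prim: "dg (X \<sigma> * divisor E r u0 * L ^ Suc (Suc k)) = 0"
  let ?S = "link \<sigma>"
  obtain c where c: "\<And>G. G \<in> ?S \<Longrightarrow> 0 < c G" "X \<sigma> * L - (\<Sum>G\<in>?S. const (c G) * X (insert G \<sigma>)) \<in> I"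
    using ample_link[OF \<sigma>] by blast
  have ch: "chain (insert F \<sigma>)" "card (insert F \<sigma>) + k + 2 = d" if "F \<in> ?S" for F
    using chain_insert[OF \<sigma> that] card_insert_link[OF \<sigma> that] card by auto
  have Xi: "X (insert F \<sigma>) = var F * X \<sigma>" if "F \<in> ?S" for F by (rule X_insert_link[OF \<sigma> that])
  have E1: "dg (X \<sigma> * L * s) = (\<Sum>F\<in>?S. c F * dg (X (insert F \<sigma>) * s))" if "vars_in V s" for s
    by (rule dg_expand[OF c(2) that])
  \<comment> \<open>The coordinate of \<open>var G\<close> is scaled by c G, so that v = 1
    represents L on the link. Hence the row sums of q are the weights w.\<close>
  define U where "U v = (\<lambda>G. if G \<in> ?S then c G * v G else 0)" for v :: "'a set \<Rightarrow> real"
  define Y where "Y v = divisor E r (U v)" for v :: "'a set \<Rightarrow> real"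
  have Y: "Y v = (\<Sum>G\<in>?S. const (c G * v G) * var G)" for v
    unfolding Y_def U_def by (rule divisor_link)
  have Yv: "vars_in V (Y v)" for v unfolding Y_def by (rule divisor_vars)
  define q where "q F G = c F * c G * dg (X \<sigma> * var F * var G * L ^ Suc k)" for F G
  define w where "w F = c F * dg (X (insert F \<sigma>) * L ^ Suc (Suc k))" for F
  have q_row: "(\<Sum>G\<in>?S. q F G * v G) = c F * dg (X (insert F \<sigma>) * Y v * L ^ Suc k)" if F: "F \<in> ?S" for F v
  proof -
    have "X (insert F \<sigma>) * Y v * L ^ Suc k = (\<Sum>G\<in>?S. const (c G * v G) * (X \<sigma> * var F * var G * L ^ Suc k))"
      unfolding Y Xi[OF F] sum_distrib_left sum_distrib_right by (intro sum.cong refl) (simp add: mult_ac)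
    then show ?thesis by (simp only: dg_sum dg_scale q_def sum_distrib_left) (intro sum.cong refl, simp)
  qed
  have q_form: "(\<Sum>F\<in>?S. \<Sum>G\<in>?S. q F G * v F * v G) = dg (X \<sigma> * (Y v * Y v) * L ^ Suc k)" for v
  proof -
    have "X \<sigma> * (Y v * Y v) * L ^ Suc k = (\<Sum>F\<in>?S. const (c F * v F) * (X (insert F \<sigma>) * Y v * L ^ Suc k))"
      unfolding Y[of v] sum_distrib_left sum_distrib_right
      by (subst (2) sum.swap, intro sum.cong refl) (simp add: Xi mult_ac)
    then have "dg (X \<sigma> * (Y v * Y v) * L ^ Suc k) = (\<Sum>F\<in>?S. v F * (\<Sum>G\<in>?S. q F G * v G))"
      by (simp only: dg_sum dg_scale) (intro sum.cong refl, simp add: q_row)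
    then show ?thesis by (simp add: sum_distrib_left mult_ac)
  qed
  have q_sum: "w F = (\<Sum>G\<in>?S. q F G)" if F: "F \<in> ?S" for F
  proof -
    have "dg (X (insert F \<sigma>) * L ^ Suc (Suc k)) = dg (X \<sigma> * L * (var F * L ^ Suc k))"
      using Xi[OF F] by (simp add: mult_ac)
    also have "\<dots> = (\<Sum>G\<in>?S. c G * dg (X (insert G \<sigma>) * (var F * L ^ Suc k)))"
      by (rule E1) (intro vars_in_mult L_vars vars_in_var link_V[OF F])
    finally show ?thesis unfolding w_def q_def sum_distrib_left
      by (simp add: sum_distrib_left) (intro sum.cong refl, simp add: Xi mult_ac)
  qed
  have wpos: "0 < w F" if F: "F \<in> ?S" for F
    unfolding w_def using c(1)[OF F] dg_pos[OF ch(1)[OF F], of "Suc (Suc k)"] ch(2)[OF F] by simp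
  have q_cmp: "0 < q F G" if FG: "F \<in> ?S" "G \<in> ?S" "F \<noteq> G" "cmp F G" for F G
  proof -
    have G: "G \<in> link (insert F \<sigma>)" using FG link_insert_iff[OF link_V[OF FG(1)]] by blast
    have "0 < dg (X (insert G (insert F \<sigma>)) * L ^ Suc k)"
      by (rule dg_pos[OF chain_insert[OF ch(1)[OF FG(1)] G]])
        (use card_insert_link[OF ch(1)[OF FG(1)] G] ch(2)[OF FG(1)] in simp)
    then show ?thesis unfolding q_def using c(1) FG X_insert_link[OF ch(1)[OF FG(1)] G] Xi[OF FG(1)]
      by (simp add: mult_ac)
  qed
  have q_ncmp: "q F G = 0" if FG: "F \<in> ?S" "G \<in> ?S" "\<not> cmp F G" for F G
  proof -
    have "var F * var G \<in> I" using FG link_V incomparable_ideal unfolding cmp_def by blast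
    then have "dg (var F * var G * (X \<sigma> * L ^ Suc k)) = 0"
      by (rule dg_mult_ideal) (intro vars_in_mult X_vars \<sigma> L_vars)
    then show ?thesis unfolding q_def by (simp add: mult_ac)
  qed
  have hyp: "(\<Sum>F\<in>?S. \<Sum>G\<in>?S. q F G * v F * v G) \<le> (\<Sum>F\<in>?S. (\<Sum>G\<in>?S. q F G * v G)\<^sup>2 / w F)" for v
  proof -
    have "dg (X \<sigma> * (Y v * Y v) * L ^ Suc k) = dg (X \<sigma> * L * ((Y v * Y v) * L ^ k))" by (simp add: mult_ac)
    also have "\<dots> = (\<Sum>F\<in>?S. c F * dg (X (insert F \<sigma>) * ((Y v * Y v) * L ^ k)))"
      by (rule E1) (intro vars_in_mult Yv L_vars)
    also have "\<dots> \<le> (\<Sum>F\<in>?S. (\<Sum>G\<in>?S. q F G * v G)\<^sup>2 / w F)"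
    proof (rule sum_mono)
      fix F assume F: "F \<in> ?S"
      let ?p = "dg (X (insert F \<sigma>) * L ^ Suc (Suc k))" and ?b = "dg (X (insert F \<sigma>) * Y v * L ^ Suc k)"
      have "dg (X (insert F \<sigma>) * ((Y v * Y v) * L ^ k)) \<le> ?b\<^sup>2 / ?p"
        using HR_ineq[OF IH[OF F] ch[OF F], of "U v"] unfolding Y_def by (simp add: mult.assoc)
      then have "c F * dg (X (insert F \<sigma>) * ((Y v * Y v) * L ^ k)) \<le> c F * (?b\<^sup>2 / ?p)"
        using c(1)[OF F] by (intro mult_left_mono) auto
      also have "\<dots> = (c F * ?b)\<^sup>2 / (c F * ?p)" using c(1)[OF F] by (simp add: power2_eq_square)
      finally show "c F * dg (X (insert F \<sigma>) * ((Y v * Y v) * L ^ k)) \<le> (\<Sum>G\<in>?S. q F G * v G)\<^sup>2 / w F"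
        unfolding q_row[OF F] w_def .
    qed
    finally show ?thesis unfolding q_form .
  qed
  obtain b where b: "X \<sigma> * divisor E r u0 - X \<sigma> * divisor E r (\<lambda>G. if G \<in> ?S then b G else 0) \<in> I"
    using link_rep[OF \<sigma>] by blast
  define v where "v G = b G / c G" for G
  have "(\<lambda>G. if G \<in> ?S then b G else 0) = U v"
    unfolding U_def v_def using c(1) by (intro ext) (auto simp: less_imp_neq[THEN not_sym])
  then have rep: "X \<sigma> * divisor E r u0 - X \<sigma> * Y v \<in> I" using b by (simp add: Y_def)
  have dgY: "dg (X \<sigma> * divisor E r u0 * s) = dg (X \<sigma> * Y v * s)" if "vars_in V s" for s
    by (rule dg_cong[OF rep that])
  have dgYY: "dg (X \<sigma> * (divisor E r u0 * divisor E r u0) * L ^ Suc k) = dg (X \<sigma> * (Y v * Y v) * L ^ Suc k)"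
    using dgY[of "divisor E r u0 * L ^ Suc k"] dgY[of "Y v * L ^ Suc k"] Yv divisor_vars L_vars
    by (simp add: mult_ac vars_in_mult del: power_Suc)
  have orth: "(\<Sum>F\<in>?S. w F * v F) = 0"
  proof -
    have "X \<sigma> * Y v * L ^ Suc (Suc k) = (\<Sum>F\<in>?S. const (c F * v F) * (X (insert F \<sigma>) * L ^ Suc (Suc k)))"
      unfolding Y sum_distrib_left sum_distrib_right by (intro sum.cong refl) (simp add: Xi mult_ac)
    then have "dg (X \<sigma> * Y v * L ^ Suc (Suc k)) = (\<Sum>F\<in>?S. w F * v F)"
      by (simp only: dg_sum dg_scale w_def) (intro sum.cong refl, simp)
    then show ?thesis using dgY[OF L_vars, of "Suc (Suc k)"] prim by simp
  qed
  have conn: "\<forall>F\<in>?S. \<forall>G\<in>?S. t F = t G"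
    if t: "\<And>F G. F \<in> ?S \<Longrightarrow> G \<in> ?S \<Longrightarrow> q F G \<noteq> 0 \<Longrightarrow> t F = t G" for t :: "'a set \<Rightarrow> real"
  proof (intro ballI)
    fix F G assume FG: "F \<in> ?S" "G \<in> ?S"
    show "t F = t G"
    proof (rule link_connected[OF \<sigma> _ _ FG])
      fix F G assume FG: "F \<in> ?S" "G \<in> ?S" "cmp F G"
      show "t F = t G"
      proof (cases "F = G")
        case False
        then show ?thesis using t[OF FG(1,2)] q_cmp[OF FG(1,2) False FG(3)] by simp
      qed simp
    qed (use card in simp)
  qed
  have off: "0 \<le> q F G" if "F \<in> ?S" "G \<in> ?S" "F \<noteq> G" for F G
    using q_cmp[OF that] q_ncmp[OF that(1,2)] by (cases "cmp F G") auto
  have sym: "q F G = q G F" if "F \<in> ?S" "G \<in> ?S" for F G unfolding q_def by (simp add: mult_ac)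
  have bo1: "(\<Sum>F\<in>?S. \<Sum>G\<in>?S. q F G * v F * v G) \<le> 0"
    by (rule bochner(1)[of ?S q w v]) (fact link_finite sym off q_sum wpos conn hyp orth)+
  have bo2: "(\<Sum>G\<in>?S. q F G * v G) = 0"
    if "(\<Sum>F\<in>?S. \<Sum>G\<in>?S. q F G * v F * v G) = 0" "F \<in> ?S" for F
    by (rule bochner(2)[of ?S q w v]) (fact link_finite sym off q_sum wpos conn hyp orth that)+
  show "dg (X \<sigma> * (divisor E r u0 * divisor E r u0) * L ^ Suc k) \<le> 0 \<and>
     (dg (X \<sigma> * (divisor E r u0 * divisor E r u0) * L ^ Suc k) = 0 \<longrightarrow>
       (\<forall>z\<in>homs V (Suc (Suc k)). dg (X \<sigma> * divisor E r u0 * z) = 0))"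
  proof (intro conjI impI ballI)
    show "dg (X \<sigma> * (divisor E r u0 * divisor E r u0) * L ^ Suc k) \<le> 0"
      using bo1 unfolding q_form dgYY .
  next
    \<comment> \<open>Equality in \<open>bochner\<close> makes Y v primitive at every vertex. The
      local squares are then nonpositive with positively weighted sum 0, so all vanish, and the
      equality case of the induction hypothesis applies at each vertex.\<close>
    fix z assume eq: "dg (X \<sigma> * (divisor E r u0 * divisor E r u0) * L ^ Suc k) = 0" and z: "z \<in> homs V (Suc (Suc k))"
    have primF: "dg (X (insert F \<sigma>) * Y v * L ^ Suc k) = 0" if F: "F \<in> ?S" for F
      using bo2[OF _ F] eq c(1)[OF F] unfolding q_form dgYY q_row[OF F] by simp
    have nonpos: "dg (X (insert F \<sigma>) * (Y v * Y v) * L ^ k) \<le> 0" if F: "F \<in> ?S" for F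
      using HR_D(1)[OF IH[OF F], of "U v"] primF[OF F] unfolding Y_def by blast
    have "(\<Sum>F\<in>?S. c F * dg (X (insert F \<sigma>) * ((Y v * Y v) * L ^ k))) = dg (X \<sigma> * L * ((Y v * Y v) * L ^ k))"
      by (rule E1[symmetric]) (intro vars_in_mult Yv L_vars)
    also have "\<dots> = 0" using eq unfolding dgYY by (simp add: mult_ac)
    finally have sum0: "(\<Sum>F\<in>?S. - (c F * dg (X (insert F \<sigma>) * ((Y v * Y v) * L ^ k)))) = 0"
      by (simp add: sum_negf)
    have zeroF: "dg (X (insert F \<sigma>) * (Y v * Y v) * L ^ k) = 0" if F: "F \<in> ?S" for F
    proof -
      have "\<forall>F\<in>?S. - (c F * dg (X (insert F \<sigma>) * ((Y v * Y v) * L ^ k))) = 0"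
      proof (rule sum_nonneg_eq_0_iff[THEN iffD1, OF link_finite _ sum0])
        fix F assume F: "F \<in> ?S"
        have "c F * dg (X (insert F \<sigma>) * ((Y v * Y v) * L ^ k)) \<le> 0"
          using c(1)[OF F] nonpos[OF F] by (simp add: mult_le_0_iff mult.assoc)
        then show "0 \<le> - (c F * dg (X (insert F \<sigma>) * ((Y v * Y v) * L ^ k)))" by simp
      qed
      then have "c F * dg (X (insert F \<sigma>) * ((Y v * Y v) * L ^ k)) = 0" using F by simp
      then show ?thesis using c(1)[OF F] by (simp add: mult.assoc)
    qed
    have "dg (X \<sigma> * Y v * z) = 0"
    proof (rule dg_link_zero[OF \<sigma> Yv _ z])
      fix F z assume F: "F \<in> ?S" and z: "z \<in> homs V (Suc k)"
      show "dg (X (insert F \<sigma>) * Y v * z) = 0"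
        using HR_D(2)[OF IH[OF F], of "U v"] primF[OF F] zeroF[OF F] z unfolding Y_def by blast
    qed
    then show "dg (X \<sigma> * divisor E r u0 * z) = 0" using dgY[OF homs_vars[OF z]] by simp
  qed
qed

text \<open>A Gram matrix with a single positive square and an ample class of positive degree give
  the situation of \<open>reversed_Cauchy_Schwarz\<close>. In the equality case all coordinates of u
  in this diagonal form vanish, so u pairs to 0 with every variable.\<close>

lemma HR_base:
  assumes \<sigma>: "chain \<sigma>" "card \<sigma> + 2 = d" and T: "finite T" and \<kappa>: "\<kappa> > 0"
    and t: "\<And>F G. F \<in> link \<sigma> \<Longrightarrow> G \<in> link \<sigma> \<Longrightarrow>
      dg (X \<sigma> * var F * var G) = \<kappa> * (s F * s G - (\<Sum>x\<in>T. \<psi> x F * \<psi> x G))"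
  shows "HR \<sigma> 0"
  unfolding HR_def
proof (intro allI impI)
  let ?S = "link \<sigma>"
  define Y where "Y b = (\<Sum>G\<in>?S. const (b G) * var G)" for b
  define s' where "s' b = (\<Sum>G\<in>?S. b G * s G)" for b
  define \<psi>' where "\<psi>' b x = (\<Sum>G\<in>?S. b G * \<psi> x G)" for b x
  have Yv: "vars_in V (Y b)" for b
    unfolding Y_def by (intro vars_in_sum vars_in_mult vars_in_const vars_in_var link_V)
  have form: "dg (X \<sigma> * Y b * Y b') = \<kappa> * (s' b * s' b' - (\<Sum>x\<in>T. \<psi>' b x * \<psi>' b' x))" for b b'
  proof -
    have "X \<sigma> * Y b * Y b' = (\<Sum>F\<in>?S. \<Sum>G\<in>?S. const (b F * b' G) * (X \<sigma> * var F * var G))"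
      unfolding Y_def sum_distrib_left sum_distrib_right
      by (subst sum.swap, intro sum.cong refl) (simp add: const_mult mult_ac)
    then have "dg (X \<sigma> * Y b * Y b') = (\<Sum>F\<in>?S. \<Sum>G\<in>?S. b F * b' G * (\<kappa> * (s F * s G - (\<Sum>x\<in>T. \<psi> x F * \<psi> x G))))"
      by (simp only: dg_sum dg_scale) (intro sum.cong refl, simp add: t)
    also have "\<dots> = \<kappa> * ((\<Sum>F\<in>?S. \<Sum>G\<in>?S. (b F * s F) * (b' G * s G))
        - (\<Sum>F\<in>?S. \<Sum>G\<in>?S. \<Sum>x\<in>T. (b F * \<psi> x F) * (b' G * \<psi> x G)))"
      unfolding sum_subtractf[symmetric] sum_distrib_left
      by (intro sum.cong refl) (simp add: algebra_simps sum_distrib_left)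
    also have "(\<Sum>F\<in>?S. \<Sum>G\<in>?S. (b F * s F) * (b' G * s G)) = s' b * s' b'"
      unfolding s'_def sum_product ..
    also have "(\<Sum>F\<in>?S. \<Sum>G\<in>?S. \<Sum>x\<in>T. (b F * \<psi> x F) * (b' G * \<psi> x G)) = (\<Sum>x\<in>T. \<psi>' b x * \<psi>' b' x)"
    proof -
      have "(\<Sum>F\<in>?S. \<Sum>G\<in>?S. \<Sum>x\<in>T. (b F * \<psi> x F) * (b' G * \<psi> x G)) = (\<Sum>F\<in>?S. \<Sum>x\<in>T. \<Sum>G\<in>?S. (b F * \<psi> x F) * (b' G * \<psi> x G))"
        by (intro sum.cong refl sum.swap)
      also have "\<dots> = (\<Sum>x\<in>T. \<Sum>F\<in>?S. \<Sum>G\<in>?S. (b F * \<psi> x F) * (b' G * \<psi> x G))" by (rule sum.swap)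
      finally show ?thesis unfolding \<psi>'_def sum_product .
    qed
    finally show ?thesis .
  qed
  have rep: "\<exists>b. X \<sigma> * divisor E r u - X \<sigma> * Y b \<in> I" for u
    using link_rep[OF \<sigma>(1), of u] unfolding divisor_link Y_def .
  have pair: "dg (X \<sigma> * divisor E r u * divisor E r u') = dg (X \<sigma> * Y b * Y b')"
    if "X \<sigma> * divisor E r u - X \<sigma> * Y b \<in> I" "X \<sigma> * divisor E r u' - X \<sigma> * Y b' \<in> I" for u u' b b'
    using dg_cong[OF that(1) divisor_vars, of u'] dg_cong[OF that(2) Yv, of b] by (simp add: mult_ac)
  obtain l where l: "X \<sigma> * L - X \<sigma> * Y l \<in> I" using rep by blast
  fix u assume prim: "dg (X \<sigma> * divisor E r u * L ^ Suc 0) = 0"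
  obtain b where b: "X \<sigma> * divisor E r u - X \<sigma> * Y b \<in> I" using rep by blast
  have "0 < dg (X \<sigma> * L ^ 2)" using dg_pos[OF \<sigma>] .
  then have pos: "0 < s' l * s' l - (\<Sum>x\<in>T. \<psi>' l x * \<psi>' l x)"
  proof -
    have "dg (X \<sigma> * L ^ 2) = dg (X \<sigma> * Y l * Y l)"
      using pair[OF l l] by (simp add: power2_eq_square mult.assoc)
    with \<open>0 < dg (X \<sigma> * L ^ 2)\<close> show ?thesis using \<kappa> by (simp add: form zero_less_mult_iff)
  qed
  have orth: "s' b * s' l - (\<Sum>x\<in>T. \<psi>' b x * \<psi>' l x) = 0"
    using prim pair[OF b l] \<kappa> by (simp add: form)
  note rcs = reversed_Cauchy_Schwarz[OF T pos orth]
  have uu: "dg (X \<sigma> * (divisor E r u * divisor E r u) * L ^ 0) = \<kappa> * (s' b * s' b - (\<Sum>x\<in>T. \<psi>' b x * \<psi>' b x))"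
    unfolding form[symmetric] using pair[OF b b] by (simp add: mult.assoc)
  show "dg (X \<sigma> * (divisor E r u * divisor E r u) * L ^ 0) \<le> 0 \<and>
     (dg (X \<sigma> * (divisor E r u * divisor E r u) * L ^ 0) = 0 \<longrightarrow>
       (\<forall>z\<in>homs V (Suc 0). dg (X \<sigma> * divisor E r u * z) = 0))"
    unfolding uu
  proof (intro conjI impI ballI)
    show "\<kappa> * (s' b * s' b - (\<Sum>x\<in>T. \<psi>' b x * \<psi>' b x)) \<le> 0"
      using rcs(1) \<kappa> by (simp add: mult_le_0_iff)
    fix z assume eq: "\<kappa> * (s' b * s' b - (\<Sum>x\<in>T. \<psi>' b x * \<psi>' b x)) = 0" and z: "z \<in> homs V (Suc 0)"
    then have sb: "s' b = 0" "\<forall>x\<in>T. \<psi>' b x = 0" using rcs(2) \<kappa> by auto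
    show "dg (X \<sigma> * divisor E r u * z) = 0"
    proof (rule dg_link_zero[OF \<sigma>(1) divisor_vars _ z])
      fix F z assume F: "F \<in> ?S" and z: "z \<in> homs V 0"
      have FV: "F \<in> V" using link_V[OF F] .
      obtain b' where b': "X \<sigma> * divisor E r (xi F) - X \<sigma> * Y b' \<in> I" using rep by blast
      have 0: "dg (X (insert F \<sigma>) * divisor E r u) = 0"
      proof -
        have "dg (X \<sigma> * divisor E r u * divisor E r (xi F)) = 0"
          unfolding pair[OF b b'] form using sb by simp
        then show ?thesis by (simp add: divisor_xi[OF FV] X_insert_link[OF \<sigma>(1) F] mult_ac)
      qed
      from z show "dg (X (insert F \<sigma>) * divisor E r u * z) = 0"
        by (induction z rule: homs_induct)
          (simp_all add: ring_distribs dg_add mult.left_commute[of _ "const _"] dg_scale 0 mult.commute[of _ "const _"])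
    qed
  qed
qed

end

section \<open>Linear relations within a gap\<close>

context chow
begin

lemma divisor_alpha: "divisor E r (\<lambda>F. if e \<in> F then 1 else 0) = alpha e"
  unfolding divisor_def alpha_def by (subst sum.inter_filter) (auto intro!: sum.cong)

lemma gap_disjoint: "gap \<sigma> j H K \<Longrightarrow> j \<notin> r ` \<sigma> \<Longrightarrow> F \<in> \<sigma> \<Longrightarrow> F \<subseteq> H \<or> K \<subseteq> F"
  unfolding gap_def by (metis image_eqI linorder_neqE_nat)

text \<open>No member of the chain separates e from f, as both lie in K - H. So the linear relation
  for e and f restricts to the link without normalisation.\<close>

lemma gap_relation_ideal:
  assumes \<sigma>: "chain \<sigma>" and g: "gap \<sigma> j H K" and j: "j \<notin> r ` \<sigma>"
    and e: "e \<in> K" "e \<notin> H" and f: "f \<in> K" "f \<notin> H"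
  shows "(\<Sum>G\<in>link \<sigma>. const ((if e \<in> G then 1 else 0) - (if f \<in> G then 1 else 0)) * X (insert G \<sigma>)) \<in> I"
proof -
  let ?u = "\<lambda>G. (if e \<in> G then 1 else 0) - (if f \<in> G then 1 else (0::real))"
  have ef: "e \<in> E" "f \<in> E" using e f flat_subset[OF gap_flats(2)[OF \<sigma> g]] by auto
  have "X \<sigma> * divisor E r ?u - (\<Sum>G\<in>link \<sigma>. const (?u G) * X (insert G \<sigma>)) \<in> I"
  proof (rule X_divisor[OF \<sigma>])
    fix F assume "F \<in> \<sigma>"
    then have "F \<subseteq> H \<or> K \<subseteq> F" by (rule gap_disjoint[OF g j])
    then have "e \<in> F \<longleftrightarrow> f \<in> F" using e f by blast
    then show "?u F = 0" by simp
  qed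
  moreover have "X \<sigma> * divisor E r ?u \<in> I"
    unfolding divisor_diff divisor_alpha by (intro ideal_mult alpha_diff_ideal ef X_vars \<sigma>)
  ultimately show ?thesis using ideal_diff by fastforce
qed

lemma gap_relation:
  assumes \<sigma>: "chain \<sigma>" and g: "gap \<sigma> j H K" and j: "j \<notin> r ` \<sigma>"
    and e: "e \<in> K" "e \<notin> H" and f: "f \<in> K" "f \<notin> H" and y: "vars_in V y"
  shows "(\<Sum>G\<in>link \<sigma>. ((if e \<in> G then 1 else 0) - (if f \<in> G then 1 else 0)) * dg (X (insert G \<sigma>) * y)) = 0"
  using dg_mult_ideal[OF gap_relation_ideal[OF assms(1-7)] y]
  by (simp only: sum_distrib_right mult.assoc dg_sum dg_scale)

lemma card_missing: "chain \<sigma> \<Longrightarrow> card \<sigma> + n = d \<Longrightarrow> card ({1..d} - r ` \<sigma>) = n"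
proof -
  assume \<sigma>: "chain \<sigma>" and n: "card \<sigma> + n = d"
  have "card ({1..d} - r ` \<sigma>) = card {1..d} - card (r ` \<sigma>)"
    by (rule card_Diff_subset) (use chain_finite[OF \<sigma>] chain_ranks[OF \<sigma>] in auto)
  then show ?thesis using chain_card[OF \<sigma>] n by simp
qed

lemma link_rank_missing: "chain \<sigma> \<Longrightarrow> G \<in> link \<sigma> \<Longrightarrow> r G \<in> {1..d} - r ` \<sigma>"
  using link_rank V_rank[OF link_V] by auto

lemma gap_lower_rank:
  assumes \<sigma>: "chain \<sigma>" and g: "gap \<sigma> j H K" and j: "1 \<le> j" "j = 1 \<or> j - 1 \<in> r ` \<sigma>"
  shows "Suc (r H) = j"
proof (cases "j = 1")
  case True
  then show ?thesis using g unfolding gap_def by auto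
next
  case False
  then obtain F where F: "F \<in> \<sigma>" "r F = j - 1" using j by auto
  then have "F \<subseteq> H" using g j False unfolding gap_def by auto
  then have "r F \<le> r H" by (rule rank_mono) (rule flat_subset[OF gap_flats(1)[OF \<sigma> g]])
  then show ?thesis using F gap_flats(4)[OF \<sigma> g] j by linarith
qed

lemma gap_upper_rank:
  assumes \<sigma>: "chain \<sigma>" and g: "gap \<sigma> j H K" and m: "j < m" "m = Suc d \<or> m \<in> r ` \<sigma>"
  shows "r K \<le> m"
proof (cases "m = Suc d")
  case True
  then show ?thesis using rank_mono[OF flat_subset[OF gap_flats(2)[OF \<sigma> g]] order_refl] rank_E by simp
next
  case False
  then obtain F where F: "F \<in> \<sigma>" "r F = m" using m by auto
  then have "K \<subseteq> F" using g m unfolding gap_def by auto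
  then have "r K \<le> r F" by (rule rank_mono) (rule np_subset[OF chain_V[OF \<sigma> F(1)]])
  then show ?thesis using F by simp
qed

lemma link_cover:
  assumes \<sigma>: "chain \<sigma>" and g: "gap \<sigma> j H K" and j: "j \<notin> r ` \<sigma>"
    and M: "is_flat E r M" "H \<subseteq> M" "M \<subseteq> K" "e \<in> K" "e \<notin> M" "Suc (r M) < r K"
  shows "cl E r (insert e M) \<in> link \<sigma>" "r (cl E r (insert e M)) = Suc (r M)" "insert e M \<subseteq> cl E r (insert e M)"
proof -
  have KE: "K \<subseteq> E" using flat_subset[OF gap_flats(2)[OF \<sigma> g]] .
  have eE: "e \<in> E" and ME: "M \<subseteq> E" using KE M by auto
  show rk: "r (cl E r (insert e M)) = Suc (r M)" by (rule rank_cl_insert[OF M(1) eE M(5)])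
  show sub: "insert e M \<subseteq> cl E r (insert e M)" by (rule mem_cl_insert[OF ME eE])
  have "cl E r (insert e M) \<subseteq> K" using M(3,4) by (intro cl_mono_flat[OF gap_flats(2)[OF \<sigma> g]]) blast
  moreover have "cl E r (insert e M) \<noteq> K" using rk M(6) by auto
  ultimately show "cl E r (insert e M) \<in> link \<sigma>"
    using sub M(2,5) eE ME by (intro gap_linkI[OF \<sigma> g j flat_cl]) blast+
qed

lemma dg_two_comparable:
  assumes \<sigma>: "chain \<sigma>" "card \<sigma> + 2 = d" and FG: "F \<in> link \<sigma>" "G \<in> link \<sigma>" "F \<noteq> G" "cmp F G"
  shows "dg (X \<sigma> * var F * var G) = 1"
proof -
  have c: "chain (insert F \<sigma>)" by (rule chain_insert[OF \<sigma>(1) FG(1)])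
  have G: "G \<in> link (insert F \<sigma>)" using FG link_insert_iff[OF link_V[OF FG(1)]] by blast
  have "dg (X (insert G (insert F \<sigma>))) = 1"
    by (rule dg_flag[OF chain_insert[OF c G]])
      (use card_insert_link[OF c G] card_insert_link[OF \<sigma>(1) FG(1)] \<sigma>(2) in simp)
  then show ?thesis by (simp add: X_insert_link[OF c G] X_insert_link[OF \<sigma>(1) FG(1)] mult_ac)
qed

lemma dg_two_incomparable:
  assumes \<sigma>: "chain \<sigma>" and FG: "F \<in> link \<sigma>" "G \<in> link \<sigma>" "\<not> cmp F G"
  shows "dg (X \<sigma> * var F * var G) = 0"
proof -
  have "var F * var G \<in> I" using FG link_V incomparable_ideal unfolding cmp_def by blast
  from dg_mult_ideal[OF this X_vars[OF \<sigma>]] show ?thesis by (simp add: mult_ac)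
qed

lemma dg_two_same_rank:
  assumes \<sigma>: "chain \<sigma>" and FG: "F \<in> link \<sigma>" "G \<in> link \<sigma>" "r F = r G" "F \<noteq> G"
  shows "dg (X \<sigma> * var F * var G) = 0"
  using dg_two_incomparable[OF \<sigma> FG(1,2)] V_rank_eq[OF link_V[OF FG(1)] link_V[OF FG(2)]] FG by blast

lemma gap_relation2:
  assumes \<sigma>: "chain \<sigma>" and g: "gap \<sigma> j H K" and j: "j \<notin> r ` \<sigma>"
    and e: "e \<in> K" "e \<notin> H" and f: "f \<in> K" "f \<notin> H" and F: "F \<in> link \<sigma>"
  shows "(\<Sum>G\<in>link \<sigma>. ((if e \<in> G then 1 else 0) - (if f \<in> G then 1 else 0)) * dg (X \<sigma> * var F * var G)) = 0"
proof -
  have "X (insert G \<sigma>) * var F = X \<sigma> * var F * var G" if "G \<in> link \<sigma>" for G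
    by (simp add: X_insert_link[OF \<sigma> that] mult_ac)
  then show ?thesis using gap_relation[OF assms(1-7) vars_in_var[OF link_V[OF F]]] by simp
qed

end

section \<open>The intersection form of two-dimensional links\<close>

context chow_ample
begin

text \<open>The missing ranks lie in different gaps, so every flat of rank i is below every one of
  rank j. Squares vanish and mixed products are 1, as on a product of two curves: half of a
  difference of two squares, where the sign \<open>?\<psi>\<close> tells the gaps apart.\<close>

lemma HR_two_gaps:
  assumes \<sigma>: "chain \<sigma>" "card \<sigma> + 2 = d" and ij: "{1..d} - r ` \<sigma> = {i, j}" "Suc i < j"
  shows "HR \<sigma> 0"
proof -
  have i: "i \<notin> r ` \<sigma>" "1 \<le> i" "i \<le> d" and j: "j \<notin> r ` \<sigma>" "1 \<le> j" "j \<le> d" using ij(1) by auto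
  obtain H K where g: "gap \<sigma> i H K" using gap_exists[OF \<sigma>(1) i(2,3)] by blast
  obtain H' K' where g': "gap \<sigma> j H' K'" using gap_exists[OF \<sigma>(1) j(2,3)] by blast
  have "Suc i \<in> r ` \<sigma>" using ij j by (metis DiffI Suc_le_mono atLeastAtMost_iff insert_iff le0 le_trans less_imp_le not_less_eq_eq n_not_Suc_n nat_less_le One_nat_def singletonD)
  then have rK: "r K \<le> Suc i" using gap_upper_rank[OF \<sigma>(1) g, of "Suc i"] by blast
  then have "K \<noteq> E" using ij(2) j(3) rank_E by auto
  then have "K \<in> \<sigma>" "r K < j" using g rK ij(2) unfolding gap_def by auto
  then have KH: "K \<subseteq> H'" using g' unfolding gap_def by blast
  have rk: "r F = i \<or> r F = j" if "F \<in> link \<sigma>" for F using link_rank_missing[OF \<sigma>(1) that] ij by auto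
  have lo: "H \<subset> F \<and> F \<subset> K" if "F \<in> link \<sigma>" "r F = i" for F using gap_linkD[OF \<sigma>(1) g that] by blast
  have hi: "H' \<subset> F \<and> F \<subset> K'" if "F \<in> link \<sigma>" "r F = j" for F using gap_linkD[OF \<sigma>(1) g' that] by blast
  have pq: "dg (X \<sigma> * var F * var G) = 1" if "F \<in> link \<sigma>" "G \<in> link \<sigma>" "r F = i" "r G = j" for F G
  proof (rule dg_two_comparable[OF \<sigma> that(1,2)])
    show "F \<noteq> G" using that ij(2) by auto
    show "cmp F G" using lo[of F] hi[of G] that KH unfolding cmp_def by blast
  qed
  have self: "dg (X \<sigma> * var F * var F) = 0" if F: "F \<in> link \<sigma>" for F
  proof -
    have "\<exists>m M N. gap \<sigma> m M N \<and> m \<notin> r ` \<sigma> \<and> M \<subset> F \<and> F \<subset> N \<and>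
       (\<forall>G\<in>link \<sigma>. r G \<noteq> r F \<longrightarrow> G \<subseteq> M \<or> N \<subseteq> G)"
    proof (cases "r F = i")
      case True
      have "K \<subseteq> G" if "G \<in> link \<sigma>" "r G \<noteq> r F" for G using hi[OF that(1)] rk[OF that(1)] that True KH by auto
      then show ?thesis using g i lo[OF F True] by blast
    next
      case False
      then have j': "r F = j" using rk[OF F] by simp
      have "G \<subseteq> H'" if "G \<in> link \<sigma>" "r G \<noteq> r F" for G using lo[OF that(1)] rk[OF that(1)] that j' KH by auto
      then show ?thesis using g' j hi[OF F j'] by blast
    qed
    then obtain m M N where m: "gap \<sigma> m M N" "m \<notin> r ` \<sigma>" "M \<subset> F" "F \<subset> N"
       "\<And>G. G\<in>link \<sigma> \<Longrightarrow> r G \<noteq> r F \<Longrightarrow> G \<subseteq> M \<or> N \<subseteq> G" by blast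
    then obtain e f where ef: "e \<in> F" "e \<notin> M" "f \<in> N" "f \<notin> F" by blast
    have efN: "e \<in> N" "f \<notin> M" using ef m by auto
    \<comment> \<open>e and f separate only flats in the gap of F, and distinct flats of equal rank
      multiply to 0. The relation reduces to the square of F.\<close>
    have "((if e \<in> G then 1 else 0) - (if f \<in> G then 1 else 0)) * dg (X \<sigma> * var F * var G)
        = (if G = F then dg (X \<sigma> * var F * var F) else 0)" if G: "G \<in> link \<sigma>" for G
    proof (cases "G = F")
      case True
      then show ?thesis using ef by simp
    next
      case GF: False
      show ?thesis
      proof (cases "r G = r F")
        case True
        then show ?thesis using dg_two_same_rank[OF \<sigma>(1) F G] GF by simp
      next
        case False
        then have "e \<in> G \<longleftrightarrow> f \<in> G" using m(5)[OF G] ef efN by blast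
        then show ?thesis using GF by simp
      qed
    qed
    then have "(\<Sum>G\<in>link \<sigma>. if G = F then dg (X \<sigma> * var F * var F) else 0) = 0"
      using gap_relation2[OF \<sigma>(1) m(1,2) efN(1) ef(2,3) efN(2) F] by simp
    then show ?thesis using F by (simp add: sum.delta)
  qed
  let ?\<psi> = "\<lambda>(x::unit) F. if r F = i then 1 else (-1::real)"
  show ?thesis
  proof (rule HR_base[OF \<sigma>, of "{()}" "1/2" "\<lambda>_. 1" ?\<psi>])
    fix F G assume FG: "F \<in> link \<sigma>" "G \<in> link \<sigma>"
    have ne: "i \<noteq> j" using ij(2) by simp
    show "dg (X \<sigma> * var F * var G) = 1/2 * (1 * 1 - (\<Sum>x\<in>{()}. ?\<psi> x F * ?\<psi> x G))"
    proof (cases "r F = r G")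
      case True
      then have "dg (X \<sigma> * var F * var G) = 0"
        using self[OF FG(1)] dg_two_same_rank[OF \<sigma>(1) FG] by (cases "F = G") auto
      then show ?thesis using True by simp
    next
      case False
      then consider "r F = i" "r G = j" | "r F = j" "r G = i" using rk FG by metis
      then show ?thesis
      proof cases
        case 1
        then show ?thesis using pq[OF FG] ne by simp
      next
        case 2
        then show ?thesis using pq[OF FG(2,1)] ne by (simp add: mult_ac)
      qed
    qed
  qed auto
qed

text \<open>Between H and K the flats of rank i and i + 1 are the points and lines of a rank 3
  matroid. The relations of the gap give back the form of \<open>D_rank3\<close>: incidence for
  mixed products, square -1 for a line, and 1 minus the number of lines through it for a
  point.\<close>

lemma HR_one_gap:
  assumes \<sigma>: "chain \<sigma>" "card \<sigma> + 2 = d" and i: "{1..d} - r ` \<sigma> = {i, Suc i}"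
  shows "HR \<sigma> 0"
proof -
  have "i \<in> {1..d} - r ` \<sigma>" "Suc i \<in> {1..d} - r ` \<sigma>" unfolding i by simp_all
  then have i1: "i \<notin> r ` \<sigma>" "1 \<le> i" "i \<le> d" and i2: "Suc i \<notin> r ` \<sigma>" "Suc i \<le> d"
    unfolding Diff_iff atLeastAtMost_iff by blast+
  obtain H K where g: "gap \<sigma> i H K" using gap_exists[OF \<sigma>(1) i1(2,3)] by blast
  note gf = gap_flats[OF \<sigma>(1) g]
  have rK: "Suc i < r K"
  proof -
    have "K = E \<or> K \<in> \<sigma>" using g unfolding gap_def by blast
    then have "r K \<noteq> Suc i" using i2 rank_E by (metis Suc_eq_plus1 image_eqI not_less_eq_eq order_refl)
    then show ?thesis using gf(5) by linarith
  qed
  have g2: "gap \<sigma> (Suc i) H K"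
    using g rK i1(1) unfolding gap_def by (metis Suc_lessD image_eqI less_Suc_eq less_SucI)
  have rH: "Suc (r H) = i"
  proof (rule gap_lower_rank[OF \<sigma>(1) g i1(2)])
    show "i = 1 \<or> i - 1 \<in> r ` \<sigma>"
    proof (rule disjCI)
      assume "i - 1 \<notin> r ` \<sigma>"
      moreover have "i - 1 \<notin> {i, Suc i}" using i1(2) by auto
      ultimately have "i - 1 \<notin> {1..d}" unfolding i[symmetric] by blast
      then show "i = 1" using i1(2,3) by auto
    qed
  qed
  have rk: "r F = i \<or> r F = Suc i" if "F \<in> link \<sigma>" for F using link_rank_missing[OF \<sigma>(1) that] i by auto
  have bet: "H \<subset> F \<and> F \<subset> K" if "F \<in> link \<sigma>" for F
    using gap_linkD[OF \<sigma>(1) g that] gap_linkD[OF \<sigma>(1) g2 that] rk[OF that] by blast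
  have fl: "is_flat E r F" "F \<subseteq> E" if "F \<in> link \<sigma>" for F using link_V[OF that] np_flat np_subset by auto
  define Q where "Q = {F \<in> link \<sigma>. r F = Suc i}"
  have finQ: "finite Q" unfolding Q_def by simp
  have cov1: "F = cl E r (insert e H)" if "F \<in> link \<sigma>" "r F = i" "e \<in> F" "e \<notin> H" for F e
    by (rule flat_cover_unique[OF gf(1) fl(1)[OF that(1)]]) (use bet[OF that(1)] rH that in auto)
  have cov2: "G = cl E r (insert f F)" if "F \<in> link \<sigma>" "r F = i" "G \<in> Q" "F \<subseteq> G" "f \<in> G" "f \<notin> F" for F G f
    by (rule flat_cover_unique[OF fl(1)[OF that(1)] fl(1)]) (use that in \<open>auto simp: Q_def\<close>)
  have ex1: "cl E r (insert e H) \<in> link \<sigma>" "r (cl E r (insert e H)) = i" "insert e H \<subseteq> cl E r (insert e H)"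
    if "e \<in> K" "e \<notin> H" for e
    using link_cover[OF \<sigma>(1) g i1(1) gf(1) order_refl gf(3) that] rH rK by auto
  have ex2: "cl E r (insert f F) \<in> Q" "insert f F \<subseteq> cl E r (insert f F)"
    if F: "F \<in> link \<sigma>" "r F = i" and f: "f \<in> K" "f \<notin> F" for F f
    using link_cover[OF \<sigma>(1) g i1(1) fl(1)[OF F(1)] _ _ f] bet[OF F(1)] F rK by (auto simp: Q_def)
  let ?t = "\<lambda>F G. dg (X \<sigma> * var F * var G)"
  have tPQ: "?t F G = (if F \<subseteq> G then 1 else 0)" if "F \<in> link \<sigma>" "r F = i" "G \<in> Q" for F G
  proof -
    have G: "G \<in> link \<sigma>" "r G = Suc i" using that by (auto simp: Q_def)
    have n: "\<not> G \<subseteq> F" using rank_mono[of G F] fl(2)[OF that(1)] that G by auto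
    show ?thesis
    proof (cases "F \<subseteq> G")
      case True
      moreover have "F \<noteq> G" using n by blast
      ultimately show ?thesis using dg_two_comparable[OF \<sigma> that(1) G(1)] by (simp add: cmp_def)
    next
      case False
      then show ?thesis using dg_two_incomparable[OF \<sigma>(1) that(1) G(1)] n by (simp add: cmp_def)
    qed
  qed
  \<comment> \<open>With e in the line F and f outside, only F itself and the point of F through e
    contribute to the relation.\<close>
  have tQQ: "?t F F = -1" if F: "F \<in> Q" for F
  proof -
    have Fl: "F \<in> link \<sigma>" "r F = Suc i" using F by (auto simp: Q_def)
    obtain e f where ef: "e \<in> F" "e \<notin> H" "f \<in> K" "f \<notin> F" using bet[OF Fl(1)] by blast
    have efN: "e \<in> K" "f \<notin> H" using ef bet[OF Fl(1)] by auto
    let ?p = "cl E r (insert e H)"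
    have p: "?p \<subseteq> F" using cl_mono_flat[OF fl(1)[OF Fl(1)], of "insert e H"] ef bet[OF Fl(1)] by auto
    have "((if e \<in> G then 1 else 0) - (if f \<in> G then 1 else 0)) * ?t F G
        = (if G = F then ?t F F else 0) + (if G = ?p then 1 else 0)" if G: "G \<in> link \<sigma>" for G
    proof -
      consider "G = F" | "r G = Suc i" "G \<noteq> F" | "r G = i" "G \<subseteq> F" "e \<in> G" | "r G = i" "G \<subseteq> F" "e \<notin> G" | "r G = i" "\<not> G \<subseteq> F"
        using rk[OF G] by blast
      then show ?thesis
      proof cases
        case 1
        then show ?thesis using ef ex1(2)[OF efN(1) ef(2)] Fl by auto
      next
        case 2
        then show ?thesis using dg_two_same_rank[OF \<sigma>(1) Fl(1) G] Fl ex1(2)[OF efN(1) ef(2)] by auto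
      next
        case 3
        then have "G = ?p" "f \<notin> G" "G \<noteq> F" using cov1[OF G] ef Fl by auto
        moreover have "?t F G = 1" using tPQ[OF G 3(1) F] 3(2) by (simp add: mult_ac)
        ultimately show ?thesis using 3 by simp
      next
        case 4
        then have "f \<notin> G" "G \<noteq> F" "G \<noteq> ?p" using ef Fl ex1(3)[OF efN(1) ef(2)] by auto
        then show ?thesis using 4 by simp
      next
        case 5
        then have "?t F G = 0" using tPQ[OF G 5(1) F] by (simp add: mult_ac)
        moreover have "G \<noteq> F" "G \<noteq> ?p" using 5 p by auto
        ultimately show ?thesis by simp
      qed
    qed
    then have "(\<Sum>G\<in>link \<sigma>. (if G = F then ?t F F else 0) + (if G = ?p then 1 else 0)) = 0"
      using gap_relation2[OF \<sigma>(1) g i1(1) efN(1) ef(2,3) efN(2) Fl(1)] by simp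
    then show ?thesis using Fl(1) ex1(1)[OF efN(1) ef(2)] by (simp add: sum.distrib sum.delta)
  qed
  \<comment> \<open>Two points span exactly one line, so the product 0 of distinct points comes out
    as 1 - 1 in the diagonal form.\<close>
  have uniq: "(\<Sum>x\<in>Q. (if F \<subseteq> x then 1 else 0) * (if F' \<subseteq> x then 1 else 0)) = (1::real)"
    if F: "F \<in> link \<sigma>" "r F = i" and F': "F' \<in> link \<sigma>" "r F' = i" and ne: "F \<noteq> F'" for F F'
  proof -
    have "\<not> F' \<subseteq> F" using V_rank_eq[OF link_V[OF F(1)] link_V[OF F'(1)]] F F' ne unfolding cmp_def by auto
    then obtain f where f: "f \<in> F'" "f \<notin> F" by blast
    have fK: "f \<in> K" "f \<notin> H" using f bet[OF F(1)] bet[OF F'(1)] by auto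
    let ?q = "cl E r (insert f F)"
    note q = ex2[OF F fK(1) f(2)]
    have F'q: "F' \<subseteq> ?q"
    proof -
      have "F' = cl E r (insert f H)" by (rule cov1[OF F' f(1) fK(2)])
      also have "\<dots> \<subseteq> ?q"
        by (rule cl_mono_flat) (use q bet[OF F(1)] fl in \<open>auto simp: Q_def\<close>)
      finally show ?thesis .
    qed
    have "(if F \<subseteq> x then 1 else 0) * (if F' \<subseteq> x then 1 else 0) = (if x = ?q then 1 else (0::real))" if x: "x \<in> Q" for x
    proof (cases "F \<subseteq> x \<and> F' \<subseteq> x")
      case True
      then have "x = ?q" using cov2[OF F x] f by blast
      then show ?thesis using True by simp
    next
      case False
      then have "x \<noteq> ?q" using F'q q(2) by blast
      then show ?thesis using False by auto
    qed
    then show ?thesis using q(1) finQ by (simp add: sum.delta)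
  qed
  \<comment> \<open>With e in the point F and f outside, every line through F counts 1, except the
    line spanned by F and f, where the two terms of the relation cancel.\<close>
  have tPP: "?t F F = 1 - (\<Sum>x\<in>Q. (if F \<subseteq> x then 1 else 0))" if F: "F \<in> link \<sigma>" "r F = i" for F
  proof -
    obtain e f where ef: "e \<in> F" "e \<notin> H" "f \<in> K" "f \<notin> F" using bet[OF F(1)] by blast
    have efN: "e \<in> K" "f \<notin> H" using ef bet[OF F(1)] by auto
    let ?q = "cl E r (insert f F)"
    note q = ex2[OF F ef(3,4)]
    have ql: "?q \<in> link \<sigma>" "r ?q = Suc i" using q by (auto simp: Q_def)
    have "((if e \<in> G then 1 else 0) - (if f \<in> G then 1 else 0)) * ?t F G
        = (if G = F then ?t F F else 0) + (if r G = Suc i then if F \<subseteq> G then 1 else 0 else 0) - (if G = ?q then 1 else 0)"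
      if G: "G \<in> link \<sigma>" for G
    proof -
      consider "G = F" | "r G = i" "G \<noteq> F" | "r G = Suc i" "F \<subseteq> G" | "r G = Suc i" "\<not> F \<subseteq> G"
        using rk[OF G] by blast
      then show ?thesis
      proof cases
        case 1
        then show ?thesis using ef F ql(2) by auto
      next
        case 2
        then show ?thesis using dg_two_same_rank[OF \<sigma>(1) F(1) G] F ql(2) by auto
      next
        case 3
        then have GQ: "G \<in> Q" using G by (simp add: Q_def)
        have "f \<in> G \<longleftrightarrow> G = ?q" using cov2[OF F GQ 3(2) _ ef(4)] q(2) by blast
        then show ?thesis using tPQ[OF F GQ] 3 ef F by auto
      next
        case 4
        then have GQ: "G \<in> Q" using G by (simp add: Q_def)
        have "G \<noteq> ?q" using 4 q(2) by blast
        then show ?thesis using tPQ[OF F GQ] 4 F by auto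
      qed
    qed
    then have "(\<Sum>G\<in>link \<sigma>. (if G = F then ?t F F else 0) + (if r G = Suc i then if F \<subseteq> G then 1 else 0 else 0) - (if G = ?q then 1 else 0)) = 0"
      using gap_relation2[OF \<sigma>(1) g i1(1) efN(1) ef(2,3) efN(2) F(1)] by simp
    moreover have "(\<Sum>G\<in>link \<sigma>. if r G = Suc i then if F \<subseteq> G then 1 else 0 else 0) = (\<Sum>x\<in>Q. (if F \<subseteq> x then 1 else (0::real)))"
      unfolding Q_def by (rule sum.inter_filter[symmetric]) simp
    ultimately show ?thesis using F(1) ql(1) by (simp add: sum.distrib sum_subtractf sum.delta)
  qed
  \<comment> \<open>The positive square is that of the sum of the point coefficients; each line x
    gives the negative square of its own coefficient minus those of the points on it.\<close>
  let ?s = "\<lambda>F. if r F = i then 1 else (0::real)"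
  let ?\<psi> = "\<lambda>x F. if r F = i then - (if F \<subseteq> x then 1 else 0) else if F = x then 1 else (0::real)"
  show ?thesis
  proof (rule HR_base[OF \<sigma> finQ, of 1 ?s ?\<psi>])
    fix F G assume F: "F \<in> link \<sigma>" and G: "G \<in> link \<sigma>"
    consider "r F = i" "r G = i" "F = G" | "r F = i" "r G = i" "F \<noteq> G" | "r F = i" "G \<in> Q" "r G \<noteq> i"
      | "F \<in> Q" "r G = i" "r F \<noteq> i" | "F \<in> Q" "G \<in> Q" "r F \<noteq> i" "r G \<noteq> i"
      using rk[OF F] rk[OF G] F G by (fastforce simp: Q_def)
    then show "?t F G = 1 * (?s F * ?s G - (\<Sum>x\<in>Q. ?\<psi> x F * ?\<psi> x G))"
    proof cases
      case 1
      have "(\<Sum>x\<in>Q. ?\<psi> x F * ?\<psi> x G) = (\<Sum>x\<in>Q. (if F \<subseteq> x then 1 else 0))"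
        by (intro sum.cong refl) (use 1 in auto)
      then show ?thesis using tPP[OF F 1(1)] 1 by simp
    next
      case 2
      have "(\<Sum>x\<in>Q. ?\<psi> x F * ?\<psi> x G) = (\<Sum>x\<in>Q. (if F \<subseteq> x then 1 else 0) * (if G \<subseteq> x then 1 else 0))"
        by (intro sum.cong refl) (use 2 in auto)
      then show ?thesis using dg_two_same_rank[OF \<sigma>(1) F G] uniq[OF F 2(1) G 2(2,3)] 2 by simp
    next
      case 3
      have "(\<Sum>x\<in>Q. ?\<psi> x F * ?\<psi> x G) = (\<Sum>x\<in>Q. if x = G then - (if F \<subseteq> G then 1 else 0) else 0)"
        by (intro sum.cong refl) (use 3 in auto)
      then show ?thesis using tPQ[OF F 3(1,2)] 3 finQ by (simp add: sum.delta)
    next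
      case 4
      have "(\<Sum>x\<in>Q. ?\<psi> x F * ?\<psi> x G) = (\<Sum>x\<in>Q. if x = F then - (if G \<subseteq> F then 1 else 0) else 0)"
        by (intro sum.cong refl) (use 4 in auto)
      then show ?thesis using tPQ[OF G 4(2,1)] 4 finQ by (simp add: sum.delta mult_ac)
    next
      case 5
      have "(\<Sum>x\<in>Q. ?\<psi> x F * ?\<psi> x G) = (\<Sum>x\<in>Q. if x = F then (if F = G then 1 else 0) else 0)"
        by (intro sum.cong refl) (use 5 in auto)
      also have "\<dots> = (if F = G then 1 else 0)" using 5 finQ by (simp add: sum.delta)
      finally show ?thesis
        using 5 tQQ[OF 5(1)] dg_two_same_rank[OF \<sigma>(1) F G] by (cases "F = G") (auto simp: Q_def)
    qed
  qed simp
qed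

lemma HR_all: "chain \<sigma> \<Longrightarrow> card \<sigma> + k + 2 = d \<Longrightarrow> HR \<sigma> k"
proof (induction k arbitrary: \<sigma>)
  case 0
  have "card ({1..d} - r ` \<sigma>) = 2" using card_missing[OF 0(1), of 2] 0(2) by simp
  then obtain i j where "{1..d} - r ` \<sigma> = {i, j}" "i \<noteq> j" by (auto simp: card_2_iff)
  then obtain i j where ij: "{1..d} - r ` \<sigma> = {i, j}" "i < j" by (metis insert_commute linorder_neqE_nat)
  show ?case
  proof (cases "j = Suc i")
    case True
    then show ?thesis using HR_one_gap[OF 0(1)] ij 0(2) by simp
  next
    case False
    then show ?thesis using HR_two_gaps[OF 0(1) _ ij(1)] ij(2) 0(2) by simp
  qed
next
  case (Suc k)
  show ?case
  proof (rule HR_step[OF Suc(2)])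
    show "card \<sigma> + k + 3 = d" using Suc(3) by simp
    fix F assume F: "F \<in> link \<sigma>"
    show "HR (insert F \<sigma>) k"
      by (rule Suc(1)[OF chain_insert[OF Suc(2) F]]) (use card_insert_link[OF Suc(2) F] Suc(3) in simp)
  qed
qed

end

section \<open>Poincare duality\<close>

context chow
begin

text \<open>For m = 0 these are the maximal chains.\<close>
definition missing :: "nat \<Rightarrow> 'a set set set" where
  "missing m = {\<tau>. chain \<tau> \<and> r ` \<tau> = {1..d} - {m}}"

lemma missing_chain: "\<tau> \<in> missing m \<Longrightarrow> chain \<tau>"
  and missing_ranks: "\<tau> \<in> missing m \<Longrightarrow> r ` \<tau> = {1..d} - {m}"
  by (simp_all add: missing_def)

lemma finite_missing [simp]: "finite (missing m)"
  by (rule finite_subset[of _ "Pow V"]) (auto simp: missing_def dest: chain_V)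

lemma missing_gap:
  assumes \<tau>: "\<tau> \<in> missing m" and m: "1 \<le> m" "m \<le> d" and g: "gap \<tau> m H K"
  shows "Suc (r H) = m" "r K = Suc m"
proof -
  have c: "chain \<tau>" by (rule missing_chain[OF \<tau>])
  show "Suc (r H) = m"
    by (rule gap_lower_rank[OF c g m(1)]) (use m missing_ranks[OF \<tau>] in auto)
  have "r K \<le> Suc m"
    by (rule gap_upper_rank[OF c g]) (use m missing_ranks[OF \<tau>] in auto)
  then show "r K = Suc m" using gap_flats(5)[OF c g] by simp
qed

lemma missing_link_rank:
  assumes "\<tau> \<in> missing m" "G \<in> link \<tau>"
  shows "r G = m"
  using link_rank_missing[OF missing_chain[OF assms(1)] assms(2)] missing_ranks[OF assms(1)] by auto

text \<open>The flats strictly between H and K partition K - H.\<close>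
lemma missing_partition:
  fixes w :: "'a \<Rightarrow> real"
  assumes \<tau>: "\<tau> \<in> missing m" and m: "1 \<le> m" "m \<le> d" and g: "gap \<tau> m H K"
  shows "(\<Sum>G\<in>link \<tau>. sum w G - sum w H) = sum w K - sum w H"
proof -
  have c: "chain \<tau>" by (rule missing_chain[OF \<tau>])
  have mr: "m \<notin> r ` \<tau>" using missing_ranks[OF \<tau>] by simp
  note gf = gap_flats[OF c g] and rk = missing_gap[OF assms]
  have bet: "H \<subset> G" "G \<subset> K" if "G \<in> link \<tau>" for G
    using gap_linkD[OF c g that missing_link_rank[OF \<tau> that]] by auto
  have fin: "finite K" "finite H" using gf flat_finite by auto
  have finG: "finite G" if "G \<in> link \<tau>" for G using bet(2)[OF that] fin finite_subset by blast
  have cov: "G = cl E r (insert e H)" if "G \<in> link \<tau>" "e \<in> G" "e \<notin> H" for G e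
    by (rule flat_cover_unique[OF gf(1) np_flat[OF link_V[OF that(1)]]])
      (use bet[OF that(1)] rk missing_link_rank[OF \<tau> that(1)] that in auto)
  have un: "(\<Union>G\<in>link \<tau>. G - H) = K - H"
  proof (intro equalityI subsetI)
    fix e assume "e \<in> (\<Union>G\<in>link \<tau>. G - H)"
    then show "e \<in> K - H" using bet by blast
  next
    fix e assume e: "e \<in> K - H"
    then have "cl E r (insert e H) \<in> link \<tau>" "insert e H \<subseteq> cl E r (insert e H)"
      using link_cover[OF c g mr gf(1) order_refl gf(3), of e] rk by auto
    then show "e \<in> (\<Union>G\<in>link \<tau>. G - H)" using e by blast
  qed
  have "(\<Sum>G\<in>link \<tau>. sum w G - sum w H) = (\<Sum>G\<in>link \<tau>. sum w (G - H))"
    by (intro sum.cong refl sum_diff[symmetric] finG) (use bet in auto)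
  also have "\<dots> = sum w (\<Union>G\<in>link \<tau>. G - H)"
  proof (rule sum.UNION_disjoint[symmetric])
    show "\<forall>G\<in>link \<tau>. \<forall>G'\<in>link \<tau>. G \<noteq> G' \<longrightarrow> (G - H) \<inter> (G' - H) = {}" using cov by blast
  qed (use finG in auto)
  also have "\<dots> = sum w K - sum w H" unfolding un by (rule sum_diff[OF fin(1) gf(3)])
  finally show ?thesis .
qed

text \<open>After subtracting a modular function that agrees with u on the chain, only the link
  contributes, each vertex completing a flag of degree 1. The partition of K - H evaluates the
  modular part. The values 0 at the empty set and E cover a gap that starts or ends there.\<close>

lemma dg_missing:
  assumes \<tau>: "\<tau> \<in> missing m" and m: "1 \<le> m" "m \<le> d" and g: "gap \<tau> m H K"
    and u: "u {} = 0" "u E = 0"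
  shows "dg (X \<tau> * divisor E r u) = (\<Sum>G\<in>link \<tau>. u G - u H) - (u K - u H)"
proof -
  have c: "chain \<tau>" by (rule missing_chain[OF \<tau>])
  have "insert E \<tau> \<subseteq> Pow E" using chain_V[OF c] np_subset by blast
  then obtain w where w: "\<And>A. A \<in> insert E \<tau> \<Longrightarrow> sum w A = u A"
    using modular_interpolation[OF finite_E _ chain_E_comp[OF c], where a = u] u(1) by metis
  have HK: "sum w H = u H" "sum w K = u K" using g w u(1) unfolding gap_def by auto
  define v where "v F = u F - sum w F" for F
  have "X \<tau> * divisor E r v - (\<Sum>G\<in>link \<tau>. const (v G) * X (insert G \<tau>)) \<in> I"
    by (rule X_divisor[OF c]) (simp add: v_def w)
  then have "dg (X \<tau> * divisor E r v * 1) = (\<Sum>G\<in>link \<tau>. v G * dg (X (insert G \<tau>) * 1))"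
    by (rule dg_expand) simp
  also have "\<dots> = (\<Sum>G\<in>link \<tau>. v G)"
  proof (intro sum.cong refl)
    fix G assume G: "G \<in> link \<tau>"
    have "card \<tau> = d - 1" using chain_card[OF c] missing_ranks[OF \<tau>] m by simp
    then have "dg (X (insert G \<tau>)) = 1"
      by (intro dg_flag[OF chain_insert[OF c G]]) (use card_insert_link[OF c G] m in simp)
    then show "v G * dg (X (insert G \<tau>) * 1) = v G" by simp
  qed
  also have "\<dots> = (\<Sum>G\<in>link \<tau>. u G - u H) - (\<Sum>G\<in>link \<tau>. sum w G - sum w H)"
    unfolding v_def sum_subtractf[symmetric] by (intro sum.cong refl) (simp add: HK)
  also have "\<dots> = (\<Sum>G\<in>link \<tau>. u G - u H) - (u K - u H)"
    using missing_partition[OF assms(1-4), of w] HK by simp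
  finally have "dg (X \<tau> * divisor E r v) = (\<Sum>G\<in>link \<tau>. u G - u H) - (u K - u H)" by simp
  moreover have "dg (X \<tau> * divisor E r (\<lambda>F. sum w F)) = 0"
    by (intro dg_ideal ideal_mult modular_divisor_ideal X_vars c) (simp add: w u)
  moreover have "divisor E r v = divisor E r u - divisor E r (\<lambda>F. sum w F)" unfolding v_def by (rule divisor_diff)
  ultimately show ?thesis by (simp add: right_diff_distrib dg_diff)
qed

lemma missing_through:
  assumes F: "is_flat E r F" "r F = Suc k" "1 \<le> k" and H: "is_flat E r H" "H \<subseteq> F" "Suc (r H) = k"
  shows "\<exists>\<tau>\<in>missing k. gap \<tau> k H F"
proof -
  have FE: "F \<subseteq> E" "H \<subseteq> E" using F H flat_subset by auto
  have kd: "k \<le> d" using rank_mono[OF FE(1) order_refl] F rank_E by simp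
  let ?\<sigma> = "{H, F} \<inter> V"
  have \<sigma>: "chain ?\<sigma>" unfolding chain_def cmp_def using H(2) by blast
  have "r ` ?\<sigma> \<subseteq> {1..d} - {k}" using V_rank F H by fastforce
  from extend_chain[OF \<sigma> this] obtain \<tau> where \<tau>: "chain \<tau>" "?\<sigma> \<subseteq> \<tau>" "r ` \<tau> = {1..d} - {k}" by blast
  have HV: "H = {} \<or> H \<in> \<tau>"
  proof (cases "H = {}")
    case False
    then have "H \<in> V" using VI[OF H(1)] rank_pos[OF FE(2)] H(3) kd by simp
    then show ?thesis using \<tau>(2) by blast
  qed simp
  have FV: "F = E \<or> F \<in> \<tau>"
  proof (cases "F = E")
    case False
    then have "r F < r E" using flat_rank_less[OF F(1) order_refl] FE by auto
    then have "F \<in> V" using VI[OF F(1)] F rank_E by simp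
    then show ?thesis using \<tau>(2) by blast
  qed simp
  have "A \<subseteq> H" if A: "A \<in> \<tau>" "r A < k" for A
  proof (cases "H = {}")
    case True
    then show ?thesis using A H(3) V_rank[OF chain_V[OF \<tau>(1) A(1)]] by simp
  next
    case False
    then show ?thesis using HV chain_rank_le[OF \<tau>(1) A(1), of H] A H(3) by auto
  qed
  moreover have "F \<subseteq> A" if A: "A \<in> \<tau>" "k < r A" for A
  proof (cases "F = E")
    case True
    then show ?thesis using A F rank_E V_rank[OF chain_V[OF \<tau>(1) A(1)]] by simp
  next
    case False
    then show ?thesis using FV chain_rank_le[OF \<tau>(1) _ A(1), of F] A F(2) by auto
  qed
  ultimately have "gap \<tau> k H F" unfolding gap_def using HV FV F H by auto
  then show ?thesis using \<tau> by (auto simp: missing_def)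
qed

text \<open>Pairing with a chain that misses rank k expresses the value at the upper end F of its
  gap by values at smaller ranks. Modular functions obey the same recursion by
  \<open>missing_partition\<close>, so u is modular as soon as it is matched at the points.\<close>

lemma poincare_duality_1:
  assumes triv: "\<And>m \<tau>. 1 \<le> m \<Longrightarrow> m \<le> d \<Longrightarrow> \<tau> \<in> missing m \<Longrightarrow> dg (X \<tau> * divisor E r u) = 0"
  shows "divisor E r u \<in> I"
proof -
  define v where "v A = (if A = {} \<or> A = E then 0 else u A)" for A
  have v0: "v {} = 0" "v E = 0" by (simp_all add: v_def)
  have dv: "divisor E r u = divisor E r v"
    by (rule divisor_cong) (use empty_notin_V E_notin_V in \<open>auto simp: v_def\<close>)
  \<comment> \<open>Each point value is spread evenly over the parallel class of the point, which
    makes w correct in rank 1.\<close>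
  define w where "w e = v (cl E r {e}) / card (cl E r {e})" for e
  have modular: "v F = sum w F" if "is_flat E r F" for F
    using that
  proof (induction "r F" arbitrary: F rule: less_induct)
    case less
    have FE: "F \<subseteq> E" using less(2) flat_subset by blast
    consider "r F = 0" | "r F = 1" | k where "r F = Suc k" "1 \<le> k"
      by (metis One_nat_def Suc_le_eq not0_implies_Suc not_gr_zero)
    then show ?case
    proof cases
      case 1
      then have "F = {}" using rank_pos[OF FE] by auto
      then show ?thesis using v0 by simp
    next
      case 2
      have "cl E r {e} = F" if "e \<in> F" for e
        by (rule cl_eq_flat[OF less(2)]) (use that FE rank_singleton 2 in auto)
      then have "sum w F = (\<Sum>e\<in>F. v F / card F)" by (intro sum.cong refl) (simp add: w_def)
      moreover have "card F \<noteq> 0" using 2 flat_finite[OF less(2)] by auto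
      ultimately show ?thesis by simp
    next
      case 3
      obtain H where H: "is_flat E r H" "H \<subseteq> F" "r H = k - 1"
      proof -
        have "\<exists>G. is_flat E r G \<and> {} \<subseteq> G \<and> G \<subseteq> F \<and> r G = k - 1"
          by (rule flat_between[OF flat_empty less(2)]) (use 3 in simp_all)
        then show ?thesis using that by blast
      qed
      then obtain \<tau> where \<tau>: "\<tau> \<in> missing k" "gap \<tau> k H F"
        using missing_through[OF less(2) 3 H(1,2)] 3 by auto
      have kd: "k \<le> d" using rank_mono[OF FE order_refl] 3 rank_E by simp
      have "(\<Sum>G\<in>link \<tau>. v G - v H) - (v F - v H) = 0"
        using triv[OF 3(2) kd \<tau>(1)] dg_missing[OF \<tau>(1) 3(2) kd \<tau>(2) v0] unfolding dv by simp
      moreover have "v H = sum w H" using less(1)[of H] H 3 by simp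
      moreover have "v G = sum w G" if "G \<in> link \<tau>" for G
        using less(1)[of G] missing_link_rank[OF \<tau>(1) that] np_flat[OF link_V[OF that]] 3 by simp
      ultimately have "(\<Sum>G\<in>link \<tau>. sum w G - sum w H) - (v F - sum w H) = 0" by simp
      then show ?thesis using missing_partition[OF \<tau>(1) 3(2) kd \<tau>(2), of w] by simp
    qed
  qed
  have "divisor E r v = divisor E r (\<lambda>F. sum w F)"
    by (rule divisor_cong) (use modular np_flat in auto)
  moreover have "sum w E = 0" using modular[OF flat_E] v0 by simp
  ultimately show ?thesis unfolding dv using modular_divisor_ideal[of w] by simp
qed

text \<open>Among chains whose missing rank is below r F, the variable of F detects those whose gap
  ends at F. These are the test classes of \<open>level_step\<close>.\<close>

lemma dg_missing_top:
  assumes \<tau>: "\<tau> \<in> missing m" and m: "1 \<le> m" "m \<le> d" and g: "gap \<tau> m H K" and F: "F \<in> V" "m < r F"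
  shows "dg (X \<tau> * var F) = (if F = K then -1 else 0)"
proof -
  have u: "xi F {} = 0" "xi F E = 0" using F empty_notin_V E_notin_V by auto
  have "G \<noteq> F" if "G \<in> link \<tau>" for G using missing_link_rank[OF \<tau> that] F by auto
  moreover have "H \<noteq> F" using gap_flats(4)[OF missing_chain[OF \<tau>] g] F by auto
  ultimately have "(\<Sum>G\<in>link \<tau>. xi F G - xi F H) - (xi F K - xi F H) = (if F = K then -1 else 0)"
    by (simp add: eq_commute)
  then show ?thesis using dg_missing[OF assms(1-4), of "xi F", OF u] divisor_xi[OF F(1)] by simp
qed

text \<open>A gap ending at E has no variable to test it. The class of \<open>alpha i\<close> takes
  this role; as it does not depend on i, the element can be chosen inside the gap if K = E and
  outside K otherwise.\<close>

lemma dg_missing_alpha: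
  assumes \<tau>: "\<tau> \<in> missing m" and m: "1 \<le> m" "m \<le> d" and g: "gap \<tau> m H K" and i: "i \<in> E"
  shows "dg (X \<tau> * alpha i) = (if m = d then 1 else 0)"
proof -
  have c: "chain \<tau>" by (rule missing_chain[OF \<tau>])
  have mr: "m \<notin> r ` \<tau>" using missing_ranks[OF \<tau>] by simp
  note gf = gap_flats[OF c g] and rk = missing_gap[OF assms(1-4)]
  have indep: "dg (X \<tau> * alpha i) = dg (X \<tau> * alpha e)" if "e \<in> E" for e
    using dg_ideal[OF ideal_mult[OF alpha_diff_ideal[OF i that] X_vars[OF c]]]
    by (simp add: right_diff_distrib dg_diff)
  \<comment> \<open>The value at E is reset to 0 for \<open>dg_missing\<close>; E is not a variable,
    so the divisor stays the same.\<close>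
  have al: "alpha e = divisor E r (\<lambda>F. if F = E then 0 else if e \<in> F then 1 else 0)" for e
    unfolding divisor_alpha[symmetric] by (rule divisor_cong) (use E_notin_V in auto)
  have val: "dg (X \<tau> * alpha e) = (\<Sum>G\<in>link \<tau>. (if e \<in> G then 1 else 0) - (if e \<in> H then 1 else 0))
      - ((if K = E then 0 else if e \<in> K then 1 else 0) - (if e \<in> H then 1 else 0))" for e
  proof -
    let ?u = "\<lambda>F. if F = E then 0 else if e \<in> F then 1 else (0::real)"
    have "G \<noteq> E" if "G \<in> link \<tau>" for G using link_V[OF that] E_notin_V by auto
    moreover have "H \<noteq> E" using gf rk m rank_E by auto
    ultimately show ?thesis unfolding al using dg_missing[OF assms(1-4), of ?u] by simp
  qed
  show ?thesis
  proof (cases "m = d")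
    case True
    then have "K = E" using flat_eqI[OF gf(2) order_refl flat_subset[OF gf(2)]] rk rank_E by simp
    have "H \<noteq> K" using rk by auto
    then obtain e where e: "e \<in> K" "e \<notin> H" using gf(3) by blast
    have C: "cl E r (insert e H) \<in> link \<tau>" "e \<in> cl E r (insert e H)"
      using link_cover[OF c g mr gf(1) order_refl gf(3) e] rk by auto
    have "e \<in> G \<longleftrightarrow> G = cl E r (insert e H)" if "G \<in> link \<tau>" for G
      using flat_cover_unique[OF gf(1) np_flat[OF link_V[OF that]], of e] C(2)
        gap_linkD[OF c g that missing_link_rank[OF \<tau> that]] rk missing_link_rank[OF \<tau> that] e by auto
    then have "(\<Sum>G\<in>link \<tau>. (if e \<in> G then 1 else 0)) = (\<Sum>G\<in>link \<tau>. if G = cl E r (insert e H) then 1 else (0::real))"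
      by (intro sum.cong refl) simp
    also have "\<dots> = 1" using C by (simp add: sum.delta)
    finally show ?thesis using indep[of e] val[of e] e \<open>K = E\<close> True by simp
  next
    case False
    then have "K \<noteq> E" using rk rank_E m by auto
    then obtain e where e: "e \<in> E" "e \<notin> K" using flat_subset[OF gf(2)] by blast
    have "e \<notin> G" if "G \<in> link \<tau>" for G using gap_linkD[OF c g that missing_link_rank[OF \<tau> that]] e by auto
    moreover have "e \<notin> H" using gf e by auto
    ultimately show ?thesis using indep[OF e(1)] val[of e] e False by simp
  qed
qed

text \<open>Two chains through \<sigma> that first differ at rank i, in p and p', are both joined to chains
  through the join of p and p', where p can be exchanged for p'.\<close>
lemma flags_connected:
  fixes R :: "'a set set \<Rightarrow> 'a set set \<Rightarrow> bool"
  assumes refl: "\<And>\<tau>. R \<tau> \<tau>" and trans: "\<And>\<tau>1 \<tau>2 \<tau>3. R \<tau>1 \<tau>2 \<Longrightarrow> R \<tau>2 \<tau>3 \<Longrightarrow> R \<tau>1 \<tau>3"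
    and exch: "\<And>\<rho> G G'. insert G \<rho> \<in> missing m \<Longrightarrow> insert G' \<rho> \<in> missing m \<Longrightarrow> G \<notin> \<rho> \<Longrightarrow> G' \<notin> \<rho> \<Longrightarrow>
      r G = r G' \<Longrightarrow> G \<noteq> G' \<Longrightarrow> m = 0 \<or> r G \<noteq> Suc m \<Longrightarrow> R (insert G \<rho>) (insert G' \<rho>)"
    and "\<tau> \<in> missing m" "\<tau>' \<in> missing m" "\<sigma> \<subseteq> \<tau>" "\<sigma> \<subseteq> \<tau>'" "m = 0 \<or> d \<le> m \<or> Suc m \<in> r ` \<sigma>"
  shows "R \<tau> \<tau>'"
  using assms(4-8)
proof (induction "card ({1..d} - {m} - r ` \<sigma>)" arbitrary: \<sigma> \<tau> \<tau>' rule: less_induct)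
  case less
  let ?J = "{1..d} - {m}"
  have c: "chain \<tau>" "chain \<tau>'" "chain \<sigma>"
    using missing_chain less(2,3) chain_mono[OF missing_chain[OF less(2)] less(4)] by auto
  show ?case
  proof (cases "?J - r ` \<sigma> = {}")
    case True
    have eq: "\<tau>2 = \<sigma>" if t: "\<tau>2 \<in> missing m" "\<sigma> \<subseteq> \<tau>2" for \<tau>2
    proof -
      have "F \<in> \<sigma>" if F: "F \<in> \<tau>2" for F
      proof -
        have "r F \<in> ?J" using F missing_ranks[OF t(1)] by blast
        then obtain F' where F': "F' \<in> \<sigma>" "r F = r F'" using True by blast
        then have "F = F'" using inj_onD[OF chain_rank_inj[OF missing_chain[OF t(1)]] F'(2) F] t(2) by blast
        then show ?thesis using F' by simp
      qed
      then show ?thesis using t(2) by blast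
    qed
    show ?thesis using eq[OF less(2,4)] eq[OF less(3,5)] refl by simp
  next
    case False
    \<comment> \<open>The lowest rank still to be filled. With the condition on m, rank i - 1 is
      occupied unless i = 1, so H has rank i - 1 and two flats of rank i above it have a join of
      rank i + 1.\<close>
    define i where "i = Min (?J - r ` \<sigma>)"
    have iJ: "i \<in> ?J" "i \<notin> r ` \<sigma>" using Min_in[OF _ False] unfolding i_def by auto
    have below: "j \<in> r ` \<sigma>" if "j \<in> ?J" "j < i" for j
      using Min_le[of "?J - r ` \<sigma>" j] that unfolding i_def by (meson DiffI finite_Diff finite_atLeastAtMost not_le)
    have i1: "1 \<le> i" "i \<le> d" using iJ by auto
    have nm: "m = 0 \<or> i \<noteq> Suc m" using less(6) iJ i1 by (metis Suc_n_not_le_n le_trans)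
    obtain p where p: "p \<in> \<tau>" "r p = i" using iJ missing_ranks[OF less(2)] by (metis imageE)
    obtain p' where p': "p' \<in> \<tau>'" "r p' = i" using iJ missing_ranks[OF less(3)] by (metis imageE)
    have "p \<notin> \<sigma>" "p' \<notin> \<sigma>" using p(2) p'(2) iJ(2) imageI[of _ \<sigma> r] by metis+
    then have pl: "p \<in> link \<sigma>" "p' \<in> link \<sigma>"
      using insert_chain_link[OF chain_mono[OF c(1), of "insert p \<sigma>"]] insert_chain_link[OF chain_mono[OF c(2), of "insert p' \<sigma>"]]
        p p' less(4,5) by auto
    have IH: "R \<tau>1 \<tau>2" if "\<tau>1 \<in> missing m" "\<tau>2 \<in> missing m" "insert x \<sigma> \<subseteq> \<tau>1" "insert x \<sigma> \<subseteq> \<tau>2" "r x = i" for \<tau>1 \<tau>2 x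
    proof (rule less(1)[OF _ that(1-4)])
      have "?J - r ` insert x \<sigma> \<subset> ?J - r ` \<sigma>" using iJ that(5) by auto
      then show "card (?J - r ` insert x \<sigma>) < card (?J - r ` \<sigma>)" by (intro psubset_card_mono) auto
      show "m = 0 \<or> d \<le> m \<or> Suc m \<in> r ` insert x \<sigma>" using less(6) by auto
    qed
    show ?thesis
    proof (cases "p = p'")
      case True
      then show ?thesis using IH[OF less(2,3), of p] p p' less(4,5) by simp
    next
      case pp: False
      obtain H K where g: "gap \<sigma> i H K" using gap_exists[OF c(3) i1] by blast
      note gf = gap_flats[OF c(3) g]
      have rH: "Suc (r H) = i"
      proof (rule gap_lower_rank[OF c(3) g i1(1)])
        have "i - 1 \<in> r ` \<sigma>" if "i \<noteq> 1"
        proof (rule below)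
          have "i - 1 \<noteq> m" using nm that i1 by auto
          then show "i - 1 \<in> ?J" using that i1 by auto
        qed (use i1 in simp)
        then show "i = 1 \<or> i - 1 \<in> r ` \<sigma>" by blast
      qed
      have bet: "H \<subset> p" "p \<subset> K" "H \<subset> p'" "p' \<subset> K"
        using gap_linkD[OF c(3) g pl(1) p(2)] gap_linkD[OF c(3) g pl(2) p'(2)] by auto
      have KE: "K = E \<or> K \<in> \<sigma>" "H = {} \<or> H \<in> \<sigma>" using g unfolding gap_def by auto
      have pE: "p \<subseteq> E" "p' \<subseteq> E" "p \<in> V" "p' \<in> V" using link_V[OF pl(1)] link_V[OF pl(2)] np_subset by auto
      \<comment> \<open>A chain through p whose higher members all contain \<open>p'\<close> as
        well, so that p can be exchanged. If no rank to be filled lies between i and r K, then K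
        serves as the join.\<close>
      have "\<exists>\<tau>1\<in>missing m. insert p \<sigma> \<subseteq> \<tau>1 \<and> (\<forall>F\<in>\<tau>1. i < r F \<longrightarrow> p' \<subseteq> F)"
      proof (cases "\<forall>j\<in>?J. i < j \<longrightarrow> r K \<le> j")
        case True
        have "p' \<subseteq> F" if F: "F \<in> \<tau>" "i < r F" for F
        proof -
          have "r F \<in> ?J" using missing_ranks[OF less(2)] F(1) by blast
          then have rK: "r K \<le> r F" "r F \<le> d" using True F(2) by auto
          then have "K \<noteq> E" using rank_E by auto
          then have "K \<subseteq> F" using KE(1) less(4) chain_rank_le[OF c(1) _ F(1) rK(1)] by blast
          then show ?thesis using bet(4) by blast
        qed
        then show ?thesis using less(2,4) p(1) by blast
      next
        case False
        then obtain j where j: "j \<in> ?J" "i < j" "j < r K" by (meson not_le)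
        \<comment> \<open>If i + 1 were the missing rank, the join could not be inserted. But then
          rank m + 1 is occupied in \<sigma>, K has rank at most m + 1, and nothing is left to fill
          below K.\<close>
        have "Suc i \<noteq> m"
        proof
          assume m: "Suc i = m"
          then have jm: "Suc m \<le> j" using j by auto
          then have "\<not> d \<le> m" using j(1) by auto
          then have "Suc m \<in> r ` \<sigma>" using less(6) m by auto
          then have "r K \<le> Suc m" using gap_upper_rank[OF c(3) g, of "Suc m"] m by simp
          then show False using j(3) jm by simp
        qed
        then have SiJ: "Suc i \<in> ?J" and SiK: "Suc i < r K" using j by auto
        define q where "q = cl E r (p \<union> p')"
        have PP: "p \<union> p' \<subseteq> E" "p \<union> p' \<subseteq> K" using pE bet by blast+
        have q: "is_flat E r q" "p \<subseteq> q" "p' \<subseteq> q" "q \<subseteq> K" "r q = r (p \<union> p')"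
          unfolding q_def using flat_cl[OF PP(1)] subset_cl[OF PP(1)] rank_cl[OF PP(1)] cl_mono_flat[OF gf(2) PP(2)] by simp_all
        have rq: "r q = Suc i"
        proof -
          have "r (p \<union> p') + r (p \<inter> p') \<le> r p + r p'" by (rule rank_submod[OF pE(1,2)])
          moreover have "r H \<le> r (p \<inter> p')" by (rule rank_mono) (use bet pE in auto)
          moreover have "r p < r (p \<union> p')"
          proof (rule flat_rank_less[OF np_flat[OF pE(3)] PP(1)])
            have "\<not> p' \<subseteq> p" using V_rank_eq[OF pE(3,4)] p(2) p'(2) pp unfolding cmp_def by auto
            then show "p \<subset> p \<union> p'" by blast
          qed
          ultimately show ?thesis using q(5) p(2) p'(2) rH by linarith
        qed
        have "q \<noteq> K" using rq SiK by auto
        then have ql: "q \<in> link \<sigma>"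
          using q bet(1) by (intro gap_linkI[OF c(3) g iJ(2) q(1)]) auto
        then have ql': "q \<in> link (insert p \<sigma>)"
          using link_insert_iff[OF pE(3), of q \<sigma>] q(2) rq p(2) by (auto simp: cmp_def)
        have "chain (insert q (insert p \<sigma>))" by (rule chain_insert[OF chain_insert[OF c(3) pl(1)] ql'])
        moreover have "r ` insert q (insert p \<sigma>) \<subseteq> ?J"
        proof -
          have "r ` \<sigma> \<subseteq> ?J" using image_mono[OF less(4), of r] missing_ranks[OF less(2)] by simp
          then show ?thesis unfolding image_insert p(2) rq using SiJ iJ(1) by blast
        qed
        ultimately obtain \<tau>1 where t: "chain \<tau>1" "insert q (insert p \<sigma>) \<subseteq> \<tau>1" "r ` \<tau>1 = ?J"
          using extend_chain[of _ ?J] by (metis Diff_subset)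
        have "p' \<subseteq> F" if F: "F \<in> \<tau>1" "i < r F" for F
        proof -
          have "q \<subseteq> F" by (rule chain_rank_le[OF t(1) _ F(1)]) (use t(2) rq F(2) in auto)
          then show ?thesis using q(3) by blast
        qed
        then show ?thesis using t by (intro bexI[of _ \<tau>1]) (auto simp: missing_def)
      qed
      then obtain \<tau>1 where t: "\<tau>1 \<in> missing m" "insert p \<sigma> \<subseteq> \<tau>1" "\<And>F. F \<in> \<tau>1 \<Longrightarrow> i < r F \<Longrightarrow> p' \<subseteq> F" by metis
      define \<rho> where "\<rho> = \<tau>1 - {p}"
      have ct: "chain \<tau>1" by (rule missing_chain[OF t(1)])
      have t1: "\<tau>1 = insert p \<rho>" "p \<notin> \<rho>" and c\<rho>: "chain \<rho>"
        using t(2) chain_mono[OF ct] by (auto simp: \<rho>_def)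
      have rne: "r F \<noteq> i" if "F \<in> \<rho>" for F
        using inj_onD[OF chain_rank_inj[OF ct], of F p] that p(2) t1 by auto
      have p'n: "p' \<notin> \<rho>" using rne p'(2) by blast
      have cm: "cmp F p'" if F: "F \<in> \<rho>" for F
      proof (cases "i < r F")
        case True
        then show ?thesis using t(3)[of F] F t1 unfolding cmp_def by auto
      next
        case False
        have F1: "F \<in> \<tau>1" using F t1 by simp
        have le: "r F \<le> r H" using False rne[OF F] rH by simp
        then have "H \<noteq> {}" using V_rank[OF chain_V[OF ct F1]] by auto
        then have "H \<in> \<tau>1" using KE(2) t(2) by blast
        then have "F \<subseteq> H" using chain_rank_le[OF ct F1 _ le] by blast
        then show ?thesis using bet(3) unfolding cmp_def by blast
      qed
      have "p' \<in> link \<rho>" unfolding link_def using pE(4) p'n cm by blast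
      then have ct': "chain (insert p' \<rho>)" by (rule chain_insert[OF c\<rho>])
      have t': "insert p' \<rho> \<in> missing m"
        using ct' missing_ranks[OF t(1)] p(2) p'(2) unfolding t1(1) missing_def by simp
      have s\<rho>: "\<sigma> \<subseteq> \<rho>" using t(2) \<open>p \<notin> \<sigma>\<close> by (auto simp: \<rho>_def)
      have "R \<tau> \<tau>1" using IH[OF less(2) t(1), of p] p less(4) t(2) by simp
      moreover have "R \<tau>1 (insert p' \<rho>)"
        unfolding t1(1) by (rule exch) (use t(1) t1 t' p'n p p' pp nm in auto)
      moreover have "R (insert p' \<rho>) \<tau>'" using IH[OF t' less(3), of p'] p' less(5) s\<rho> by auto
      ultimately show ?thesis using trans by blast
    qed
  qed
qed

text \<open>The gap relation for e in G - G' and f in G' - G. By \<open>low\<close> the gap starts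
  one rank below G, so G is the only flat of its rank in the link through e, and G' the only one
  through f. What remains are flats of other ranks.\<close>

lemma exchange:
  assumes G: "chain (insert G \<rho>)" "G \<notin> \<rho>" and G': "chain (insert G' \<rho>)" "G' \<notin> \<rho>" "r G = r G'" "G \<noteq> G'"
    and low: "r G = 1 \<or> r G - 1 \<in> r ` \<rho>"
  shows "\<exists>e f. e \<in> G \<and> e \<notin> G' \<and> f \<in> G' \<and> f \<notin> G \<and> X (insert G \<rho>) - X (insert G' \<rho>)
     + (\<Sum>F\<in>{F\<in>link \<rho>. r F \<noteq> r G}. const ((if e \<in> F then 1 else 0) - (if f \<in> F then 1 else 0)) * X (insert F \<rho>)) \<in> I"
proof -
  have c: "chain \<rho>" using chain_mono[OF G(1)] by blast
  have l: "G \<in> link \<rho>" "G' \<in> link \<rho>" using insert_chain_link G G' by auto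
  let ?i = "r G"
  have i: "1 \<le> ?i" "?i \<le> d" "?i \<notin> r ` \<rho>" using V_rank[OF link_V[OF l(1)]] link_rank[OF c l(1)] by auto
  obtain H K where g: "gap \<rho> ?i H K" using gap_exists[OF c i(1,2)] by blast
  have rH: "Suc (r H) = ?i" by (rule gap_lower_rank[OF c g i(1) low])
  have "\<not> cmp G G'" using V_rank_eq[OF link_V[OF l(1)] link_V[OF l(2)] G'(3)] G'(4) by blast
  then obtain e f where ef: "e \<in> G" "e \<notin> G'" "f \<in> G'" "f \<notin> G" unfolding cmp_def by blast
  have bet: "H \<subset> F" "F \<subset> K" if "F \<in> link \<rho>" "r F = ?i" for F using gap_linkD[OF c g that] by auto
  have efH: "e \<in> K" "e \<notin> H" "f \<in> K" "f \<notin> H" using ef bet[OF l(1)] bet[OF l(2)] G'(3) by auto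
  have uniq: "F = F'" if "F \<in> link \<rho>" "r F = ?i" "F' \<in> link \<rho>" "r F' = ?i" "x \<in> F" "x \<in> F'" "x \<notin> H" for F F' x
    using flat_cover_unique[OF gap_flats(1)[OF c g] np_flat[OF link_V[OF that(1)]], of x]
      flat_cover_unique[OF gap_flats(1)[OF c g] np_flat[OF link_V[OF that(3)]], of x]
      bet[OF that(1,2)] bet[OF that(3,4)] that rH by auto
  let ?c = "\<lambda>F. (if e \<in> F then 1 else 0) - (if f \<in> F then 1 else (0::real))"
  have "(\<Sum>F\<in>link \<rho>. const (?c F) * X (insert F \<rho>)) \<in> I"
    by (rule gap_relation_ideal[OF c g i(3) efH])
  also have "(\<Sum>F\<in>link \<rho>. const (?c F) * X (insert F \<rho>))
     = (\<Sum>F\<in>{F\<in>link \<rho>. r F = ?i} \<union> {F\<in>link \<rho>. r F \<noteq> ?i}. const (?c F) * X (insert F \<rho>))"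
    by (rule sum.cong) auto
  also have "\<dots> = (\<Sum>F\<in>{F\<in>link \<rho>. r F = ?i}. const (?c F) * X (insert F \<rho>))
     + (\<Sum>F\<in>{F\<in>link \<rho>. r F \<noteq> ?i}. const (?c F) * X (insert F \<rho>))"
    by (rule sum.union_disjoint) auto
  also have "(\<Sum>F\<in>{F\<in>link \<rho>. r F = ?i}. const (?c F) * X (insert F \<rho>))
     = (\<Sum>F\<in>{F\<in>link \<rho>. r F = ?i}. (if F = G then X (insert F \<rho>) else 0) - (if F = G' then X (insert F \<rho>) else 0))"
  proof (intro sum.cong refl)
    fix F assume F: "F \<in> {F\<in>link \<rho>. r F = ?i}"
    have F: "F \<in> link \<rho>" "r F = ?i" using F by simp_all
    have eG: "(e \<in> F) = (F = G)"
      using uniq[OF F l(1) refl _ ef(1) efH(2)] ef(1) by blast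
    have fG: "(f \<in> F) = (F = G')"
      using uniq[OF F l(2) G'(3)[symmetric] _ ef(3) efH(4)] ef(3) by blast
    show "const (?c F) * X (insert F \<rho>) = (if F = G then X (insert F \<rho>) else 0) - (if F = G' then X (insert F \<rho>) else 0)"
      unfolding eG fG using G'(4) by (simp add: const_uminus)
  qed
  also have "\<dots> = X (insert G \<rho>) - X (insert G' \<rho>)"
    using l G'(3) by (simp add: sum_subtractf sum.delta)
  finally show ?thesis using ef by blast
qed

text \<open>An exchange in a complete flag has no error terms, since after removing one member only
  that rank is missing. So all complete flags are congruent, and the degree, 1 on each, decides
  membership in the ideal.\<close>

lemma top_degree_ideal:
  assumes w: "w \<in> homs V d" and z: "dg w = 0"
  shows "w \<in> I"
proof -
  have ch: "chains d = missing 0"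
  proof -
    have "r ` \<sigma> = {1..d} \<longleftrightarrow> card \<sigma> = d" if "chain \<sigma>" for \<sigma>
    proof
      assume "card \<sigma> = d"
      then show "r ` \<sigma> = {1..d}" by (intro card_subset_eq) (use chain_ranks[OF that] chain_card[OF that] in auto)
    qed (use chain_card[OF that] in auto)
    then show ?thesis unfolding chains_def missing_def by (intro Collect_cong conj_cong) auto
  qed
  obtain \<tau>0 where t0: "\<tau>0 \<in> missing 0" using extend_chain[of "{}" "{1..d}"] by (auto simp: missing_def)
  have eq: "X \<tau> - X \<tau>0 \<in> I" if t: "\<tau> \<in> missing 0" for \<tau>
  proof (rule flags_connected[OF _ _ _ t t0, of "\<lambda>\<tau> \<tau>'. X \<tau> - X \<tau>' \<in> I" "{}"])
    fix \<tau>1 \<tau>2 \<tau>3 assume "X \<tau>1 - X \<tau>2 \<in> I" "X \<tau>2 - X \<tau>3 \<in> I"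
    from ideal_add[OF this] show "X \<tau>1 - X \<tau>3 \<in> I" by simp
  next
    fix \<rho> G G' assume a: "insert G \<rho> \<in> missing 0" "insert G' \<rho> \<in> missing 0" "G \<notin> \<rho>" "G' \<notin> \<rho>" "r G = r G'" "G \<noteq> G'"
    have cG: "chain (insert G \<rho>)" "chain (insert G' \<rho>)" using a missing_chain by auto
    have im: "insert (r G) (r ` \<rho>) = {1..d}" using missing_ranks[OF a(1)] by simp
    have "r G = 1 \<or> r G - 1 \<in> r ` \<rho>"
    proof (rule disjCI)
      assume n: "r G - 1 \<notin> r ` \<rho>"
      have rG: "r G \<in> {1..d}" using im by blast
      then have "r G - 1 \<noteq> r G" by auto
      then have "r G - 1 \<notin> {1..d}" using n unfolding im[symmetric] by blast
      then show "r G = 1" using rG by auto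
    qed
    from exchange[OF cG(1) a(3) cG(2) a(4-6) this]
    obtain e f where "X (insert G \<rho>) - X (insert G' \<rho>)
     + (\<Sum>F\<in>{F\<in>link \<rho>. r F \<noteq> r G}. const ((if e \<in> F then 1 else 0) - (if f \<in> F then 1 else 0)) * X (insert F \<rho>)) \<in> I"
      by blast
    moreover have "{F\<in>link \<rho>. r F \<noteq> r G} = {}"
    proof -
      have "chain \<rho>" using chain_mono[OF cG(1)] by blast
      then have "r F \<in> {1..d} - r ` \<rho>" if "F \<in> link \<rho>" for F using link_rank_missing that by blast
      then show ?thesis unfolding im[symmetric] by blast
    qed
    ultimately show "X (insert G \<rho>) - X (insert G' \<rho>) \<in> I" by simp
  qed auto
  obtain c where c: "w - (\<Sum>\<sigma>\<in>missing 0. const (c \<sigma>) * X \<sigma>) \<in> I"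
    using homs_cspan[OF w] unfolding cspan_def ch by blast
  let ?C = "\<Sum>\<sigma>\<in>missing 0. c \<sigma>"
  have "(\<Sum>\<sigma>\<in>missing 0. const (c \<sigma>) * (X \<sigma> - X \<tau>0)) \<in> I" by (intro ideal_sum ideal_scale eq)
  from ideal_add[OF c this] have wC: "w - const ?C * X \<tau>0 \<in> I"
    by (simp add: right_diff_distrib sum_subtractf const_sum sum_distrib_right)
  then have "dg w = ?C * dg (X \<tau>0)" using dg_ideal[OF wC] by (simp add: dg_diff dg_scale)
  moreover have "dg (X \<tau>0) = 1" using t0 ch by (intro dg_flag) (auto simp: chains_def)
  ultimately have "?C = 0" using z by simp
  then show ?thesis using wC by simp
qed

text \<open>A filtration by the missing rank of the chains of size d - 1, descended one level at a
  time by \<open>level_step\<close>.\<close>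

definition levels :: "nat \<Rightarrow> 'a set set set" where
  "levels k = (\<Union>m\<in>{1..k}. missing m)"

lemma finite_levels [simp]: "finite (levels k)" by (simp add: levels_def)

text \<open>An error term F of an exchange fills rank m. If r G < m, the missing rank becomes r G, a
  lower level. If r G > m + 1, a common flat of rank m + 1 contains F and lies in both G and G', so
  F contains neither e nor f. Rank m + 1 is never exchanged, as K is fixed.\<close>

lemma same_top_congruent:
  assumes m: "1 \<le> m" "m \<le> d" and t: "\<tau> \<in> missing m" "\<tau>' \<in> missing m"
    and top: "gap \<tau> m H K" "gap \<tau>' m H' K"
  shows "X \<tau> - X \<tau>' \<in> cspan (levels (m - 1))"
proof -
  have Kc: "K = E \<or> K \<in> \<tau> \<and> K \<in> \<tau>'"
    using top E_notin_V chain_V[OF missing_chain[OF t(1)]] chain_V[OF missing_chain[OF t(2)]] unfolding gap_def by auto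
  have rK: "r K = Suc m" by (rule missing_gap(2)[OF t(1) m top(1)])
  show ?thesis
  proof (rule flags_connected[OF _ _ _ t, of "\<lambda>\<tau> \<tau>'. X \<tau> - X \<tau>' \<in> cspan (levels (m - 1))" "{K} - {E}"])
    show "X \<tau> - X \<tau> \<in> cspan (levels (m - 1))" for \<tau> by (rule cspan_ideal) simp
  next
    fix \<tau>1 \<tau>2 \<tau>3 assume "X \<tau>1 - X \<tau>2 \<in> cspan (levels (m - 1))" "X \<tau>2 - X \<tau>3 \<in> cspan (levels (m - 1))"
    from cspan_add[OF this] show "X \<tau>1 - X \<tau>3 \<in> cspan (levels (m - 1))" by simp
  next
    fix \<rho> G G' assume a: "insert G \<rho> \<in> missing m" "insert G' \<rho> \<in> missing m" "G \<notin> \<rho>" "G' \<notin> \<rho>" "r G = r G'" "G \<noteq> G'"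
      "m = 0 \<or> r G \<noteq> Suc m"
    have cG: "chain (insert G \<rho>)" "chain (insert G' \<rho>)" using a missing_chain by auto
    have c: "chain \<rho>" using chain_mono[OF cG(1)] by blast
    have im: "insert (r G) (r ` \<rho>) = {1..d} - {m}" using missing_ranks[OF a(1)] by simp
    have "r G \<in> {1..d} - {m}" unfolding im[symmetric] by simp
    then have rG: "r G \<in> {1..d}" "r G \<noteq> m" "r G \<noteq> Suc m" using a(7) m(1) by auto
    have nr: "r G \<notin> r ` \<rho>" using link_rank[OF c insert_chain_link[OF cG(1) a(3)]] .
    have in_\<rho>: "j \<in> r ` \<rho>" if "j \<in> {1..d}" "j \<noteq> m" "j \<noteq> r G" for j
      using im that by blast
    have low: "r G = 1 \<or> r G - 1 \<in> r ` \<rho>"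
    proof (rule disjCI)
      assume n: "r G - 1 \<notin> r ` \<rho>"
      have "r G - 1 \<noteq> m" "r G - 1 \<noteq> r G" using rG by auto
      then have "r G - 1 \<notin> {1..d}" using n in_\<rho> by blast
      then show "r G = 1" using rG by auto
    qed
    from exchange[OF cG(1) a(3) cG(2) a(4-6) low]
    obtain e f where ef: "e \<in> G" "e \<notin> G'" "f \<in> G'" "f \<notin> G" "X (insert G \<rho>) - X (insert G' \<rho>)
     + (\<Sum>F\<in>{F\<in>link \<rho>. r F \<noteq> r G}. const ((if e \<in> F then 1 else 0) - (if f \<in> F then 1 else 0)) * X (insert F \<rho>)) \<in> I"
      (is "_ + ?S \<in> I") by blast
    have "?S \<in> cspan (levels (m - 1))"
    proof (rule cspan_sum)
      fix F assume "F \<in> {F\<in>link \<rho>. r F \<noteq> r G}"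
      then have F: "F \<in> link \<rho>" "r F \<noteq> r G" by auto
      have rF: "r F = m" using link_rank_missing[OF c F(1)] in_\<rho> F(2) by blast
      show "const ((if e \<in> F then 1 else 0) - (if f \<in> F then 1 else 0)) * X (insert F \<rho>) \<in> cspan (levels (m - 1))"
      proof (cases "r G < m")
        case True
        have "r ` \<rho> = {1..d} - {m} - {r G}" using im nr by blast
        moreover have "m \<in> {1..d} - {r G}" using m rG(2) by simp
        ultimately have "r ` insert F \<rho> = {1..d} - {r G}" unfolding image_insert rF by blast
        then have "insert F \<rho> \<in> missing (r G)" using chain_insert[OF c F(1)] by (simp add: missing_def)
        then have "insert F \<rho> \<in> levels (m - 1)" unfolding levels_def using rG True by auto
        then show ?thesis by (intro cspan_scale cspan_X) auto
      next
        case False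
        then have big: "Suc m < r G" using rG by auto
        have "Suc m \<in> r ` \<rho>" by (rule in_\<rho>) (use big rG in auto)
        then obtain M where M: "M \<in> \<rho>" "r M = Suc m" by (metis imageE)
        have "M \<subseteq> G" by (rule chain_rank_le[OF cG(1)]) (use M big in auto)
        moreover have "M \<subseteq> G'" by (rule chain_rank_le[OF cG(2)]) (use M big a(5) in auto)
        moreover have "F \<subseteq> M" by (rule chain_rank_le[OF chain_insert[OF c F(1)]]) (use M rF in auto)
        ultimately have "e \<notin> F" "f \<notin> F" using ef by auto
        then show ?thesis by (simp add: cspan_ideal)
      qed
    qed
    from cspan_diff[OF cspan_ideal[OF ef(5)] this] show "X (insert G \<rho>) - X (insert G' \<rho>) \<in> cspan (levels (m - 1))"
      by simp
  next
    show "m = 0 \<or> d \<le> m \<or> Suc m \<in> r ` ({K} - {E})"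
    proof (cases "K = E")
      case True
      then show ?thesis using rK rank_E by simp
    next
      case False
      then show ?thesis using rK by auto
    qed
  qed (use Kc in auto)
qed

text \<open>Testing with the variable of K, or with \<open>alpha\<close> if K = E, isolates the
  chains missing m with upper end K and kills all lower levels. So their coefficients sum to 0, and
  these chains are congruent modulo lower levels.\<close>

lemma level_step:
  assumes m: "1 \<le> m" "m \<le> d" and w: "w \<in> cspan (levels m)" and triv: "\<And>F. F \<in> V \<Longrightarrow> dg (w * var F) = 0"
  shows "w \<in> cspan (levels (m - 1))"
proof -
  obtain c where c: "w - (\<Sum>\<tau>\<in>levels m. const (c \<tau>) * X \<tau>) \<in> I" using w unfolding cspan_def by blast
  have same: "m = m'" if "\<tau> \<in> missing m" "\<tau> \<in> missing m'" "1 \<le> m'" "m' \<le> d" for \<tau> m'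
  proof (rule ccontr)
    assume "m \<noteq> m'"
    then have "m' \<in> {1..d} - {m}" "m' \<notin> {1..d} - {m'}" using that by auto
    then show False using missing_ranks[OF that(1)] missing_ranks[OF that(2)] by metis
  qed
  have disj: "levels (m - 1) \<inter> missing m = {}"
  proof (rule equals0I)
    fix \<tau> assume a: "\<tau> \<in> levels (m - 1) \<inter> missing m"
    then obtain m' where m': "1 \<le> m'" "m' \<le> m - 1" "\<tau> \<in> missing m'" unfolding levels_def by auto
    then have "m' \<le> d" "m \<noteq> m'" using m by arith+
    then show False using same[OF _ m'(3,1)] a by blast
  qed
  have "{1..m} = insert m {1..m - 1}" using m by auto
  then have lev: "levels m = levels (m - 1) \<union> missing m" unfolding levels_def by auto
  have "\<forall>\<tau>\<in>missing m. \<exists>H K. gap \<tau> m H K" using gap_exists[OF missing_chain m] by blast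
  then obtain bot top where g: "\<And>\<tau>. \<tau> \<in> missing m \<Longrightarrow> gap \<tau> m (bot \<tau>) (top \<tau>)" by metis
  have pair: "(\<Sum>\<tau>\<in>levels m. c \<tau> * dg (X \<tau> * y)) = dg (w * y)" if "vars_in V y" for y
    by (rule dg_expand[OF c that, symmetric])
  have zero: "(\<Sum>\<tau>\<in>{\<tau>\<in>missing m. top \<tau> = K}. c \<tau>) = 0" if K: "K \<in> top ` missing m" for K
  proof -
    obtain \<tau>K where tK: "\<tau>K \<in> missing m" "K = top \<tau>K" using K by blast
    have rK: "r K = Suc m" unfolding tK(2) by (rule missing_gap(2)[OF tK(1) m g[OF tK(1)]])
    have fK: "is_flat E r K" unfolding tK(2) by (rule gap_flats(2)[OF missing_chain[OF tK(1)] g[OF tK(1)]])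
    show ?thesis
    proof (cases "m = d")
      case True
      have allE: "top \<tau> = E" if "\<tau> \<in> missing m" for \<tau>
        using flat_eqI[OF gap_flats(2)[OF missing_chain[OF that] g[OF that]] order_refl]
          missing_gap(2)[OF that m g[OF that]] rank_E True
          flat_subset[OF gap_flats(2)[OF missing_chain[OF that] g[OF that]]] by simp
      obtain e where e: "e \<in> E" using E_ne by blast
      have "dg (w * alpha e) = 0" unfolding alpha_def sum_distrib_left dg_sum by (rule sum.neutral) (use triv in auto)
      then have "(\<Sum>\<tau>\<in>levels m. c \<tau> * dg (X \<tau> * alpha e)) = 0"
        using pair[OF homs_vars[OF homs_alpha]] by simp
      moreover have "c \<tau> * dg (X \<tau> * alpha e) = (if \<tau> \<in> missing m then c \<tau> else 0)" if t: "\<tau> \<in> levels m" for \<tau>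
      proof -
        obtain m' where m': "1 \<le> m'" "m' \<le> m" "\<tau> \<in> missing m'" using t unfolding levels_def by auto
        have m'd: "m' \<le> d" using m' m by simp
        obtain H K where "gap \<tau> m' H K" using gap_exists[OF missing_chain[OF m'(3)] m'(1) m'd] by blast
        from dg_missing_alpha[OF m'(3,1) m'd this e] show ?thesis
          using same[OF _ m'(3,1) m'd] m'(3) True by (cases "m' = m") auto
      qed
      ultimately have "(\<Sum>\<tau>\<in>levels m. if \<tau> \<in> missing m then c \<tau> else 0) = 0" by simp
      moreover have "levels m \<inter> missing m = missing m" using lev by blast
      ultimately have "(\<Sum>\<tau>\<in>missing m. c \<tau>) = 0" by (simp add: sum.inter_restrict[symmetric])
      moreover have "{\<tau>\<in>missing m. top \<tau> = K} = missing m" using allE tK by auto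
      ultimately show ?thesis by simp
    next
      case False
      then have KV: "K \<in> V" using VI[OF fK] rK m by simp
      have "(\<Sum>\<tau>\<in>levels m. c \<tau> * dg (X \<tau> * var K)) = 0"
        using pair[OF vars_in_var[OF KV]] triv[OF KV] by simp
      moreover have "c \<tau> * dg (X \<tau> * var K) = - (if \<tau> \<in> {\<tau>\<in>missing m. top \<tau> = K} then c \<tau> else 0)" if t: "\<tau> \<in> levels m" for \<tau>
      proof (cases "\<tau> \<in> missing m")
        case True
        then show ?thesis using dg_missing_top[OF True m g[OF True] KV] rK by auto
      next
        case nm: False
        obtain m' where m': "1 \<le> m'" "m' \<le> m" "\<tau> \<in> missing m'" using t unfolding levels_def by auto
        have m'd: "m' \<le> d" "m' < m" using m' m nm by (auto simp: le_less)
        obtain H' K' where g': "gap \<tau> m' H' K'" using gap_exists[OF missing_chain[OF m'(3)] m'(1) m'd(1)] by blast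
        have "K \<noteq> K'" using missing_gap(2)[OF m'(3,1) m'd(1) g'] rK m'd by auto
        then show ?thesis using dg_missing_top[OF m'(3,1) m'd(1) g' KV] rK m'd nm by auto
      qed
      ultimately have "(\<Sum>\<tau>\<in>levels m. if \<tau> \<in> {\<tau>\<in>missing m. top \<tau> = K} then c \<tau> else 0) = 0"
        by (simp add: sum_negf)
      moreover have "levels m \<inter> {\<tau>\<in>missing m. top \<tau> = K} = {\<tau>\<in>missing m. top \<tau> = K}" using lev by blast
      ultimately show ?thesis
        using sum.inter_restrict[OF finite_levels[of m], of c "{\<tau>\<in>missing m. top \<tau> = K}"] by simp
    qed
  qed
  have "(\<Sum>\<tau>\<in>{\<tau>\<in>missing m. top \<tau> = K}. const (c \<tau>) * X \<tau>) \<in> cspan (levels (m - 1))" if K: "K \<in> top ` missing m" for K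
  proof -
    obtain \<tau>K where tK: "\<tau>K \<in> missing m" "K = top \<tau>K" using K by blast
    have "(\<Sum>\<tau>\<in>{\<tau>\<in>missing m. top \<tau> = K}. const (c \<tau>) * (X \<tau> - X \<tau>K)) \<in> cspan (levels (m - 1))"
    proof (intro cspan_sum cspan_scale)
      fix \<tau> assume "\<tau> \<in> {\<tau>\<in>missing m. top \<tau> = K}"
      then show "X \<tau> - X \<tau>K \<in> cspan (levels (m - 1))"
        using same_top_congruent[OF m _ tK(1) _ g[OF tK(1)], of \<tau> "bot \<tau>"] g[of \<tau>] tK(2) by simp
    qed
    moreover have "(\<Sum>\<tau>\<in>{\<tau>\<in>missing m. top \<tau> = K}. const (c \<tau>) * (X \<tau> - X \<tau>K)) =
       (\<Sum>\<tau>\<in>{\<tau>\<in>missing m. top \<tau> = K}. const (c \<tau>) * X \<tau>) - const (\<Sum>\<tau>\<in>{\<tau>\<in>missing m. top \<tau> = K}. c \<tau>) * X \<tau>K"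
      by (simp add: right_diff_distrib sum_subtractf const_sum sum_distrib_right)
    ultimately show ?thesis using zero[OF K] by simp
  qed
  then have "(\<Sum>K\<in>top ` missing m. \<Sum>\<tau>\<in>{\<tau>\<in>missing m. top \<tau> = K}. const (c \<tau>) * X \<tau>) \<in> cspan (levels (m - 1))"
    by (rule cspan_sum)
  also have "(\<Sum>K\<in>top ` missing m. \<Sum>\<tau>\<in>{\<tau>\<in>missing m. top \<tau> = K}. const (c \<tau>) * X \<tau>) = (\<Sum>\<tau>\<in>missing m. const (c \<tau>) * X \<tau>)"
    by (rule sum.group) auto
  finally have 1: "(\<Sum>\<tau>\<in>missing m. const (c \<tau>) * X \<tau>) \<in> cspan (levels (m - 1))" .
  have 2: "(\<Sum>\<tau>\<in>levels (m - 1). const (c \<tau>) * X \<tau>) \<in> cspan (levels (m - 1))"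
    by (intro cspan_sum cspan_scale cspan_X) auto
  have "(\<Sum>\<tau>\<in>levels m. const (c \<tau>) * X \<tau>) = (\<Sum>\<tau>\<in>levels (m - 1). const (c \<tau>) * X \<tau>) + (\<Sum>\<tau>\<in>missing m. const (c \<tau>) * X \<tau>)"
    unfolding lev by (rule sum.union_disjoint) (use disj in auto)
  then show ?thesis using cspan_cong[OF cspan_add[OF 2 1]] c by simp
qed

text \<open>A chain of size d - 1 misses exactly one rank, so w lies in the span of level d. Level 0
  is empty and its span is the ideal.\<close>

lemma poincare_duality_codim1:
  assumes w: "w \<in> homs V (d - 1)" and d: "1 \<le> d" and triv: "\<And>F. F \<in> V \<Longrightarrow> dg (w * var F) = 0"
  shows "w \<in> I"
proof -
  have "chains (d - 1) \<subseteq> levels d"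
  proof
    fix \<tau> assume "\<tau> \<in> chains (d - 1)"
    then have t: "chain \<tau>" "card \<tau> + 1 = d" using d by (auto simp: chains_def)
    then obtain m where m: "{1..d} - r ` \<tau> = {m}" using card_missing[OF t] by (auto simp: card_1_singleton_iff)
    then have "r ` \<tau> = {1..d} - {m}" "m \<in> {1..d}" using chain_ranks[OF t(1)] by blast+
    then show "\<tau> \<in> levels d" using t(1) by (auto simp: levels_def missing_def)
  qed
  then have "w \<in> cspan (levels d)"
  proof -
    obtain c where c: "w - (\<Sum>\<tau>\<in>chains (d - 1). const (c \<tau>) * X \<tau>) \<in> I"
      using homs_cspan[OF w] unfolding cspan_def by blast
    have "(\<Sum>\<tau>\<in>chains (d - 1). const (c \<tau>) * X \<tau>) \<in> cspan (levels d)"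
      using \<open>chains (d - 1) \<subseteq> levels d\<close> by (intro cspan_sum cspan_scale cspan_X) auto
    then show ?thesis by (rule cspan_cong[OF _ c])
  qed
  moreover have down: "w \<in> cspan (levels (d - k))" if "k \<le> d" "w \<in> cspan (levels d)" for k
    using that
  proof (induction k)
    case (Suc k)
    have "w \<in> cspan (levels (d - k - 1))"
      by (rule level_step) (use Suc triv in auto)
    then show ?case by simp
  qed simp
  ultimately have "w \<in> cspan (levels 0)" using down[of d] by simp
  then show ?thesis by (simp add: cspan_def levels_def)
qed

end

section \<open>Hard Lefschetz and the theorem\<close>

text \<open>The subspace W is arbitrary for the sake of the induction: it shrinks to the kernel of f s.\<close>
lemma functional_in_span:
  fixes f :: "'c \<Rightarrow> ('b \<Rightarrow> real) \<Rightarrow> real"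
  assumes "finite S"
    and f: "\<And>s u v c. f s (\<lambda>x. u x + c * v x) = f s u + c * f s v"
    and g: "\<And>u v c. g (\<lambda>x. u x + c * v x) = g u + c * g v"
    and "\<And>u v c. u \<in> W \<Longrightarrow> v \<in> W \<Longrightarrow> (\<lambda>x. u x + c * v x) \<in> W"
    and "\<And>u. u \<in> W \<Longrightarrow> (\<And>s. s \<in> S \<Longrightarrow> f s u = 0) \<Longrightarrow> g u = (0 :: real)"
  shows "\<exists>c. \<forall>u\<in>W. g u = (\<Sum>s\<in>S. c s * f s u)"
  using assms(1,4,5)
proof (induction S arbitrary: W rule: finite_induct)
  case empty
  then show ?case by simp
next
  case (insert s S)
  have "\<exists>c. \<forall>u\<in>{u \<in> W. f s u = 0}. g u = (\<Sum>s\<in>S. c s * f s u)"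
  proof (rule insert.IH)
    show "(\<lambda>x. u x + c * v x) \<in> {u \<in> W. f s u = 0}" if "u \<in> {u \<in> W. f s u = 0}" "v \<in> {u \<in> W. f s u = 0}" for u v c
      using that insert.prems(1) by (simp add: f)
    show "g u = 0" if "u \<in> {u \<in> W. f s u = 0}" "\<And>t. t \<in> S \<Longrightarrow> f t u = 0" for u
      by (rule insert.prems(2)) (use that in auto)
  qed
  then obtain c where c: "\<And>u. u \<in> W \<Longrightarrow> f s u = 0 \<Longrightarrow> g u = (\<Sum>s\<in>S. c s * f s u)" by blast
  have upd: "(\<Sum>t\<in>insert s S. (c(s := b)) t * f t u) = b * f s u + (\<Sum>t\<in>S. c t * f t u)" for b u
  proof -
    have "(\<Sum>t\<in>S. (c(s := b)) t * f t u) = (\<Sum>t\<in>S. c t * f t u)"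
      by (rule sum.cong) (use insert.hyps in auto)
    then show ?thesis using insert.hyps by simp
  qed
  show ?case
  proof (cases "\<forall>u\<in>W. f s u = 0")
    case True
    then show ?thesis using c upd by (intro exI[of _ "c(s := 0)"]) (simp del: fun_upd_apply)
  next
    case False
    then obtain v where v: "v \<in> W" "f s v \<noteq> 0" by blast
    \<comment> \<open>The value at v forces b. Subtracting a multiple of v moves any u into the
      kernel of \<open>f s\<close>, where c already works.\<close>
    define b where "b = (g v - (\<Sum>t\<in>S. c t * f t v)) / f s v"
    have "g u = b * f s u + (\<Sum>t\<in>S. c t * f t u)" if u: "u \<in> W" for u
    proof -
      define k where "k = - (f s u / f s v)"
      have "g (\<lambda>x. u x + k * v x) = (\<Sum>t\<in>S. c t * f t (\<lambda>x. u x + k * v x))"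
      proof (rule c[OF insert.prems(1)[OF u v(1)]])
        show "f s (\<lambda>x. u x + k * v x) = 0" unfolding f using v(2) by (simp add: k_def)
      qed
      then have "g u + k * g v = (\<Sum>t\<in>S. c t * f t u) + k * (\<Sum>t\<in>S. c t * f t v)"
        by (simp add: f g ring_distribs sum.distrib sum_distrib_left mult_ac)
      then have "g u = (\<Sum>t\<in>S. c t * f t u) - k * (g v - (\<Sum>t\<in>S. c t * f t v))"
        by (simp add: algebra_simps)
      moreover have "k * (g v - (\<Sum>t\<in>S. c t * f t v)) = - (b * f s u)" by (simp add: k_def b_def)
      ultimately show ?thesis by simp
    qed
    then show ?thesis unfolding upd[symmetric] by blast
  qed
qed

section \<open>Identification of the degree map\<close>

context chow
begin

lemma homs_1_divisor: "z \<in> homs V 1 \<Longrightarrow> \<exists>u. z = divisor E r u"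
proof (induction z rule: homs_induct)
  case zero
  show ?case by (rule exI[of _ "\<lambda>_. 0"]) (simp add: divisor_def)
next
  case (step c xs q)
  then obtain u F where u: "q = divisor E r u" "xs = [F]" "F \<in> V" by (cases xs) auto
  show ?case
    by (rule exI[of _ "\<lambda>G. c * xi F G + u G"]) (simp only: divisor_add divisor_scale divisor_xi[OF u(3)] u vmon_simps mult_1_right)
qed

lemma homs_0_const: "z \<in> homs V 0 \<Longrightarrow> \<exists>c. z = const c"
proof (induction z rule: homs_induct)
  case zero
  show ?case by (rule exI[of _ 0]) simp
next
  case (step c xs q)
  then obtain b where "q = const b" by blast
  then show ?case using step by (intro exI[of _ "c + b"]) (simp add: const_add)
qed

text \<open>Existence is \<open>dg\<close> cut off outside degree d. For uniqueness, p minus its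
  degree times a complete flag has degree 0, hence lies in the ideal, where every candidate
  vanishes.\<close>

lemma chow_deg_eq:
  assumes p: "p \<in> homs V d"
  shows "chow_deg E r p = dg p"
proof -
  have d: "r E - 1 = d" using rank_E by simp
  let ?A = "chow_hom E r (r E - 1)"
  have A: "?A = homs V d" unfolding chow_hom_eq d ..
  let ?P = "\<lambda>\<phi>. (\<forall>p\<in>?A. \<forall>q\<in>?A. \<phi> (p + q) = \<phi> p + \<phi> q) \<and> (\<forall>c. \<forall>p\<in>?A. \<phi> (const c * p) = c * \<phi> p)
    \<and> (\<forall>p\<in>?A \<inter> I. \<phi> p = 0) \<and> (\<forall>C. max_chain E r C \<longrightarrow> \<phi> (\<Prod>F\<in>C. var F) = (1::real))
    \<and> (\<forall>p. p \<notin> ?A \<longrightarrow> \<phi> p = 0)"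
  let ?\<phi> = "\<lambda>p. if p \<in> homs V d then dg p else 0"
  have "?P ?\<phi>"
    unfolding A
  proof (intro conjI allI ballI impI)
    fix C assume "max_chain E r C"
    then have C: "chain C" "card C = d" using max_chain_iff by auto
    then show "?\<phi> (\<Prod>F\<in>C. var F) = 1" using dg_flag[OF C] X_homs[OF C(1)] unfolding X_def by simp
  qed (auto simp: homs_add dg_add homs_scale dg_scale dg_ideal)
  moreover have "\<phi> = ?\<phi>" if P: "?P \<phi>" for \<phi>
  proof
    fix p
    show "\<phi> p = ?\<phi> p"
    proof (cases "p \<in> homs V d")
      case True
      obtain \<tau> where t: "chain \<tau>" "r ` \<tau> = {1..d}" using extend_chain[of "{}" "{1..d}"] by auto
      have tc: "card \<tau> = d" using chain_card[OF t(1)] t(2) by simp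
      have Xt: "X \<tau> \<in> homs V d" using X_homs[OF t(1)] tc by simp
      have "\<phi> (X \<tau>) = 1" using P max_chain_iff t(1) tc unfolding X_def by blast
      define q where "q = p - const (dg p) * X \<tau>"
      have q: "q \<in> homs V d" unfolding q_def by (intro homs_diff homs_scale True Xt)
      have "dg q = 0" unfolding q_def by (simp add: dg_diff dg_scale dg_flag[OF t(1) tc])
      then have "\<phi> q = 0" using P top_degree_ideal[OF q] q unfolding A by blast
      moreover have "\<phi> (const (dg p) * X \<tau>) = dg p * \<phi> (X \<tau>)" using P Xt unfolding A by blast
      moreover have "\<phi> (q + const (dg p) * X \<tau>) = \<phi> q + \<phi> (const (dg p) * X \<tau>)"
        using P q homs_scale[OF Xt] unfolding A by blast
      ultimately show ?thesis using True \<open>\<phi> (X \<tau>) = 1\<close> by (simp add: q_def)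
    next
      case False
      then show ?thesis using P unfolding A by simp
    qed
  qed
  ultimately have "(THE \<phi>. ?P \<phi>) = ?\<phi>" by (rule the_equality)
  then have "chow_deg E r = ?\<phi>" unfolding chow_deg_def .
  then show ?thesis using p by simp
qed

end

section \<open>Hard Lefschetz and Hodge-Riemann in degrees 0 and 1\<close>

context chow_ample
begin

text \<open>The equality case of \<open>HR\<close> for the empty chain: the divisor pairs to 0 with
  all of degree d - 1, in particular with the chain monomials that \<open>poincare_duality_1\<close>
  tests.\<close>

lemma numerically_trivial:
  assumes d: "2 \<le> d" and prim: "dg (divisor E r u * L ^ (d - 1)) = 0"
    and zero: "dg (divisor E r u * divisor E r u * L ^ (d - 2)) = 0"
  shows "divisor E r u \<in> I"
proof (rule poincare_duality_1)
  fix m \<tau> assume m: "1 \<le> m" "m \<le> d" "\<tau> \<in> missing m"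
  have s: "Suc (d - 2) = d - 1" using d by simp
  have "card \<tau> = d - 1" using chain_card[OF missing_chain[OF m(3)]] missing_ranks[OF m(3)] m by simp
  then have "X \<tau> \<in> homs V (Suc (d - 2))" using X_homs[OF missing_chain[OF m(3)]] s by simp
  moreover have "HR {} (d - 2)" by (rule HR_all) (use d in auto)
  ultimately have "dg (X {} * divisor E r u * X \<tau>) = 0"
    using HR_D(2)[of "{}" "d - 2" u "X \<tau>"] prim zero unfolding s by simp
  then show "dg (X \<tau> * divisor E r u) = 0" by (simp add: mult.commute)
qed

lemma primitive_negative:
  assumes d: "2 \<le> d" and prim: "dg (divisor E r u * L ^ (d - 1)) = 0" and u: "divisor E r u \<notin> I"
  shows "dg (divisor E r u * divisor E r u * L ^ (d - 2)) < 0"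
proof -
  have s: "Suc (d - 2) = d - 1" using d by simp
  have "HR {} (d - 2)" by (rule HR_all) (use d in auto)
  then have "dg (divisor E r u * divisor E r u * L ^ (d - 2)) \<le> 0"
    using HR_D(1)[of "{}" "d - 2" u] prim unfolding s by simp
  then show ?thesis using numerically_trivial[OF d prim] u by linarith
qed

lemma L_pow_homs: "L ^ n \<in> homs V n"
  using homs_power[OF L_homs, of n] by simp

text \<open>By \<open>numerically_trivial\<close> the functional of w on divisors vanishes wherever
  those of all \<open>var F * L ^ (d - 2)\<close> do, so it is a combination of them. The
  coefficients form a preimage up to a class that pairs to 0 with every variable.\<close>

lemma hard_lefschetz_surj:
  assumes d: "2 \<le> d" and w: "w \<in> homs V (d - 1)"
  shows "\<exists>z\<in>homs V 1. L ^ (d - 2) * z - w \<in> I"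
proof -
  let ?f = "\<lambda>F u. dg (var F * L ^ (d - 2) * divisor E r u)"
  let ?g = "\<lambda>u. dg (w * divisor E r u)"
  have "\<exists>c. \<forall>u\<in>UNIV. ?g u = (\<Sum>F\<in>V. c F * ?f F u)"
  proof (rule functional_in_span)
    fix u assume z: "\<And>F. F \<in> V \<Longrightarrow> ?f F u = 0"
    have zv: "dg (divisor E r v * L ^ (d - 2) * divisor E r u) = 0" for v
    proof -
      have "divisor E r v * L ^ (d - 2) * divisor E r u = (\<Sum>F\<in>V. const (v F) * (var F * L ^ (d - 2) * divisor E r u))"
        by (simp add: divisor_def[of E r v] sum_distrib_right mult.assoc)
      then show ?thesis by (simp only: dg_sum dg_scale) (simp add: z)
    qed
    have s: "L ^ (d - 1) = L * L ^ (d - 2)" using d by (metis Suc_1 Suc_diff_le diff_Suc_Suc power_Suc)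
    have "dg (divisor E r u * L ^ (d - 1)) = 0" unfolding s using zv[of a] by (simp add: mult_ac)
    moreover have "dg (divisor E r u * divisor E r u * L ^ (d - 2)) = 0" using zv[of u] by (simp add: mult_ac)
    ultimately have "divisor E r u \<in> I" by (rule numerically_trivial[OF d])
    then show "?g u = 0" by (intro dg_ideal ideal_mult homs_vars[OF w])
  qed (simp_all add: divisor_add divisor_scale ring_distribs dg_add mult.left_commute[of _ "const _"] dg_scale)
  then obtain c where c: "\<And>u. ?g u = (\<Sum>F\<in>V. c F * ?f F u)" by blast
  have "L ^ (d - 2) * divisor E r c - w \<in> I"
  proof (rule poincare_duality_codim1)
    have "L ^ (d - 2) * divisor E r c \<in> homs V (d - 2 + 1)" by (intro homs_mult L_pow_homs divisor_homs)
    moreover have "d - 2 + 1 = d - 1" using d by simp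
    ultimately have "L ^ (d - 2) * divisor E r c \<in> homs V (d - 1)" by metis
    then show "L ^ (d - 2) * divisor E r c - w \<in> homs V (d - 1)" by (rule homs_diff[OF _ w])
    show "1 \<le> d" using d by simp
    fix F assume F: "F \<in> V"
    have "L ^ (d - 2) * divisor E r c * var F = (\<Sum>G\<in>V. const (c G) * (var G * L ^ (d - 2) * divisor E r (xi F)))"
      unfolding divisor_xi[OF F] divisor_def[of E r c] sum_distrib_left sum_distrib_right
      by (intro sum.cong refl) (simp add: mult_ac)
    then have "dg (L ^ (d - 2) * divisor E r c * var F) = ?g (xi F)"
      unfolding c[of "xi F"] by (simp only: dg_sum dg_scale)
    then show "dg ((L ^ (d - 2) * divisor E r c - w) * var F) = 0"
      by (simp add: left_diff_distrib dg_diff divisor_xi[OF F])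
  qed
  then show ?thesis using divisor_homs by blast
qed

lemma L_top_pos: "0 < dg (L ^ d)"
  using dg_pos[of "{}" d] by simp

lemma degree_0:
  shows "\<forall>z\<in>homs V 0. L ^ d * z \<in> I \<longrightarrow> z \<in> I"
    and "\<forall>w\<in>homs V d. \<exists>z\<in>homs V 0. L ^ d * z - w \<in> I"
    and "\<forall>z\<in>homs V 0. z \<notin> I \<longrightarrow> chow_deg E r (z * z * L ^ d) > 0"
proof -
  have val: "dg (L ^ d * const c) = c * dg (L ^ d)" for c
    using dg_scale[of c "L ^ d"] by (simp add: mult.commute)
  show "\<forall>z\<in>homs V 0. L ^ d * z \<in> I \<longrightarrow> z \<in> I"
  proof (intro ballI impI)
    fix z assume "z \<in> homs V 0" and z: "L ^ d * z \<in> I"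
    then obtain c where c: "z = const c" using homs_0_const by blast
    then have "c = 0" using dg_ideal[OF z] val[of c] L_top_pos by simp
    then show "z \<in> I" using c by simp
  qed
  show "\<forall>w\<in>homs V d. \<exists>z\<in>homs V 0. L ^ d * z - w \<in> I"
  proof
    fix w assume w: "w \<in> homs V d"
    let ?c = "dg w / dg (L ^ d)"
    have "L ^ d * const ?c \<in> homs V (d + 0)" by (intro homs_mult L_pow_homs homs_const)
    then have "L ^ d * const ?c - w \<in> homs V d" using w by (simp add: homs_diff)
    moreover have "dg (L ^ d * const ?c - w) = 0" using L_top_pos by (simp add: dg_diff val)
    ultimately have "L ^ d * const ?c - w \<in> I" by (rule top_degree_ideal)
    then show "\<exists>z\<in>homs V 0. L ^ d * z - w \<in> I" using homs_const by blast
  qed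
  show "\<forall>z\<in>homs V 0. z \<notin> I \<longrightarrow> chow_deg E r (z * z * L ^ d) > 0"
  proof (intro ballI impI)
    fix z assume "z \<in> homs V 0" and z: "z \<notin> I"
    then obtain c where c: "z = const c" using homs_0_const by blast
    have "c \<noteq> 0" using z c by auto
    have eq: "z * z * L ^ d = const (c * c) * L ^ d" by (simp add: c const_mult)
    have "chow_deg E r (z * z * L ^ d) = dg (z * z * L ^ d)"
      unfolding eq by (intro chow_deg_eq homs_scale L_pow_homs)
    also have "\<dots> = c * c * dg (L ^ d)" unfolding eq by (rule dg_scale)
    also have "\<dots> > 0" using \<open>c \<noteq> 0\<close> L_top_pos by (auto simp: zero_less_mult_iff linorder_neq_iff)
    finally show "chow_deg E r (z * z * L ^ d) > 0" .
  qed
qed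

lemma degree_1:
  assumes d: "2 \<le> d"
  shows "\<forall>z\<in>homs V 1. L ^ (d - 2) * z \<in> I \<longrightarrow> z \<in> I"
    and "\<forall>w\<in>homs V (d - 1). \<exists>z\<in>homs V 1. L ^ (d - 2) * z - w \<in> I"
    and "\<forall>z\<in>homs V 1. L ^ (d - 1) * z \<in> I \<and> z \<notin> I \<longrightarrow> - chow_deg E r (z * z * L ^ (d - 2)) > 0"
proof -
  have s: "L ^ (d - 1) = L * L ^ (d - 2)" using d by (metis Suc_1 Suc_diff_le diff_Suc_Suc power_Suc)
  show "\<forall>z\<in>homs V 1. L ^ (d - 2) * z \<in> I \<longrightarrow> z \<in> I"
  proof (intro ballI impI)
    fix z assume "z \<in> homs V 1" and z: "L ^ (d - 2) * z \<in> I"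
    then obtain u where u: "z = divisor E r u" using homs_1_divisor by blast
    have y: "dg (divisor E r v * (L ^ (d - 2) * z)) = 0" for v by (intro dg_ideal ideal_mult z divisor_vars)
    have "dg (divisor E r u * L ^ (d - 1)) = 0" unfolding s using y[of a] by (simp add: u mult_ac)
    moreover have "dg (divisor E r u * divisor E r u * L ^ (d - 2)) = 0" using y[of u] by (simp add: u mult_ac)
    ultimately show "z \<in> I" unfolding u by (rule numerically_trivial[OF d])
  qed
  show "\<forall>w\<in>homs V (d - 1). \<exists>z\<in>homs V 1. L ^ (d - 2) * z - w \<in> I"
    using hard_lefschetz_surj[OF d] by blast
  show "\<forall>z\<in>homs V 1. L ^ (d - 1) * z \<in> I \<and> z \<notin> I \<longrightarrow> - chow_deg E r (z * z * L ^ (d - 2)) > 0"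
  proof (intro ballI impI, elim conjE)
    fix z assume zh: "z \<in> homs V 1" and z: "L ^ (d - 1) * z \<in> I" "z \<notin> I"
    then obtain u where u: "z = divisor E r u" using homs_1_divisor by blast
    have "z * z * L ^ (d - 2) \<in> homs V (1 + 1 + (d - 2))" by (intro homs_mult zh L_pow_homs)
    moreover have "1 + 1 + (d - 2) = d" using d by simp
    ultimately have "z * z * L ^ (d - 2) \<in> homs V d" by metis
    then have "chow_deg E r (z * z * L ^ (d - 2)) = dg (z * z * L ^ (d - 2))" by (rule chow_deg_eq)
    moreover have "dg (z * z * L ^ (d - 2)) < 0"
      unfolding u by (rule primitive_negative[OF d]) (use dg_ideal[OF z(1)] z(2) u in \<open>simp_all add: mult.commute\<close>)
    ultimately show "- chow_deg E r (z * z * L ^ (d - 2)) > 0" by simp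
  qed
qed

end

theorem theorem6p7:
  fixes E :: "'a set" and r :: "'a set \<Rightarrow> nat" and d :: nat and a :: "'a set \<Rightarrow> real"
  assumes "matroid_rank E r" and "loopless E r" and "r E = d + 1"
    and "comb_ample_fun E a"
  defines "L \<equiv> divisor E r a" and "I \<equiv> chow_ideal E r" and "A \<equiv> chow_hom E r"
  shows "\<forall>i \<in> {0, 1}. i \<le> d div 2 \<longrightarrow>
     (\<comment> \<open>HL: multiplication by l^(d-2i) : A^i \<rightarrow> A^(d-i) is injective and surjective\<close>
      (\<forall>z \<in> A i. L ^ (d - 2 * i) * z \<in> I \<longrightarrow> z \<in> I)
    \<and> (\<forall>w \<in> A (d - i). \<exists>z \<in> A i. L ^ (d - 2 * i) * z - w \<in> I)
     \<comment> \<open>HR: the Hodge-Riemann form is positive definite on the primitive part\<close>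
    \<and> (\<forall>z \<in> A i. L ^ (d - 2 * i + 1) * z \<in> I \<and> z \<notin> I \<longrightarrow>
         (-1) ^ i * chow_deg E r (z * z * L ^ (d - 2 * i)) > 0))"
proof -
  interpret chow_ample E r d a using assms(1-4) by unfold_locales
  have A: "A = homs (np_flats E r)" unfolding A_def by (rule ext) (rule chow_hom_eq)
  show ?thesis
  proof (intro ballI impI)
    fix i :: nat assume "i \<in> {0, 1}" and i: "i \<le> d div 2"
    \<comment> \<open>The bound on i excludes i = 1 when d < 2, where d - 2 would be
      truncated.\<close>
    then consider "i = 0" | "i = 1" "2 \<le> d" by fastforce
    then show "(\<forall>z \<in> A i. L ^ (d - 2 * i) * z \<in> I \<longrightarrow> z \<in> I)
    \<and> (\<forall>w \<in> A (d - i). \<exists>z \<in> A i. L ^ (d - 2 * i) * z - w \<in> I)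
    \<and> (\<forall>z \<in> A i. L ^ (d - 2 * i + 1) * z \<in> I \<and> z \<notin> I \<longrightarrow>
         (-1) ^ i * chow_deg E r (z * z * L ^ (d - 2 * i)) > 0)"
    proof cases
      case 1
      then show ?thesis using degree_0 unfolding A L_def I_def by simp
    next
      case 2
      then have "d - 2 + 1 = d - 1" by simp
      then show ?thesis using degree_1[OF 2(2)] 2(1) unfolding A L_def I_def by simp
    qed
  qed
qed

end
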